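(* Let $Z=[z_0:z_1:\ldots:z_n]$ be the homogeneous coordinate system of $\mathbb{CP}^n$, and let $\Lambda=\sum_{\alpha,\beta}\overleftarrow{\partial_{Z_\alpha}}\,\Lambda^{\alpha,\beta}\,\overrightarrow{\partial_{Z_\beta}}$ be a holomorphic skew-symmetric biderivation of order zero acting on the structure sheaf $\mathcal{O}_{\mathbb{CP}^n}$ which satisfies the Jacobi rule and, for every $k\ge 1$, $$\bigl(\overleftarrow{\partial_{Z_{\alpha_1}}}\Lambda^{\alpha_1,\beta_1}\overrightarrow{\partial_{Z_{\beta_1}}}\bigr)\cdots\bigl(\overleftarrow{\partial_{Z_{\alpha_k}}}\Lambda^{\alpha_k,\beta_k}\overrightarrow{\partial_{Z_{\beta_k}}}\bigr)=\overleftarrow{\partial_{Z_{\alpha_1\ldots\alpha_k}}}\,\Lambda^{\alpha_1,\beta_1}\cdots\Lambda^{\alpha_k,\beta_k}\,\overrightarrow{\partial_{Z_{\beta_1\ldots\beta_k}}}.$$ Let $A[Z]:=ZA\,{}^tZ$ be a quadratic form, homogeneous of degree $2$, where $A$ is a complex symmetric matrix. Then $$e_\star^{\frac1\mu A[Z]}={\det}^{-1/2}\Bigl(\frac{e^{\Lambda A}+e^{-\Lambda A}}{2}\Bigr)\cdot e^{\frac1\mu\left(\frac{\Lambda^{-1}}{\sqrt{-1}}\tan(\sqrt{-1}\,\Lambda A)\right)[Z]}\;\in\;\sum_{k=0}^\infty H^0\bigl(\mathbb{CP}^n,\mathcal{O}_{\mathbb{CP}^n}(k)[\mu,\mu^{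-1}]]\bigr).$$
   Context: Indices run over $0,\dots,n$, and repeated indices are summed (Einstein convention). Sections of $\mathcal{O}_{\mathbb{CP}^n}(k)$ are regarded as holomorphic functions of $Z=(z_0,\dots,z_n)$, homogeneous of degree $k$, so that $H^0(\mathbb{CP}^n,\mathcal{O}(k))$ is the space of homogeneous polynomials of degree $k$; $\partial_{Z_\alpha}=\partial/\partial z_\alpha$. The biderivation is $f\Lambda g=\Lambda^{\alpha,\beta}(Z)\,\partial_{Z_\alpha}f\,\partial_{Z_\beta}g$ with holomorphic coefficients, $\Lambda^{\alpha,\beta}=-\Lambda^{\beta,\alpha}$; $\Lambda$ also denotes the $(n+1)\times(n+1)$ matrix $(\Lambda^{\alpha,\beta}(Z))$. "Order zero" means that the biderivation preserves homogeneity degree (the coefficients $\Lambda^{\alpha,\beta}$ are homogeneous of degree $2$ in $Z$). The Jacobi rule means that $\{f,g\}=f\Lambda g$ satisfies the Jacobi identity. Arrow notation: $f\,\overleftarrow{\partial_{Z_{\alpha_1\ldots\alpha_k}}}$ means $\partial_{Z_{\alpha_1}}\cdots\partial_{Z_{\alpha_k}}f$, and $\overrightarrow{\partial_{Z_{\beta_1\ldots\beta_k}}}\,g$ means $\partial_{Z_{\beta_1}}\cdots\partial_{Z_{\beta_k}}g$. The displayed assumption on $\Lambda$ is an identity of bidifferential operators, applied between arbitrary homogeneous holomorphic functions $f$ (on the left) and $g$ (on the right); in the product on the left-hand side, each left-pointing arrow differentiates (by the Leibniz rule) everything to its left, and each right-pointing arrow everything to its right, including the coefficients $\Lambda^{\alpha_i,\beta_i}$.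 The product is $$f\star g=\sum_{k=0}^\infty\frac1{k!}\Bigl(\frac{\mu}{2}\Bigr)^k\Lambda^{\alpha_1\beta_1}\cdots\Lambda^{\alpha_k\beta_k}\,\partial_{Z_{\alpha_1}}\cdots\partial_{Z_{\alpha_k}}f\;\partial_{Z_{\beta_1}}\cdots\partial_{Z_{\beta_k}}g .$$ The star exponential $e_\star^{\frac1\mu A[Z]}$ is $F(1)$, where $F(t)=e_\star^{t\frac1\mu A[Z]}$ is the solution of $\partial_tF=\frac1\mu A[Z]\star F$ with $F(0)=1$. For a matrix $M$, $M[Z]:=ZM\,{}^tZ$. The expression $\frac{\Lambda^{-1}}{\sqrt{-1}}\tan(\sqrt{-1}\Lambda A)$ is understood via the power series of $\tan$ (in which the leading factor $\Lambda$ cancels with $\Lambda^{-1}$), and $\det^{-1/2}$ is the branch with value $1$ at the identity matrix. $\sum_{k=0}^\infty$ in the membership statement allows infinite formal sums of homogeneous components, and $[\mu,\mu^{-1}]]$ denotes adjoining the formal parameter $\mu$ with formal power series in $\mu^{-1}$ allowed. *)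

theory Defs
  imports "HOL-Analysis.Analysis" "HOL-Computational_Algebra.Formal_Laurent_Series"
begin

unbundle no fps_syntax

text \<open>
  The index set \<open>{0,\<dots>,n}\<close> is a finite type \<open>'n\<close> (so \<open>n + 1 = CARD('n)\<close>), and
  \<open>Z = (z\<^sub>0,\<dots>,z\<^sub>n)\<close> is a vector of type \<open>complex ^ 'n\<close>.
\<close>

section \<open>Sections of O(k) as homogeneous holomorphic functions\<close>

definition holomorphic_fun :: "(complex ^ 'n::finite \<Rightarrow> complex) \<Rightarrow> bool" where
  "holomorphic_fun f \<longleftrightarrow>
     (\<forall>Z. \<exists>D. (f has_derivative D) (at Z) \<and> (\<forall>c v. D (c *s v) = c * D v))"

definition H0 :: "nat \<Rightarrow> (complex ^ 'n::finite \<Rightarrow> complex) set" where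
  "H0 k = {f. holomorphic_fun f \<and> (\<forall>c Z. f (c *s Z) = c ^ k * f Z)}"

definition pd :: "'n::finite \<Rightarrow> (complex ^ 'n \<Rightarrow> complex) \<Rightarrow> complex ^ 'n \<Rightarrow> complex" where
  "pd \<alpha> f Z = deriv (\<lambda>t. f (Z + axis \<alpha> t)) 0"

definition pds :: "'n::finite list \<Rightarrow> (complex ^ 'n \<Rightarrow> complex) \<Rightarrow> complex ^ 'n \<Rightarrow> complex" where
  "pds \<alpha>s f = foldr pd \<alpha>s f"

definition multi_indices :: "nat \<Rightarrow> 'n::finite list set" where
  "multi_indices k = {\<alpha>s. length \<alpha>s = k}"

section \<open>The biderivation\<close>

definition bracket ::
  "('n::finite \<Rightarrow> 'n \<Rightarrow> complex ^ 'n \<Rightarrow> complex) \<Rightarrow> (complex ^ 'n \<Rightarrow> complex) \<Rightarrow>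
   (complex ^ 'n \<Rightarrow> complex) \<Rightarrow> complex ^ 'n \<Rightarrow> complex" where
  "bracket \<Lambda> f g Z = (\<Sum>\<alpha>\<in>UNIV. \<Sum>\<beta>\<in>UNIV. \<Lambda> \<alpha> \<beta> Z * pd \<alpha> f Z * pd \<beta> g Z)"

definition jacobi_rule :: "('n::finite \<Rightarrow> 'n \<Rightarrow> complex ^ 'n \<Rightarrow> complex) \<Rightarrow> bool" where
  "jacobi_rule \<Lambda> \<longleftrightarrow>
     (\<forall>a b c. \<forall>f\<in>H0 a. \<forall>g\<in>H0 b. \<forall>h\<in>H0 c. \<forall>Z.
        bracket \<Lambda> f (bracket \<Lambda> g h) Z + bracket \<Lambda> g (bracket \<Lambda> h f) Z
          + bracket \<Lambda> h (bracket \<Lambda> f g) Z = 0)"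

text \<open>
  In the product of \<open>k\<close> arrow operators put between \<open>f\<close> and \<open>g\<close>, the factors that get
  differentiated stand, from left to right, at the positions \<open>0,\<dots>,k+1\<close>: \<open>f\<close> at position \<open>0\<close>,
  the \<open>j\<close>-th coefficient (\<open>j = 0,\<dots>,k-1\<close>) at position \<open>j+1\<close>, and \<open>g\<close> at position \<open>k+1\<close>.
  The \<open>j\<close>-th left arrow acts on the positions \<open>0,\<dots>,j\<close> and the \<open>j\<close>-th right arrow on the
  positions \<open>j+2,\<dots>,k+1\<close>.  Expanding all arrows by the Leibniz rule is a sum over all choices
  \<open>\<phi> j\<close>, \<open>\<psi> j\<close> of the position which the \<open>j\<close>-th left resp. right arrow differentiates.
\<close>

definition arrow_factor ::
  "('n::finite \<Rightarrow> 'n \<Rightarrow> complex ^ 'n \<Rightarrow> complex) \<Rightarrow> nat \<Rightarrow> 'n list \<Rightarrow> 'n list \<Rightarrow>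
   (complex ^ 'n \<Rightarrow> complex) \<Rightarrow> (complex ^ 'n \<Rightarrow> complex) \<Rightarrow> nat \<Rightarrow> complex ^ 'n \<Rightarrow> complex" where
  "arrow_factor \<Lambda> k \<alpha>s \<beta>s f g p =
     (if p = 0 then f else if p = k + 1 then g else \<Lambda> (\<alpha>s ! (p - 1)) (\<beta>s ! (p - 1)))"

definition arrow_product ::
  "('n::finite \<Rightarrow> 'n \<Rightarrow> complex ^ 'n \<Rightarrow> complex) \<Rightarrow> nat \<Rightarrow>
   (complex ^ 'n \<Rightarrow> complex) \<Rightarrow> (complex ^ 'n \<Rightarrow> complex) \<Rightarrow> complex ^ 'n \<Rightarrow> complex" where
  "arrow_product \<Lambda> k f g Z =
     (\<Sum>\<alpha>s\<in>multi_indices k. \<Sum>\<beta>s\<in>multi_indices k.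
      \<Sum>\<phi>\<in>(\<Pi>\<^sub>E j\<in>{..<k}. {0..j}). \<Sum>\<psi>\<in>(\<Pi>\<^sub>E j\<in>{..<k}. {j + 2..k + 1}).
      \<Prod>p\<in>{0..k + 1}.
        pds (map ((!) \<alpha>s) (filter (\<lambda>j. \<phi> j = p) [0..<k]) @
             map ((!) \<beta>s) (filter (\<lambda>j. \<psi> j = p) [0..<k]))
          (arrow_factor \<Lambda> k \<alpha>s \<beta>s f g p) Z)"

definition normal_ordered_product ::
  "('n::finite \<Rightarrow> 'n \<Rightarrow> complex ^ 'n \<Rightarrow> complex) \<Rightarrow> nat \<Rightarrow>
   (complex ^ 'n \<Rightarrow> complex) \<Rightarrow> (complex ^ 'n \<Rightarrow> complex) \<Rightarrow> complex ^ 'n \<Rightarrow> complex" where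
  "normal_ordered_product \<Lambda> k f g Z =
     (\<Sum>\<alpha>s\<in>multi_indices k. \<Sum>\<beta>s\<in>multi_indices k.
        (\<Prod>i<k. \<Lambda> (\<alpha>s ! i) (\<beta>s ! i) Z) * pds \<alpha>s f Z * pds \<beta>s g Z)"

section \<open>Formal sums of sections with coefficients in C[mu, 1/mu]]\<close>

text \<open>
  The variable of \<open>fls\<close> is \<open>1/\<mu>\<close>: a Laurent series has finitely many negative powers of its
  variable, so \<open>complex fls\<close> allows finitely many positive and infinitely many negative powers
  of \<open>\<mu>\<close>.  The variable of \<open>fps\<close> only records the homogeneity degree in \<open>Z\<close>: a formal sum
  \<open>\<Sum>\<^sub>k F\<^sub>k\<close> with \<open>F\<^sub>k\<close> homogeneous of degree \<open>k\<close> is the function assigning to \<open>Z\<close> the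
  power series with coefficients \<open>F\<^sub>k(Z)\<close>.  Products of formal sums are then pointwise products.
  Infinite sums of power series below are limits in the metric topology of \<open>fps\<close>, that is,
  each coefficient becomes stationary.
\<close>

type_synonym scalar = "complex fls fps"

type_synonym 'n formal = "complex ^ 'n \<Rightarrow> scalar"

definition formal_sections :: "('n::finite) formal set" where
  "formal_sections = {F. \<forall>k.
     (\<forall>m. (\<lambda>Z. fls_nth (fps_nth (F Z) k) m) \<in> H0 k) \<and>
     (\<exists>N. \<forall>m<N. \<forall>Z. fls_nth (fps_nth (F Z) k) m = 0)}"

definition const :: "complex \<Rightarrow> scalar" where
  "const c = fps_const (fls_const c)"

definition mu :: scalar where
  "mu = fps_const fls_X_inv"

definition inv_mu :: scalar where
  "inv_mu = fps_const fls_X"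

definition homog :: "nat \<Rightarrow> (complex ^ 'n::finite \<Rightarrow> complex) \<Rightarrow> 'n formal" where
  "homog k f = (\<lambda>Z. const (f Z) * fps_X ^ k)"

text \<open>Coefficientwise; a partial derivative turns degree \<open>k + 1\<close> into degree \<open>k\<close>.\<close>

definition fpd :: "'n::finite \<Rightarrow> 'n formal \<Rightarrow> 'n formal" where
  "fpd \<alpha> F = (\<lambda>Z. Abs_fps (\<lambda>k. Abs_fls (\<lambda>m.
     pd \<alpha> (\<lambda>W. fls_nth (fps_nth (F W) (k + 1)) m) Z)))"

definition fpds :: "'n::finite list \<Rightarrow> 'n formal \<Rightarrow> 'n formal" where
  "fpds \<alpha>s F = foldr fpd \<alpha>s F"

section \<open>The star product and the star exponential\<close>

definition star ::
  "('n::finite \<Rightarrow> 'n \<Rightarrow> complex ^ 'n \<Rightarrow> complex) \<Rightarrow> 'n formal \<Rightarrow> 'n formal \<Rightarrow> 'n formal" where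
  "star \<Lambda> F G = (\<lambda>Z. \<Sum>k. const (1 / fact k) * (const (1 / 2) * mu) ^ k *
     (\<Sum>\<alpha>s\<in>multi_indices k. \<Sum>\<beta>s\<in>multi_indices k.
        (\<Prod>i<k. homog 2 (\<Lambda> (\<alpha>s ! i) (\<beta>s ! i)) Z) * fpds \<alpha>s F Z * fpds \<beta>s G Z))"

definition star_flow ::
  "('n::finite \<Rightarrow> 'n \<Rightarrow> complex ^ 'n \<Rightarrow> complex) \<Rightarrow> 'n formal \<Rightarrow> (real \<Rightarrow> 'n formal) \<Rightarrow> bool" where
  "star_flow \<Lambda> H F \<longleftrightarrow>
     (\<forall>t. F t \<in> formal_sections) \<and> F 0 = (\<lambda>Z. 1) \<and>
     (\<forall>t Z k m. ((\<lambda>s. fls_nth (fps_nth (F s Z) k) m) has_vector_derivative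
        fls_nth (fps_nth (star \<Lambda> H (F t) Z) k) m) (at t))"

definition star_exp ::
  "('n::finite \<Rightarrow> 'n \<Rightarrow> complex ^ 'n \<Rightarrow> complex) \<Rightarrow> 'n formal \<Rightarrow> 'n formal" where
  "star_exp \<Lambda> H = (THE F. star_flow \<Lambda> H F) 1"

section \<open>Matrix functions\<close>

definition Lambda_matrix ::
  "('n::finite \<Rightarrow> 'n \<Rightarrow> complex ^ 'n \<Rightarrow> complex) \<Rightarrow> complex ^ 'n \<Rightarrow> scalar ^ 'n ^ 'n" where
  "Lambda_matrix \<Lambda> Z = (\<chi> \<alpha> \<beta>. homog 2 (\<Lambda> \<alpha> \<beta>) Z)"

definition const_matrix :: "complex ^ 'n ^ 'n \<Rightarrow> scalar ^ 'n ^ 'n" where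
  "const_matrix A = (\<chi> i j. const (A $ i $ j))"

definition scale_matrix :: "scalar \<Rightarrow> scalar ^ 'n ^ 'n \<Rightarrow> scalar ^ 'n ^ 'n" where
  "scale_matrix c M = (\<chi> i j. c * M $ i $ j)"

definition matrix_power :: "scalar ^ 'n ^ 'n \<Rightarrow> nat \<Rightarrow> scalar ^ 'n::finite ^ 'n" where
  "matrix_power M k = (((**) M) ^^ k) (mat 1)"

definition matrix_series :: "complex fps \<Rightarrow> scalar ^ 'n ^ 'n \<Rightarrow> scalar ^ 'n::finite ^ 'n" where
  "matrix_series c M = (\<chi> i j. \<Sum>k. const (fps_nth c k) * matrix_power M k $ i $ j)"

definition matrix_exp :: "scalar ^ 'n ^ 'n \<Rightarrow> scalar ^ 'n::finite ^ 'n" where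
  "matrix_exp M = matrix_series (fps_exp 1) M"

text \<open>
  With \<open>tan w = w * \<tau>(w)\<close>, i.e. \<open>\<tau> = fps_shift 1 (fps_tan 1)\<close>, cancelling the leading
  \<open>\<Lambda>\<close> in \<open>\<Lambda>\<^sup>-\<^sup>1/\<i> * tan(\<i> \<Lambda> A) = \<Lambda>\<^sup>-\<^sup>1/\<i> * (\<i> \<Lambda> A) * \<tau>(\<i> \<Lambda> A)\<close> leaves
  \<open>A * \<tau>(\<i> \<Lambda> A)\<close>, which makes sense for singular \<open>\<Lambda>\<close> as well.
\<close>

definition Lambda_inv_tan :: "scalar ^ 'n ^ 'n \<Rightarrow> scalar ^ 'n ^ 'n \<Rightarrow> scalar ^ 'n::finite ^ 'n" where
  "Lambda_inv_tan L A =
     A ** matrix_series (fps_shift 1 (fps_tan 1)) (scale_matrix (const \<i>) (L ** A))"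

text \<open>The first argument of \<open>fps_radical\<close> selects \<open>1\<close> as the root of the constant term.\<close>

definition det_inv_sqrt :: "scalar ^ 'n ^ 'n \<Rightarrow> scalar" where
  "det_inv_sqrt M = inverse (fps_radical (\<lambda>_ _. 1) 2 (det M))"

definition quad_form :: "scalar ^ 'n ^ 'n \<Rightarrow> complex ^ 'n::finite \<Rightarrow> scalar" where
  "quad_form M Z = (\<Sum>i\<in>UNIV. \<Sum>j\<in>UNIV.
     homog 1 (\<lambda>W. W $ i) Z * M $ i $ j * homog 1 (\<lambda>W. W $ j) Z)"

definition formal_exp :: "scalar \<Rightarrow> scalar" where
  "formal_exp x = fps_compose (fps_exp 1) x"

end

theory Submission
  imports Defs "HOL-Complex_Analysis.Cauchy_Integral_Formula"
begin

text \<open>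
  The hypotheses force the coefficients of \<open>\<Lambda>\<close> to be Casimirs, and then the computation runs as for
  a constant \<open>\<Lambda>\<close>.

  Put \<open>X\<^sub>a = \<Lambda>\<^sup>a\<^sup>d \<partial>\<^sub>d\<close>, the Hamiltonian field of the coordinate \<open>z\<^sub>a\<close>, and
  \<open>T\<^sup>c\<^sup>a\<^sup>b = X\<^sub>c \<Lambda>\<^sup>a\<^sup>b\<close>.  Skewness makes \<open>T\<close> antisymmetric in its last two indices.  The arrow identity for
  \<open>k = 2\<close>, tested on \<open>f = z\<^sub>a\<close> and on \<open>g = z\<^sub>b\<close> or \<open>g = z\<^sub>b z\<^sub>c\<close>, makes it antisymmetric in the outer two, so
  \<open>T\<close> is totally antisymmetric; the Jacobi rule says that its cyclic sum \<open>3 T\<close> vanishes.  Hence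
  \<open>X\<^sub>c \<Lambda>\<^sup>a\<^sup>b = 0\<close> (\<open>coefficients_central\<close>), and every series in the entries of \<open>\<Lambda> A\<close> is killed by all \<open>X\<^sub>a\<close>.

  Multiplication by \<open>A[Z]/\<mu>\<close> is a differential operator of order two (\<open>star_hamiltonian\<close>), and it
  raises the homogeneity degree by exactly two.  The evolution equation is therefore triangular in the
  degree: solutions are unique (\<open>star_flow_unique\<close>), and the component of degree \<open>k\<close> of the solution at
  time \<open>t\<close> is \<open>t\<^sup>k\<^sup>/\<^sup>2\<close> times the one at time \<open>1\<close>.  So time can be traded for degree: with
  \<open>\<theta> = X d/dX\<close> the operator that multiplies the component of degree \<open>k\<close> by \<open>k\<close>, a formal section \<open>G\<close>
  with constant term \<open>1\<close> is the star exponential as soon as \<open>\<theta> G = 2 (A[Z]/\<mu>) \<star> G\<close>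
  (\<open>star_flow_of_grading\<close>).

  For the closed form this is checked directly.  Let \<open>M = \<Lambda> A\<close> and \<open>\<Lambda> Q = tanh M\<close>.  The degree operator gives
  \<open>\<theta> G = (\<theta> (Q[Z]/\<mu>) - tr (M tanh M)) G\<close>, by Jacobi's formula for the determinant and
  \<open>tanh' = 1 - tanh\<^sup>2\<close> for the exponent.  On the other side, such a first-order equation
  determines \<open>G\<close>, and so \<open>X\<^sub>a G = X\<^sub>a (Q[Z]/\<mu>) G\<close> with \<open>X\<^sub>a Q = 0\<close> (\<open>ham_ode\<close>): the determinant factor is a
  Casimir as well.  Inserting this into the second-order operator leaves an identity between matrices
  (\<open>star_closed_form\<close>).  The same first-order equation shows recursively that the components of \<open>G\<close>
  are holomorphic (\<open>ode_formal_sections\<close>); this uses that partial derivatives of homogeneous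
  holomorphic functions are again such functions (\<open>pd_in_H0\<close>).
\<close>

unbundle no Formal_Power_Series.fps_syntax

section \<open>Homogeneous holomorphic functions and their partial derivatives\<close>

lemma axis_eq_smult: "axis i (t::complex) = t *s axis i 1"
  by (simp add: axis_def vec_eq_iff)

lemma holomorphic_fun_line:
  assumes "holomorphic_fun f"
  shows "\<exists>d. ((\<lambda>t. f (Z + t *s v)) has_field_derivative d) (at t0)"
proof -
  obtain D where D: "(f has_derivative D) (at (Z + t0 *s v))" "\<And>c v. D (c *s v) = c * D v"
    using assms unfolding holomorphic_fun_def by blast
  have 1: "((\<lambda>t. Z + t *s v) has_derivative (\<lambda>t. t *s v)) (at t0)"
  proof -
    have "bounded_linear (\<lambda>t::complex. t *s v)"
      unfolding linear_conv_bounded_linear[symmetric]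
      by (rule linearI) (auto simp: vec_eq_iff algebra_simps)
    then have "((\<lambda>t. t *s v) has_derivative (\<lambda>t. t *s v)) (at t0)"
      by (rule bounded_linear_imp_has_derivative)
    from has_derivative_add[OF has_derivative_const[of Z] this] show ?thesis by simp
  qed
  have "((\<lambda>t. f (Z + t *s v)) has_derivative (\<lambda>t. D (t *s v))) (at t0)"
    using diff_chain_at[OF 1 D(1)] by (simp add: o_def)
  then show ?thesis unfolding has_field_derivative_def D(2) 
    by (intro exI[of _ "D v"]) (simp add: mult.commute[of _ "D v"])
qed

lemma pd_has_derivative:
  assumes "holomorphic_fun f"
  shows "((\<lambda>t. f (Z + axis i t)) has_field_derivative pd i f Z) (at 0)"
  using holomorphic_fun_line[OF assms, of Z "axis i 1" 0]
  unfolding pd_def axis_eq_smult[symmetric] using DERIV_imp_deriv by force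

lemma pd_eqI:
  assumes "((\<lambda>t. f (Z + axis i t)) has_field_derivative d) (at 0)"
  shows "pd i f Z = d"
  using assms unfolding pd_def by (rule DERIV_imp_deriv)

lemma axis_zero: "axis i (0::complex) = 0" by (simp add: axis_def vec_eq_iff)

lemma pd_const [simp]: "pd i (\<lambda>Z. c) = (\<lambda>Z. 0)"
  by (rule ext, rule pd_eqI) simp

lemma pd_add:
  assumes "holomorphic_fun f" "holomorphic_fun g"
  shows "pd i (\<lambda>Z. f Z + g Z) Z = pd i f Z + pd i g Z"
  by (rule pd_eqI) (intro DERIV_add pd_has_derivative assms)

lemma pd_sum:
  assumes "\<And>x. x \<in> I \<Longrightarrow> holomorphic_fun (f x)"
  shows "pd i (\<lambda>Z. \<Sum>x\<in>I. f x Z) Z = (\<Sum>x\<in>I. pd i (f x) Z)"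
  by (rule pd_eqI, rule DERIV_sum) (auto intro: pd_has_derivative assms)

lemma pd_mult:
  assumes "holomorphic_fun f" "holomorphic_fun g"
  shows "pd i (\<lambda>Z. f Z * g Z) Z = pd i f Z * g Z + f Z * pd i g Z"
  by (rule pd_eqI, rule derivative_eq_intros, rule pd_has_derivative[OF assms(1)],
      rule pd_has_derivative[OF assms(2)]) (simp add: axis_zero algebra_simps)

lemma pd_cmult:
  assumes "holomorphic_fun f"
  shows "pd i (\<lambda>Z. c * f Z) Z = c * pd i f Z"
  by (rule pd_eqI) (intro DERIV_cmult pd_has_derivative assms)

lemma pd_coord: "pd i (\<lambda>Z. Z $ j) Z = (if i = j then 1 else 0)"
  by (rule pd_eqI) (auto simp: axis_def intro!: derivative_eq_intros)

lemma holomorphic_fun_const: "holomorphic_fun (\<lambda>Z. c)"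
  unfolding holomorphic_fun_def by (auto intro!: exI[of _ "\<lambda>_. 0"])

lemma holomorphic_fun_coord: "holomorphic_fun (\<lambda>Z. Z $ i)"
  unfolding holomorphic_fun_def
  by (auto intro!: exI[of _ "\<lambda>v. v $ i"] bounded_linear_imp_has_derivative bounded_linear_vec_nth)

lemma holomorphic_fun_add:
  assumes "holomorphic_fun f" "holomorphic_fun g"
  shows "holomorphic_fun (\<lambda>Z. f Z + g Z)"
  unfolding holomorphic_fun_def
proof
  fix Z
  obtain D E where D: "(f has_derivative D) (at Z)" "\<And>c v. D (c *s v) = c * D v"
    and E: "(g has_derivative E) (at Z)" "\<And>c v. E (c *s v) = c * E v"
    using assms unfolding holomorphic_fun_def by metis
  show "\<exists>D. ((\<lambda>Z. f Z + g Z) has_derivative D) (at Z) \<and> (\<forall>c v. D (c *s v) = c * D v)"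
    by (rule exI[of _ "\<lambda>v. D v + E v"])
       (auto intro!: has_derivative_add D(1) E(1) simp: D(2) E(2) algebra_simps)
qed

lemma holomorphic_fun_mult:
  assumes "holomorphic_fun f" "holomorphic_fun g"
  shows "holomorphic_fun (\<lambda>Z. f Z * g Z)"
  unfolding holomorphic_fun_def
proof
  fix Z
  obtain D E where D: "(f has_derivative D) (at Z)" "\<And>c v. D (c *s v) = c * D v"
    and E: "(g has_derivative E) (at Z)" "\<And>c v. E (c *s v) = c * E v"
    using assms unfolding holomorphic_fun_def by metis
  show "\<exists>D. ((\<lambda>Z. f Z * g Z) has_derivative D) (at Z) \<and> (\<forall>c v. D (c *s v) = c * D v)"
    by (rule exI[of _ "\<lambda>v. f Z * E v + D v * g Z"])
       (use has_derivative_mult[OF D(1) E(1)] in \<open>simp add: D(2) E(2) distrib_left mult_ac\<close>)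
qed

lemma holomorphic_fun_sum:
  assumes "\<And>x. x \<in> I \<Longrightarrow> holomorphic_fun (f x)"
  shows "holomorphic_fun (\<lambda>Z. \<Sum>x\<in>I. f x Z)"
  using assms
  by (induction I rule: infinite_finite_induct)
     (auto intro: holomorphic_fun_add holomorphic_fun_const)

lemma holomorphic_fun_translate:
  assumes "holomorphic_fun f"
  shows "holomorphic_fun (\<lambda>Z. f (Z + v))"
  unfolding holomorphic_fun_def
proof
  fix Z
  obtain D where D: "(f has_derivative D) (at (Z + v))" "\<And>c v. D (c *s v) = c * D v"
    using assms unfolding holomorphic_fun_def by metis
  have 1: "((\<lambda>Z. Z + v) has_derivative (\<lambda>h. h)) (at Z)"
    by (auto intro!: derivative_eq_intros)
  have "((\<lambda>Z. f (Z + v)) has_derivative D) (at Z)"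
    using diff_chain_at[OF 1 D(1)] by (simp add: o_def)
  then show "\<exists>D. ((\<lambda>Z. f (Z + v)) has_derivative D) (at Z) \<and> (\<forall>c v. D (c *s v) = c * D v)"
    using D(2) by blast
qed

lemma holomorphic_fun_imp_continuous:
  assumes "holomorphic_fun f"
  shows "continuous_on UNIV f"
  using assms unfolding holomorphic_fun_def
  by (meson continuous_at_imp_continuous_on has_derivative_continuous)

lemma H0_holomorphic [intro]: "f \<in> H0 k \<Longrightarrow> holomorphic_fun f"
  by (simp add: H0_def)

lemma H0_homogeneous: "f \<in> H0 k \<Longrightarrow> f (c *s Z) = c ^ k * f Z"
  by (simp add: H0_def)

lemma H0_zero [simp]: "(\<lambda>Z. 0) \<in> H0 k"
  by (simp add: H0_def holomorphic_fun_const)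

lemma H0_const [simp]: "(\<lambda>Z. c) \<in> H0 0"
  by (simp add: H0_def holomorphic_fun_const)

lemma H0_coord [simp]: "(\<lambda>Z. Z $ i) \<in> H0 1"
  by (simp add: H0_def holomorphic_fun_coord)

lemma H0_add: "f \<in> H0 k \<Longrightarrow> g \<in> H0 k \<Longrightarrow> (\<lambda>Z. f Z + g Z) \<in> H0 k"
  by (simp add: H0_def holomorphic_fun_add algebra_simps)

lemma H0_mult: "f \<in> H0 a \<Longrightarrow> g \<in> H0 b \<Longrightarrow> (\<lambda>Z. f Z * g Z) \<in> H0 (a + b)"
  by (simp add: H0_def holomorphic_fun_mult power_add)

lemma H0_cmult: "f \<in> H0 k \<Longrightarrow> (\<lambda>Z. c * f Z) \<in> H0 k"
  using H0_mult[OF H0_const] by fastforce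

lemma H0_sum: "(\<And>x. x \<in> I \<Longrightarrow> f x \<in> H0 k) \<Longrightarrow> (\<lambda>Z. \<Sum>x\<in>I. f x Z) \<in> H0 k"
  by (induction I rule: infinite_finite_induct) (auto intro: H0_add)

lemma H0_degree_0: "f \<in> H0 0 \<Longrightarrow> f Z = f 0"
  using H0_homogeneous[of f 0 0 Z] by simp

lemma pd_degree_0: "f \<in> H0 0 \<Longrightarrow> pd i f = (\<lambda>Z. 0)"
proof -
  assume "f \<in> H0 0"
  then have "f = (\<lambda>_. f 0)" using H0_degree_0 by blast
  then have "pd i f = pd i (\<lambda>_. f 0)" by (rule arg_cong)
  then show ?thesis by simp
qed

section \<open>Partial derivatives of homogeneous holomorphic functions\<close>

text \<open>
  Homogeneity and compactness of the unit sphere give \<open>\<bar>f W\<bar> \<le> B \<parallel>W\<parallel>\<^sup>k\<close>, so the restriction of \<open>f\<close> to a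
  complex line is an entire function of polynomial growth, and Liouville's theorem applies.
\<close>
lemma H0_line_polynomial:
  assumes f: "f \<in> H0 k"
  obtains a where "\<And>t. f (Z + t *s v) = (\<Sum>j\<le>k. a j * t ^ j)"
proof -
  define h where "h = (\<lambda>t. f (Z + t *s v))"
  have hol: "h holomorphic_on UNIV"
    unfolding h_def holomorphic_on_def field_differentiable_def
    using holomorphic_fun_line[OF H0_holomorphic[OF f]] by (auto intro: has_field_derivative_at_within)
  have "compact (f ` sphere 0 1)"
    using holomorphic_fun_imp_continuous[OF H0_holomorphic[OF f]]
    by (intro compact_continuous_image) (auto intro: continuous_on_subset)
  then obtain B where B0: "B > 0" and B: "\<And>W. norm W = 1 \<Longrightarrow> norm (f W) \<le> B"
    using compact_imp_bounded bounded_pos by (metis (no_types, lifting) imageI mem_sphere_0)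
  have scale: "norm (f W) \<le> B * norm W ^ k" for W
  proof (cases "W = 0")
    case True
    show ?thesis
    proof (cases "k = 0")
      case True
      \<comment> \<open>For \<open>k = 0\<close> the function is constant, so its value at \<open>0\<close> is a value on the unit sphere.\<close>
      have "norm (axis undefined 1 :: complex ^ 'a) = 1" by simp
      then show ?thesis using B H0_degree_0[of f] f True by (metis mult.right_neutral power_0)
    next
      case False
      then show ?thesis using H0_homogeneous[OF f, of 0 0] True by (simp add: power_0_left)
    qed
  next
    case False
    define U where "U = W /\<^sub>R norm W"
    have "of_real (norm W) *s U = W"
      using False unfolding U_def vec_eq_iff
      by (simp only: vector_smult_component vector_scaleR_component) (simp add: scaleR_conv_of_real field_simps)
    moreover have "norm U = 1" using False by (simp add: U_def)
    ultimately show ?thesis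
      using H0_homogeneous[OF f, of "of_real (norm W)" U] B[of U]
      using mult_left_mono[OF B[of U], of "norm W ^ k"]
      by (simp add: norm_mult norm_power mult.commute)
  qed
  have ns: "norm (t *s v) = norm t * norm v" for t
    by (simp add: norm_vec_def norm_mult L2_set_right_distrib)
  have "norm (h t) \<le> B * (norm Z + norm v) ^ k * norm t ^ k" if t: "1 \<le> norm t" for t
  proof -
    have "norm (Z + t *s v) \<le> norm Z + norm t * norm v"
      using norm_triangle_ineq[of Z "t *s v"] ns by simp
    also have "\<dots> \<le> norm t * (norm Z + norm v)"
      using mult_right_mono[OF t, of "norm Z"] by (simp add: algebra_simps)
    finally have "norm (Z + t *s v) ^ k \<le> (norm t * (norm Z + norm v)) ^ k"
      by (intro power_mono) auto
    then have "B * norm (Z + t *s v) ^ k \<le> B * (norm t * (norm Z + norm v)) ^ k"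
      using B0 by simp
    with scale[of "Z + t *s v"] show ?thesis
      unfolding h_def by (simp only: power_mult_distrib mult.assoc mult.commute[of "norm t ^ k"] order.trans)
  qed
  from Liouville_polynomial[OF hol this]
  show thesis by (intro that[of "\<lambda>j. (deriv ^^ j) h 0 / fact j"]) (simp add: h_def)
qed

text \<open>
  The average over \<open>N\<close>-th roots of unity of \<open>\<omega>\<^sup>-\<^sup>1 p(\<omega>)\<close> keeps the coefficients of \<open>p\<close> whose index is
  congruent to \<open>1\<close> modulo \<open>N\<close>.  With \<open>N = k + 2\<close> this is the linear coefficient only, also for \<open>k = 0\<close>,
  where \<open>N = k + 1\<close> would pick the constant term.  The exponent \<open>i * (N - 1)\<close> stands for \<open>- i\<close>.
\<close>
lemma linear_coefficient_by_averaging: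
  fixes a :: "nat \<Rightarrow> complex"
  assumes N: "N = k + 2" and \<omega>: "\<omega> = exp (2 * of_real pi * \<i> / of_nat N)"
  shows "(\<Sum>i<N. \<omega> ^ (i * (N - 1)) * (\<Sum>j\<le>k. a j * (\<omega> ^ i) ^ j)) / of_nat N = (if k = 0 then 0 else a 1)"
proof -
  have N0: "N \<noteq> 0" using N by simp
  have pw: "\<omega> ^ m = 1 \<longleftrightarrow> N dvd m" for m
  proof -
    have "\<omega> ^ m = exp (2 * of_real pi * \<i> * of_nat m / of_nat N)"
      unfolding \<omega> by (simp add: exp_of_nat_mult[symmetric] mult_ac)
    then show ?thesis using complex_root_unity_eq_1[of N m] N by (simp add: mult_ac)
  qed
  have geo: "(\<Sum>i<N. (\<omega> ^ m) ^ i) = (if N dvd m then of_nat N else 0)" for m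
  proof (cases "N dvd m")
    case True then show ?thesis using pw[of m] by simp
  next
    case False
    then have "\<omega> ^ m \<noteq> 1" using pw by simp
    moreover have "(\<omega> ^ m) ^ N = 1" unfolding power_mult[symmetric] pw by simp
    ultimately show ?thesis using False by (simp add: geometric_sum)
  qed
  have dv: "N dvd (N - 1 + j) \<longleftrightarrow> j = 1" if "j \<le> k" for j
  proof
    assume "N dvd N - 1 + j"
    then obtain c where c: "N - 1 + j = N * c" by blast
    have "c = 1"
    proof -
      have "N * c < N * 2" using c that N by linarith
      then have "c < 2" by simp
      moreover have "c \<noteq> 0"
      proof
        assume "c = 0"
        then show False using c N by simp
      qed
      ultimately show ?thesis by simp
    qed
    then show "j = 1" using c N by auto
  qed (use N in auto)
  have "(\<Sum>i<N. \<omega> ^ (i * (N - 1)) * (\<Sum>j\<le>k. a j * (\<omega> ^ i) ^ j))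
      = (\<Sum>i<N. \<Sum>j\<le>k. a j * (\<omega> ^ (N - 1 + j)) ^ i)"
    by (intro sum.cong refl)
       (simp add: sum_distrib_left power_mult[symmetric] power_add[symmetric] algebra_simps)
  also have "\<dots> = (\<Sum>j\<le>k. a j * (\<Sum>i<N. (\<omega> ^ (N - 1 + j)) ^ i))"
    by (subst sum.swap) (simp add: sum_distrib_left)
  also have "\<dots> = (\<Sum>j\<le>k. if j = 1 then a 1 * of_nat N else 0)"
    by (intro sum.cong refl) (use dv in \<open>simp only: geo atMost_iff\<close>, simp)
  also have "\<dots> = (if k = 0 then 0 else a 1 * of_nat N)"
    by (auto simp: sum.delta)
  finally show ?thesis using N0 by simp
qed

text \<open>
  A partial derivative is thus a finite linear combination of translates of \<open>f\<close>, which is why it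
  inherits complex differentiability from \<open>f\<close> without any differentiation under an integral.
\<close>
lemma pd_by_averaging:
  assumes f: "f \<in> H0 k" and N: "N = k + 2" and \<omega>: "\<omega> = exp (2 * of_real pi * \<i> / of_nat N)"
  shows "pd i f Z = (\<Sum>l<N. \<omega> ^ (l * (N - 1)) * f (Z + axis i (\<omega> ^ l))) / of_nat N"
proof -
  obtain a where a: "\<And>t. f (Z + axis i t) = (\<Sum>j\<le>k. a j * t ^ j)"
    using H0_line_polynomial[OF f, of Z "axis i 1"] unfolding axis_eq_smult[symmetric] by blast
  have "((\<lambda>t. \<Sum>j\<le>k. a j * t ^ j) has_field_derivative (\<Sum>j\<le>k. a j * (of_nat j * 0 ^ (j - 1)))) (at 0)"
    by (auto intro!: derivative_eq_intros sum.cong)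
  also have "(\<Sum>j\<le>k. a j * (of_nat j * 0 ^ (j - 1))) = (\<Sum>j\<le>k. if j = 1 then a 1 else 0)"
    by (intro sum.cong) (auto simp: power_0_left)
  also have "\<dots> = (if k = 0 then 0 else a 1)" by (auto simp: sum.delta)
  finally have "pd i f Z = (if k = 0 then 0 else a 1)"
    by (intro pd_eqI) (simp add: a)
  with linear_coefficient_by_averaging[OF N \<omega>, of a] show ?thesis by (simp add: a)
qed

lemma pd_in_H0:
  assumes f: "f \<in> H0 (Suc k)"
  shows "pd i f \<in> H0 k"
proof -
  define N :: nat where "N = Suc k + 2"
  define \<omega> :: complex where "\<omega> = exp (2 * of_real pi * \<i> / of_nat N)"
  have eq: "pd i f = (\<lambda>Z. (\<Sum>l<N. (\<omega> ^ (l * (N - 1)) / of_nat N) * f (Z + axis i (\<omega> ^ l))))"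
    using pd_by_averaging[OF f N_def \<omega>_def] by (simp add: fun_eq_iff sum_divide_distrib)
  have hol: "holomorphic_fun (pd i f)"
    unfolding eq using f
    by (intro holomorphic_fun_sum holomorphic_fun_mult holomorphic_fun_const
        holomorphic_fun_translate H0_holomorphic)
  have hom: "pd i f (c *s Z) = c ^ k * pd i f Z" if c: "c \<noteq> 0" for c Z
  proof (rule pd_eqI)
    have *: "f (c *s Z + axis i t) = c ^ Suc k * f (Z + axis i (t / c))" for t
    proof -
      have "c *s Z + axis i t = c *s (Z + axis i (t / c))"
        unfolding vec_eq_iff vector_add_component vector_smult_component
        by (simp add: axis_def c distrib_left)
      then show ?thesis using H0_homogeneous[OF f] by metis
    qed
    have "((\<lambda>t. t / c) has_field_derivative 1 / c) (at 0)"
      using DERIV_cdivide[OF DERIV_ident] by blast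
    moreover have "((\<lambda>t. f (Z + axis i t)) has_field_derivative pd i f Z) (at (0 / c))"
      using pd_has_derivative[OF H0_holomorphic[OF f]] by simp
    ultimately have "((\<lambda>t. f (Z + axis i (t / c))) has_field_derivative pd i f Z * (1 / c)) (at 0)"
      by (rule DERIV_chain2[rotated])
    then have "((\<lambda>t. c ^ Suc k * f (Z + axis i (t / c))) has_field_derivative c ^ Suc k * (pd i f Z * (1 / c))) (at 0)"
      by (rule DERIV_cmult)
    then show "((\<lambda>t. f (c *s Z + axis i t)) has_field_derivative c ^ k * pd i f Z) (at 0)"
      using c by (simp add: *)
  qed
  \<comment> \<open>The chain rule gives homogeneity for \<open>c \<noteq> 0\<close>; the factor \<open>0\<close> is reached by continuity.\<close>
  have "pd i f (0 *s Z) = 0 ^ k * pd i f Z" for Z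
  proof -
    have lin: "bounded_linear (\<lambda>c::complex. c *s Z)"
      unfolding linear_conv_bounded_linear[symmetric]
      by (rule linearI) (auto simp: vec_eq_iff algebra_simps)
    have "isCont (pd i f) (0 *s Z)"
      using holomorphic_fun_imp_continuous[OF hol] by (simp add: continuous_on_eq_continuous_at)
    then have "((\<lambda>c. pd i f (c *s Z)) \<longlongrightarrow> pd i f (0 *s Z)) (at 0)"
      by (rule isCont_tendsto_compose)
         (use bounded_linear.tendsto[OF lin, of "\<lambda>c. c" 0 "at 0"] in simp)
    moreover have "((\<lambda>c. pd i f (c *s Z)) \<longlongrightarrow> 0 ^ k * pd i f Z) (at 0)"
    proof (rule Lim_transform_eventually)
      show "((\<lambda>c. c ^ k * pd i f Z) \<longlongrightarrow> 0 ^ k * pd i f Z) (at 0)"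
        by (intro tendsto_intros)
      show "\<forall>\<^sub>F c in at 0. c ^ k * pd i f Z = pd i f (c *s Z)"
        using hom by (auto simp: eventually_at intro!: exI[of _ 1])
    qed
    ultimately show ?thesis by (rule tendsto_unique[rotated]) simp
  qed
  with hom have "pd i f (c *s Z) = c ^ k * pd i f Z" for c Z by (cases "c = 0") auto
  with hol show ?thesis by (simp add: H0_def)
qed

section \<open>The ring of formal sections\<close>

text \<open>
  The subdegrees of two Laurent series that depend on \<open>Z\<close> vary with \<open>Z\<close>; with fixed bounds in their
  place, a coefficient of the product is one finite sum of functions of \<open>Z\<close>.
\<close>
lemma fls_times_nth_bounds:
  fixes f g :: "'a::{comm_monoid_add,mult_zero} fls"
  assumes "\<And>j. j < M \<Longrightarrow> fls_nth f j = 0" "\<And>j. j < N \<Longrightarrow> fls_nth g j = 0"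
  shows "fls_nth (f * g) m = (\<Sum>j=M..m - N. fls_nth f j * fls_nth g (m - j))"
proof (cases "f = 0 \<or> g = 0")
  case False
  have "M \<le> fls_subdegree f" "N \<le> fls_subdegree g"
    using assms nth_fls_subdegree_nonzero False not_le by metis+
  then show ?thesis
    unfolding fls_times_nth(2)
    by (intro sum.mono_neutral_left) (auto simp: not_le)
qed auto

abbreviation coef :: "('n::finite) formal \<Rightarrow> nat \<Rightarrow> int \<Rightarrow> complex ^ 'n \<Rightarrow> complex" where
  "coef F k m \<equiv> (\<lambda>Z. fls_nth (fps_nth (F Z) k) m)"

lemma formal_eqI:
  assumes "\<And>k m. fls_nth (fps_nth x k) m = fls_nth (fps_nth y k) m"
  shows "x = (y :: scalar)"
  by (intro fps_ext fls_eqI assms)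

lemma formal_sections_iff:
  "F \<in> formal_sections \<longleftrightarrow> (\<forall>k. (\<forall>m. coef F k m \<in> H0 k) \<and> (\<exists>N. \<forall>m<N. \<forall>Z. coef F k m Z = 0))"
  by (simp add: formal_sections_def)

lemma formal_sections_H0: "F \<in> formal_sections \<Longrightarrow> coef F k m \<in> H0 k"
  by (simp add: formal_sections_iff)

lemma formal_sections_holomorphic: "F \<in> formal_sections \<Longrightarrow> holomorphic_fun (coef F k m)"
  using formal_sections_H0 by (rule H0_holomorphic)

text \<open>
  The bounds on the powers of \<open>\<mu>\<close> may grow with the degree, but a product involves only finitely many
  degrees at a time.
\<close>
lemma formal_sections_uniform_bound:
  assumes "F \<in> formal_sections"
  obtains N where "\<And>i m Z. i \<le> k \<Longrightarrow> m < N \<Longrightarrow> coef F i m Z = 0"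
proof -
  have "\<forall>i. \<exists>N. \<forall>m<N. \<forall>Z. coef F i m Z = 0" using assms by (simp add: formal_sections_iff)
  then obtain n where n: "\<And>i m Z. m < n i \<Longrightarrow> coef F i m Z = 0" by metis
  show thesis
  proof (rule that)
    fix i m Z assume "i \<le> k" "m < Min (n ` {..k})"
    then have "m < n i" by (auto simp: Min_gr_iff)
    then show "coef F i m Z = 0" by (rule n)
  qed
qed

lemma fls_nth_sum: "fls_nth (\<Sum>x\<in>I. f x) m = (\<Sum>x\<in>I. fls_nth (f x) m)"
  by (induction I rule: infinite_finite_induct) auto

lemma coef_mult:
  assumes "\<And>i m. i \<le> k \<Longrightarrow> m < M \<Longrightarrow> coef F i m Z = 0" "\<And>i m. i \<le> k \<Longrightarrow> m < N \<Longrightarrow> coef G i m Z = 0"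
  shows "coef (\<lambda>Z. F Z * G Z) k m Z = (\<Sum>i=0..k. \<Sum>j=M..m - N. coef F i j Z * coef G (k - i) (m - j) Z)"
  unfolding fps_mult_nth fls_nth_sum
  by (intro sum.cong fls_times_nth_bounds assms refl) auto

lemma formal_sections_mult [intro]:
  assumes F: "F \<in> formal_sections" and G: "G \<in> formal_sections"
  shows "(\<lambda>Z. F Z * G Z) \<in> formal_sections"
  unfolding formal_sections_iff
proof
  fix k
  obtain M where M: "\<And>i m Z. i \<le> k \<Longrightarrow> m < M \<Longrightarrow> coef F i m Z = 0"
    using formal_sections_uniform_bound[OF F] by metis
  obtain N where N: "\<And>i m Z. i \<le> k \<Longrightarrow> m < N \<Longrightarrow> coef G i m Z = 0"
    using formal_sections_uniform_bound[OF G] by metis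
  have eq: "coef (\<lambda>Z. F Z * G Z) k m Z = (\<Sum>i=0..k. \<Sum>j=M..m - N. coef F i j Z * coef G (k - i) (m - j) Z)"
    for m Z using M N by (intro coef_mult) auto
  show "(\<forall>m. coef (\<lambda>Z. F Z * G Z) k m \<in> H0 k) \<and> (\<exists>N. \<forall>m<N. \<forall>Z. coef (\<lambda>Z. F Z * G Z) k m Z = 0)"
  proof
    have "(\<lambda>Z. coef F i j Z * coef G (k - i) (m - j) Z) \<in> H0 k" if "i \<le> k" for i j m
      using H0_mult[OF formal_sections_H0[OF F, of i j] formal_sections_H0[OF G, of "k - i" "m - j"]] that by simp
    then show "\<forall>m. coef (\<lambda>Z. F Z * G Z) k m \<in> H0 k"
      unfolding eq by (intro allI H0_sum) auto
    show "\<exists>N. \<forall>m<N. \<forall>Z. coef (\<lambda>Z. F Z * G Z) k m Z = 0"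
      by (rule exI[of _ "M + N"]) (auto simp: eq)
  qed
qed

lemma formal_sections_add [intro]:
  assumes F: "F \<in> formal_sections" and G: "G \<in> formal_sections"
  shows "(\<lambda>Z. F Z + G Z) \<in> formal_sections"
  unfolding formal_sections_iff
proof
  fix k
  have "\<exists>N. \<forall>m<N. \<forall>Z. coef F k m Z = 0" "\<exists>N. \<forall>m<N. \<forall>Z. coef G k m Z = 0"
    using F G by (simp_all add: formal_sections_iff)
  then obtain M N where M: "\<And>m Z. m < M \<Longrightarrow> coef F k m Z = 0" and N: "\<And>m Z. m < N \<Longrightarrow> coef G k m Z = 0"
    by metis
  show "(\<forall>m. coef (\<lambda>Z. F Z + G Z) k m \<in> H0 k) \<and> (\<exists>N. \<forall>m<N. \<forall>Z. coef (\<lambda>Z. F Z + G Z) k m Z = 0)"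
  proof
    show "\<forall>m. coef (\<lambda>Z. F Z + G Z) k m \<in> H0 k"
      using H0_add[OF formal_sections_H0[OF F] formal_sections_H0[OF G]] by simp
    show "\<exists>N. \<forall>m<N. \<forall>Z. coef (\<lambda>Z. F Z + G Z) k m Z = 0"
      by (rule exI[of _ "min M N"]) (simp add: M N)
  qed
qed

lemma formal_sections_fps_const [intro, simp]: "(\<lambda>Z. fps_const a) \<in> formal_sections"
  unfolding formal_sections_iff
proof
  fix k
  have "coef (\<lambda>Z. fps_const a) k m \<in> H0 k" for m by (cases "k = 0") auto
  moreover have "\<exists>N. \<forall>m<N. fls_nth (if k = 0 then a else 0) m = 0"
    by (rule exI[of _ "fls_subdegree a"]) auto
  ultimately show "(\<forall>m. coef (\<lambda>Z. fps_const a) k m \<in> H0 k) \<and> (\<exists>N. \<forall>m<N. \<forall>Z. coef (\<lambda>Z. fps_const a) k m Z = 0)"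
    by simp
qed

lemma formal_sections_0 [intro, simp]: "(\<lambda>Z. 0) \<in> formal_sections"
  and formal_sections_1 [intro, simp]: "(\<lambda>Z. 1) \<in> formal_sections"
  and formal_sections_const [intro, simp]: "(\<lambda>Z. const c) \<in> formal_sections"
  and formal_sections_mu [intro, simp]: "(\<lambda>Z. mu) \<in> formal_sections"
  and formal_sections_inv_mu [intro, simp]: "(\<lambda>Z. inv_mu) \<in> formal_sections"
  using formal_sections_fps_const[of 0] formal_sections_fps_const[of 1]
  by (simp_all add: const_def mu_def inv_mu_def)

lemma formal_sections_sum [intro]:
  "(\<And>x. x \<in> I \<Longrightarrow> F x \<in> formal_sections) \<Longrightarrow> (\<lambda>Z. \<Sum>x\<in>I. F x Z) \<in> formal_sections"
  by (induction I rule: infinite_finite_induct) auto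

lemma coef_homog: "coef (homog k f) n m Z = (if n = k \<and> m = 0 then f Z else 0)"
  by (simp add: homog_def const_def fps_X_power_mult_right_nth)

lemma formal_sections_homog [intro]: "f \<in> H0 k \<Longrightarrow> homog k f \<in> formal_sections"
proof -
  assume f: "f \<in> H0 k"
  have "coef (homog k f) n m \<in> H0 n" for n m
    unfolding coef_homog using f by (cases "n = k"; cases "m = 0") simp_all
  then show ?thesis
    unfolding formal_sections_iff by (auto simp: coef_homog intro!: exI[of _ 0])
qed

section \<open>Partial derivatives of formal sections\<close>

text \<open>
  Outside \<open>formal_sections\<close> the function under \<open>Abs_fls\<close> in \<open>fpd\<close> need not be a Laurent series; the
  bound on the powers of \<open>\<mu>\<close> guarantees that it is.
\<close>
lemma coef_fpd:
  assumes F: "F \<in> formal_sections"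
  shows "coef (fpd a F) k m Z = pd a (coef F (k + 1) m) Z"
proof -
  obtain N where N: "\<And>i m Z. i \<le> k + 1 \<Longrightarrow> m < N \<Longrightarrow> coef F i m Z = 0"
    using formal_sections_uniform_bound[OF F] by metis
  have "pd a (coef F (k + 1) m) Z = 0" if "m < N" for m
  proof -
    have "coef F (k + 1) m = (\<lambda>_. 0)" using N that by blast
    then show ?thesis by (metis pd_const)
  qed
  then show ?thesis unfolding fpd_def by (auto intro!: nth_Abs_fls_ex_lower_bound)
qed

lemma formal_sections_fpd [intro]:
  assumes F: "F \<in> formal_sections"
  shows "fpd a F \<in> formal_sections"
  unfolding formal_sections_iff coef_fpd[OF F]
proof
  fix k
  obtain N where N: "\<And>i m Z. i \<le> k + 1 \<Longrightarrow> m < N \<Longrightarrow> coef F i m Z = 0"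
    using formal_sections_uniform_bound[OF F] by metis
  have "pd a (coef F (k + 1) m) Z = 0" if "m < N" for m Z
  proof -
    have "coef F (k + 1) m = (\<lambda>_. 0)" using N that by blast
    then show ?thesis by (metis pd_const)
  qed
  moreover have "pd a (coef F (k + 1) m) \<in> H0 k" for m
    using pd_in_H0 formal_sections_H0[OF F, of "Suc k" m] by simp
  ultimately show "(\<forall>m. pd a (coef F (k + 1) m) \<in> H0 k) \<and> (\<exists>N. \<forall>m<N. \<forall>Z. pd a (coef F (k + 1) m) Z = 0)"
    by blast
qed

lemma fpd_add:
  assumes F: "F \<in> formal_sections" and G: "G \<in> formal_sections"
  shows "fpd a (\<lambda>Z. F Z + G Z) Z = fpd a F Z + fpd a G Z"
  by (rule formal_eqI)
     (simp add: coef_fpd[OF F] coef_fpd[OF G] coef_fpd[OF formal_sections_add[OF F G]]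
       pd_add formal_sections_holomorphic F G)

lemma fpd_fps_const [simp]: "fpd a (\<lambda>Z. fps_const c) = (\<lambda>Z. 0)"
  by (rule ext, rule formal_eqI) (simp add: coef_fpd)

lemma fpd_simps [simp]:
  "fpd a (\<lambda>Z. 0) = (\<lambda>Z. 0)" "fpd a (\<lambda>Z. 1) = (\<lambda>Z. 0)" "fpd a (\<lambda>Z. const c) = (\<lambda>Z. 0)"
  "fpd a (\<lambda>Z. mu) = (\<lambda>Z. 0)" "fpd a (\<lambda>Z. inv_mu) = (\<lambda>Z. 0)"
  using fpd_fps_const[of a 0] fpd_fps_const[of a 1]
  by (simp_all add: const_def mu_def inv_mu_def)

lemma fpd_sum:
  assumes "\<And>x. x \<in> I \<Longrightarrow> F x \<in> formal_sections"
  shows "fpd a (\<lambda>Z. \<Sum>x\<in>I. F x Z) Z = (\<Sum>x\<in>I. fpd a (F x) Z)"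
  using assms
proof (induction I rule: infinite_finite_induct)
  case (insert x I)
  then show ?case using fpd_add[of "F x" "\<lambda>Z. \<Sum>x\<in>I. F x Z" a Z] by (simp add: formal_sections_sum)
qed auto

lemma fpd_homog_Suc:
  assumes "f \<in> H0 (Suc k)"
  shows "fpd a (homog (Suc k) f) = homog k (pd a f)"
proof (rule ext, rule formal_eqI)
  fix Z n m
  have "coef (homog (Suc k) f) (n + 1) m = (if n = k \<and> m = 0 then f else (\<lambda>_. 0))"
    by (auto simp: coef_homog fun_eq_iff)
  then show "coef (fpd a (homog (Suc k) f)) n m Z = coef (homog k (pd a f)) n m Z"
    unfolding coef_fpd[OF formal_sections_homog[OF assms]] by (simp add: coef_homog)
qed

text \<open>
  Differentiation shifts degrees, so the Leibniz sum over degrees \<open>0,\<dots>,k + 1\<close> has to lose one end in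
  each half: those are the terms that differentiate a component of degree \<open>0\<close>, which is constant.
\<close>
lemma fpd_mult:
  assumes F: "F \<in> formal_sections" and G: "G \<in> formal_sections"
  shows "fpd a (\<lambda>Z. F Z * G Z) Z = fpd a F Z * G Z + F Z * fpd a G Z"
proof (rule formal_eqI)
  fix k m
  obtain M where M: "\<And>i m Z. i \<le> k + 1 \<Longrightarrow> m < M \<Longrightarrow> coef F i m Z = 0"
    using formal_sections_uniform_bound[OF F] by metis
  obtain N where N: "\<And>i m Z. i \<le> k + 1 \<Longrightarrow> m < N \<Longrightarrow> coef G i m Z = 0"
    using formal_sections_uniform_bound[OF G] by metis
  have dM: "coef (fpd a F) i m Z = 0" if "i \<le> k" "m < M" for i m
  proof -
    have "coef F (i + 1) m = (\<lambda>_. 0)" using M that by auto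
    then show ?thesis unfolding coef_fpd[OF F] by (metis pd_const)
  qed
  have dN: "coef (fpd a G) i m Z = 0" if "i \<le> k" "m < N" for i m
  proof -
    have "coef G (i + 1) m = (\<lambda>_. 0)" using N that by auto
    then show ?thesis unfolding coef_fpd[OF G] by (metis pd_const)
  qed
  let ?J = "{M..m - N}"
  note hol = formal_sections_holomorphic[OF F] formal_sections_holomorphic[OF G]
  have "coef (fpd a (\<lambda>Z. F Z * G Z)) k m Z = pd a (coef (\<lambda>Z. F Z * G Z) (k + 1) m) Z"
    using F G by (simp add: coef_fpd formal_sections_mult)
  also have "coef (\<lambda>Z. F Z * G Z) (k + 1) m
      = (\<lambda>Z. \<Sum>i=0..k+1. \<Sum>j\<in>?J. coef F i j Z * coef G (k + 1 - i) (m - j) Z)"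
    by (rule ext, rule coef_mult) (use M N in auto)
  also have "pd a \<dots> Z = (\<Sum>i=0..k+1. \<Sum>j\<in>?J. pd a (coef F i j) Z * coef G (k + 1 - i) (m - j) Z
       + coef F i j Z * pd a (coef G (k + 1 - i) (m - j)) Z)"
    using hol by (simp only: pd_sum pd_mult holomorphic_fun_sum holomorphic_fun_mult)
  also have "\<dots> = (\<Sum>i=0..k+1. \<Sum>j\<in>?J. pd a (coef F i j) Z * coef G (k + 1 - i) (m - j) Z)
      + (\<Sum>i=0..k+1. \<Sum>j\<in>?J. coef F i j Z * pd a (coef G (k + 1 - i) (m - j)) Z)"
    by (simp only: sum.distrib)
  also have "(\<Sum>i=0..k+1. \<Sum>j\<in>?J. pd a (coef F i j) Z * coef G (k + 1 - i) (m - j) Z)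
     = (\<Sum>i=0..k. \<Sum>j\<in>?J. coef (fpd a F) i j Z * coef G (k - i) (m - j) Z)"
    unfolding Suc_eq_plus1[symmetric] sum.atLeast0_atMost_Suc_shift
    by (simp add: coef_fpd[OF F] pd_degree_0[OF formal_sections_H0[OF F, of 0]])
  also have "\<dots> = coef (\<lambda>Z. fpd a F Z * G Z) k m Z"
    by (rule coef_mult[symmetric]) (use dM N in auto)
  also have "(\<Sum>i=0..k+1. \<Sum>j\<in>?J. coef F i j Z * pd a (coef G (k + 1 - i) (m - j)) Z)
     = (\<Sum>i=0..k. \<Sum>j\<in>?J. coef F i j Z * coef (fpd a G) (k - i) (m - j) Z)"
    unfolding Suc_eq_plus1[symmetric] sum.atLeast0_atMost_Suc
    by (simp add: coef_fpd[OF G] pd_degree_0[OF formal_sections_H0[OF G, of 0]] Suc_diff_le)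
  also have "\<dots> = coef (\<lambda>Z. F Z * fpd a G Z) k m Z"
    by (rule coef_mult[symmetric]) (use dN M in auto)
  finally show "coef (fpd a (\<lambda>Z. F Z * G Z)) k m Z = fls_nth (fps_nth (fpd a F Z * G Z + F Z * fpd a G Z) k) m"
    by simp
qed

section \<open>The degree operator\<close>

text \<open>
  The Euler operator: since the variable of the power series records the homogeneity degree, it
  multiplies the component of degree \<open>k\<close> by \<open>k\<close>.
\<close>
definition theta :: "'a::comm_ring_1 fps \<Rightarrow> 'a fps" where
  "theta x = fps_X * fps_deriv x"

lemma theta_nth [simp]: "fps_nth (theta x) n = of_nat n * fps_nth x n"
  by (cases n) (simp_all add: theta_def)

lemma theta_add: "theta (x + y) = theta x + theta y"
  and theta_mult: "theta (x * y) = theta x * y + x * theta y"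
  and theta_sum: "theta (\<Sum>i\<in>I. f i) = (\<Sum>i\<in>I. theta (f i))"
  and theta_fps_const [simp]: "theta (fps_const c) = 0"
  and theta_0 [simp]: "theta 0 = 0"
  and theta_1 [simp]: "theta 1 = 0"
  by (simp_all add: theta_def algebra_simps fps_deriv_sum sum_distrib_left)

lemma fls_of_nat_mult_nth: "fls_nth (of_nat n * x) m = of_nat n * fls_nth (x :: 'a::comm_ring_1 fls) m"
  by (simp add: fls_of_nat)

lemma formal_sections_theta [intro]:
  assumes F: "F \<in> formal_sections"
  shows "(\<lambda>Z. theta (F Z)) \<in> formal_sections"
  unfolding formal_sections_iff theta_nth fls_of_nat_mult_nth
proof
  fix k
  obtain N where "\<forall>m<N. \<forall>Z. coef F k m Z = 0" using F unfolding formal_sections_iff by blast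
  then show "(\<forall>m. (\<lambda>Z. of_nat k * coef F k m Z) \<in> H0 k) \<and> (\<exists>N. \<forall>m<N. \<forall>Z. of_nat k * coef F k m Z = 0)"
    using H0_cmult[OF formal_sections_H0[OF F]] by (metis mult_zero_right)
qed

text \<open>The correction term appears because \<open>fpd\<close> lowers the degree by one.\<close>
lemma fpd_theta:
  assumes F: "F \<in> formal_sections"
  shows "fpd a (\<lambda>Z. theta (F Z)) Z = theta (fpd a F Z) + fpd a F Z"
proof (rule formal_eqI)
  fix k m
  have "coef (fpd a (\<lambda>Z. theta (F Z))) k m Z = pd a (\<lambda>Z. of_nat (k + 1) * coef F (k + 1) m Z) Z"
    by (simp only: coef_fpd[OF formal_sections_theta[OF F]] theta_nth fls_of_nat_mult_nth)
  also have "\<dots> = of_nat (k + 1) * pd a (coef F (k + 1) m) Z"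
    by (rule pd_cmult) (rule formal_sections_holomorphic[OF F])
  finally show "fls_nth (fps_nth (fpd a (\<lambda>Z. theta (F Z)) Z) k) m
      = fls_nth (fps_nth (theta (fpd a F Z) + fpd a F Z) k) m"
    using coef_fpd[OF F, where a = a and k = k and m = m and Z = Z] by (simp add: fls_of_nat_mult_nth distrib_right del: of_nat_Suc of_nat_add) (simp add: distrib_right)
qed

lemma theta_homog: "theta (homog k f Z) = of_nat k * homog k f Z"
proof (rule formal_eqI)
  fix n m
  show "fls_nth (fps_nth (theta (homog k f Z)) n) m = fls_nth (fps_nth (of_nat k * homog k f Z) n) m"
    unfolding theta_nth fls_of_nat_mult_nth fps_of_nat[symmetric] fps_mult_left_const_nth
    by (simp add: coef_homog fls_of_nat_mult_nth)
qed

section \<open>Hamiltonian fields of the coordinates\<close>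

text \<open>The derivation \<open>X\<^sub>a = {z\<^sub>a, \<cdot>}\<close>; it raises the degree by one.\<close>
definition ham :: "('n::finite \<Rightarrow> 'n \<Rightarrow> complex ^ 'n \<Rightarrow> complex) \<Rightarrow> 'n \<Rightarrow> 'n formal \<Rightarrow> 'n formal" where
  "ham \<Lambda> a F = (\<lambda>Z. \<Sum>b\<in>UNIV. homog 2 (\<Lambda> a b) Z * fpd b F Z)"

locale quadratic_bivector =
  fixes \<Lambda> :: "'n::finite \<Rightarrow> 'n \<Rightarrow> complex ^ 'n \<Rightarrow> complex"
  assumes H0_2: "\<Lambda> a b \<in> H0 2"
begin

lemma formal_sections_ham [intro]: "F \<in> formal_sections \<Longrightarrow> ham \<Lambda> a F \<in> formal_sections"
  unfolding ham_def by (intro formal_sections_sum formal_sections_mult formal_sections_fpd formal_sections_homog H0_2)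

lemma ham_add:
  "F \<in> formal_sections \<Longrightarrow> G \<in> formal_sections \<Longrightarrow> ham \<Lambda> a (\<lambda>Z. F Z + G Z) Z = ham \<Lambda> a F Z + ham \<Lambda> a G Z"
  unfolding ham_def by (simp add: fpd_add algebra_simps sum.distrib)

lemma ham_mult:
  "F \<in> formal_sections \<Longrightarrow> G \<in> formal_sections \<Longrightarrow>
    ham \<Lambda> a (\<lambda>Z. F Z * G Z) Z = ham \<Lambda> a F Z * G Z + F Z * ham \<Lambda> a G Z"
  unfolding ham_def by (simp add: fpd_mult algebra_simps sum.distrib sum_distrib_left sum_distrib_right)

lemma ham_fps_const [simp]: "ham \<Lambda> a (\<lambda>Z. fps_const c) = (\<lambda>Z. 0)"
  and ham_const [simp]: "ham \<Lambda> a (\<lambda>Z. const d) = (\<lambda>Z. 0)"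
  and ham_inv_mu [simp]: "ham \<Lambda> a (\<lambda>Z. inv_mu) = (\<lambda>Z. 0)"
  and ham_1 [simp]: "ham \<Lambda> a (\<lambda>Z. 1) = (\<lambda>Z. 0)"
  and ham_0 [simp]: "ham \<Lambda> a (\<lambda>Z. 0) = (\<lambda>Z. 0)"
  unfolding ham_def by simp_all

lemma ham_sum:
  "(\<And>x. x \<in> I \<Longrightarrow> F x \<in> formal_sections) \<Longrightarrow> ham \<Lambda> a (\<lambda>Z. \<Sum>x\<in>I. F x Z) Z = (\<Sum>x\<in>I. ham \<Lambda> a (F x) Z)"
  unfolding ham_def by (simp add: fpd_sum sum_distrib_left) (rule sum.swap)

lemma ham_theta:
  assumes "F \<in> formal_sections"
  shows "theta (ham \<Lambda> a F Z) = ham \<Lambda> a (\<lambda>Z. theta (F Z)) Z + ham \<Lambda> a F Z"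
  unfolding ham_def fpd_theta[OF assms] theta_sum theta_mult theta_homog
  by (simp add: sum.distrib[symmetric] algebra_simps)

lemma ham_coord: "ham \<Lambda> a (homog 1 (\<lambda>W. W $ i)) Z = homog 2 (\<Lambda> a i) Z"
proof -
  have "homog 0 (pd b (\<lambda>W. W $ i)) Z = (if i = b then 1 else 0)" for b
    by (simp add: homog_def pd_coord const_def)
  then show ?thesis
    unfolding ham_def One_nat_def fpd_homog_Suc[OF H0_coord[unfolded One_nat_def]]
    by (simp add: if_distrib[of "(*) _"] cong: if_cong)
qed

end

section \<open>Power series in a matrix\<close>

lemma const_add: "const (a + b) = const a + const b"
  and const_mult: "const (a * b) = const a * const b"
  and const_minus: "const (- a) = - const a"
  and const_0 [simp]: "const 0 = 0" and const_1 [simp]: "const 1 = 1"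
  by (simp_all add: const_def fls_plus_const fls_const_mult_const)

lemma const_power: "const (a ^ k) = const a ^ k"
  by (induction k) (simp_all add: const_mult)

lemma const_of_nat: "const (of_nat k) = of_nat k"
  by (induction k) (simp_all add: const_add)

lemma const_numeral: "const (numeral k) = numeral k"
  using const_of_nat[of "numeral k"] by simp

lemma const_nth: "fps_nth (const c * x) n = fls_const c * fps_nth x n"
  by (simp add: const_def)

lemma theta_const [simp]: "theta (const c) = 0" by (simp add: const_def)

lemma matrix_power_0 [simp]: "matrix_power M 0 = mat 1"
  by (simp add: matrix_power_def)

lemma matrix_power_Suc: "matrix_power M (Suc k) = M ** matrix_power M k"
  by (simp add: matrix_power_def)

lemma matrix_power_add: "matrix_power M (j + k) = matrix_power M j ** matrix_power M k"
  by (induction j) (simp_all add: matrix_power_Suc matrix_mul_assoc)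

lemma matrix_mult_nth: "(M ** N) $ i $ j = (\<Sum>l\<in>UNIV. M $ i $ l * N $ l $ j)"
  by (simp add: matrix_matrix_mult_def)

lemma mat_nth: "mat x $ i $ j = (if i = j then x else 0)"
  by (simp add: mat_def)

text \<open>This is the condition under which power series in the matrix converge coefficientwise.\<close>
definition zero_constant_term :: "scalar ^ 'n ^ 'n \<Rightarrow> bool" where
  "zero_constant_term M \<longleftrightarrow> (\<forall>i j. fps_nth (M $ i $ j) 0 = 0)"

lemma matrix_power_nth_eq_0:
  assumes "zero_constant_term M" "n < k"
  shows "fps_nth (matrix_power M k $ i $ j) n = 0"
  using assms(2)
proof (induction k arbitrary: n i j)
  case (Suc k)
  have "fps_nth (M $ i $ l) a * fps_nth (matrix_power M k $ l $ j) (n - a) = 0" if "a \<le> n" for a l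
  proof (cases "a = 0")
    case True then show ?thesis using assms(1) by (simp add: zero_constant_term_def)
  next
    case False then show ?thesis using Suc that by simp
  qed
  then show ?case
    unfolding matrix_power_Suc matrix_mult_nth fps_sum_nth fps_mult_nth
    by (intro sum.neutral ballI) auto
qed simp

lemma suminf_fps_nth:
  fixes f :: "nat \<Rightarrow> 'a::ab_group_add fps"
  assumes "\<And>n k. n < k \<Longrightarrow> fps_nth (f k) n = 0"
  shows "fps_nth (\<Sum>k. f k) n = (\<Sum>k\<le>n. fps_nth (f k) n)"
proof -
  have "f sums Abs_fps (\<lambda>n. \<Sum>k\<le>n. fps_nth (f k) n)"
    unfolding sums_def
  proof (rule tendsto_fpsI)
    fix n
    show "\<forall>\<^sub>F N in sequentially. fps_nth (\<Sum>k<N. f k) n = fps_nth (Abs_fps (\<lambda>n. \<Sum>k\<le>n. fps_nth (f k) n)) n"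
      using eventually_gt_at_top[of n]
    proof eventually_elim
      case (elim N)
      then show ?case
        by (simp add: fps_sum_nth) (intro sum.mono_neutral_right, use assms in auto)
    qed
  qed
  then show ?thesis using sums_unique[symmetric] by force
qed

lemma matrix_series_nth:
  assumes "zero_constant_term M"
  shows "fps_nth (matrix_series c M $ i $ j) n
    = (\<Sum>k\<le>n. fls_const (fps_nth c k) * fps_nth (matrix_power M k $ i $ j) n)"
  unfolding matrix_series_def vec_lambda_beta
  by (subst suminf_fps_nth) (simp_all add: const_nth matrix_power_nth_eq_0[OF assms])

text \<open>
  A coefficient of a matrix series is a coefficient of a polynomial in the matrix.  The product
  rule and the commutation rule below are transferred from polynomials in this way.
\<close>
lemma matrix_series_trunc:
  assumes "zero_constant_term M" "n \<le> N"
  shows "fps_nth (matrix_series c M $ i $ j) n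
    = fps_nth (\<Sum>k\<le>N. const (fps_nth c k) * matrix_power M k $ i $ j) n"
  unfolding matrix_series_nth[OF assms(1)] fps_sum_nth const_nth
  by (rule sum.mono_neutral_left) (use assms in \<open>auto simp: matrix_power_nth_eq_0\<close>)

lemma fps_mult_nth_cong:
  assumes "\<And>k. k \<le> n \<Longrightarrow> fps_nth x k = fps_nth x' k" "\<And>k. k \<le> n \<Longrightarrow> fps_nth y k = fps_nth y' k"
  shows "fps_nth (x * y) n = fps_nth (x' * y') n"
  unfolding fps_mult_nth using assms by (intro sum.cong) auto

lemma matrix_series_mult:
  assumes M: "zero_constant_term M"
  shows "matrix_series c M ** matrix_series d M = matrix_series (c * d) M"
proof -
  have "fps_nth ((matrix_series c M ** matrix_series d M) $ i $ j) n = fps_nth (matrix_series (c * d) M $ i $ j) n" for i j n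
  proof -
    let ?T = "\<lambda>c i j. \<Sum>k\<le>n. const (fps_nth c k) * matrix_power M k $ i $ j"
    let ?t = "\<lambda>k k'. fls_const (fps_nth c k * fps_nth d k') * fps_nth (matrix_power M (k + k') $ i $ j) n"
    have "fps_nth ((matrix_series c M ** matrix_series d M) $ i $ j) n = (\<Sum>l\<in>UNIV. fps_nth (?T c i l * ?T d l j) n)"
      unfolding matrix_mult_nth fps_sum_nth
      by (intro sum.cong refl fps_mult_nth_cong matrix_series_trunc M)
    also have "\<dots> = fps_nth (\<Sum>l\<in>UNIV. ?T c i l * ?T d l j) n" by (simp add: fps_sum_nth)
    also have "(\<Sum>l\<in>UNIV. ?T c i l * ?T d l j)
        = (\<Sum>l\<in>UNIV. \<Sum>k\<le>n. \<Sum>k'\<le>n. const (fps_nth c k * fps_nth d k') * (matrix_power M k $ i $ l * matrix_power M k' $ l $ j))"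
      by (simp add: sum_product const_mult mult_ac)
    also have "\<dots> = (\<Sum>k\<le>n. \<Sum>k'\<le>n. const (fps_nth c k * fps_nth d k') * matrix_power M (k + k') $ i $ j)"
      unfolding matrix_power_add matrix_mult_nth sum_distrib_left
      by (subst sum.swap, rule sum.cong[OF refl], rule sum.swap)
    also have "fps_nth \<dots> n = (\<Sum>k\<le>n. \<Sum>k'\<le>n. ?t k k')"
      by (simp add: fps_sum_nth const_nth)
    also have "\<dots> = (\<Sum>(k,k')\<in>{..n} \<times> {..n}. ?t k k')" by (simp add: sum.cartesian_product)
    also have "\<dots> = (\<Sum>(k,k')\<in>{(k,k'). k + k' \<le> n}. ?t k k')"
      by (rule sum.mono_neutral_right) (auto, metis M matrix_power_nth_eq_0 not_le)
    also have "\<dots> = (\<Sum>p\<le>n. \<Sum>k\<le>p. ?t k (p - k))" by (rule sum.triangle_reindex_eq)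
    also have "\<dots> = (\<Sum>p\<le>n. fls_const (fps_nth (c * d) p) * fps_nth (matrix_power M p $ i $ j) n)"
    proof (rule sum.cong[OF refl])
      fix p
      have *: "fls_const (\<Sum>k\<in>I. f k) = (\<Sum>k\<in>I. fls_const (f k))" for I :: "nat set" and f :: "nat \<Rightarrow> complex"
        by (induction I rule: infinite_finite_induct) (simp_all add: fls_plus_const[symmetric])
      show "(\<Sum>k\<le>p. ?t k (p - k)) = fls_const (fps_nth (c * d) p) * fps_nth (matrix_power M p $ i $ j) n"
        by (simp add: fps_mult_nth * sum_distrib_right atLeast0AtMost)
    qed
    also have "\<dots> = fps_nth (matrix_series (c * d) M $ i $ j) n"
      by (simp add: matrix_series_nth[OF M])
    finally show ?thesis .
  qed
  then show ?thesis by (simp add: vec_eq_iff fps_eq_iff)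
qed

lemma matrix_series_add:
  assumes M: "zero_constant_term M"
  shows "matrix_series (c + d) M = matrix_series c M + matrix_series d M"
  unfolding vec_eq_iff
  by (intro allI fps_ext) (simp add: matrix_series_nth[OF M] fls_plus_const[symmetric] algebra_simps sum.distrib)

lemma scale_matrix_nth [simp]: "scale_matrix a M $ i $ j = a * M $ i $ j"
  by (simp add: scale_matrix_def)

lemma matrix_series_smult:
  assumes M: "zero_constant_term M"
  shows "matrix_series (fps_const a * c) M = scale_matrix (const a) (matrix_series c M)"
  unfolding vec_eq_iff
  by (intro allI fps_ext)
     (simp add: matrix_series_nth[OF M] const_nth sum_distrib_left mult.assoc[symmetric])

lemma matrix_series_X:
  assumes M: "zero_constant_term M"
  shows "matrix_series fps_X M = M"
proof -
  have "fps_nth (matrix_series fps_X M $ i $ j) n = fps_nth (M $ i $ j) n" for i j n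
  proof -
    have "fps_nth (matrix_series fps_X M $ i $ j) n = (\<Sum>k\<le>n. if k = 1 then fps_nth (M $ i $ j) n else 0)"
      unfolding matrix_series_nth[OF M]
      by (intro sum.cong refl) (auto simp: matrix_power_Suc)
    also have "\<dots> = fps_nth (M $ i $ j) n"
      using M by (cases n) (auto simp: sum.delta zero_constant_term_def)
    finally show ?thesis .
  qed
  then show ?thesis by (simp add: vec_eq_iff fps_eq_iff)
qed

lemma matrix_series_1:
  assumes M: "zero_constant_term M"
  shows "matrix_series 1 M = mat 1"
proof -
  have "fps_nth (matrix_series 1 M $ i $ j) n = fps_nth (mat 1 $ i $ j :: scalar) n" for i j n
  proof -
    have "fps_nth (matrix_series 1 M $ i $ j) n = (\<Sum>k\<le>n. if k = 0 then fps_nth (mat 1 $ i $ j :: scalar) n else 0)"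
      unfolding matrix_series_nth[OF M]
      by (intro sum.cong refl) (auto)
    then show ?thesis by (simp add: sum.delta)
  qed
  then show ?thesis by (simp add: vec_eq_iff fps_eq_iff)
qed

lemma matrix_power_scale: "matrix_power (scale_matrix a M) k = scale_matrix (a ^ k) (matrix_power M k)"
proof (induction k)
  case 0
  then show ?case by (simp add: vec_eq_iff)
next
  case (Suc k)
  then show ?case
    by (simp add: matrix_power_Suc vec_eq_iff matrix_mult_nth sum_distrib_left mult_ac)
qed

lemma matrix_series_scale:
  "matrix_series c (scale_matrix (const a) M) = matrix_series (fps_compose c (fps_const a * fps_X)) M"
  unfolding matrix_series_def matrix_power_scale scale_matrix_nth fps_nth_compose_linear const_mult const_power
  by (simp only: mult.assoc mult.left_commute)

lemma matrix_power_commute: "M ** matrix_power M k = matrix_power M k ** M"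
  by (induction k) (simp, metis matrix_power_Suc matrix_mul_assoc)

lemma matrix_power_transpose: "matrix_power (transpose M) k = transpose (matrix_power M k)"
proof (induction k)
  case (Suc k)
  have "transpose M ** transpose (matrix_power M k) = transpose (matrix_power M k ** M)"
    by (simp add: matrix_transpose_mul)
  then show ?case by (simp add: matrix_power_Suc Suc matrix_power_commute)
qed (simp add: transpose_mat)

lemma matrix_series_transpose: "matrix_series c (transpose M) = transpose (matrix_series c M)"
  by (simp add: matrix_series_def matrix_power_transpose) (simp add: transpose_def)

text \<open>
  Moving \<open>A\<close> from the left of a function of \<open>\<Lambda> A\<close> to the right of the same function of \<open>A \<Lambda>\<close>
  is what makes the matrix in the exponent symmetric.
\<close>
lemma matrix_power_push: "A ** matrix_power (L ** A) k = matrix_power (A ** L) k ** A"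
  by (induction k) (simp_all add: matrix_power_Suc, metis matrix_mul_assoc)

lemma matrix_series_push:
  assumes "zero_constant_term (L ** A)" "zero_constant_term (A ** L)"
  shows "A ** matrix_series c (L ** A) = matrix_series c (A ** L) ** A"
proof -
  have "fps_nth ((A ** matrix_series c (L ** A)) $ i $ j) n = fps_nth ((matrix_series c (A ** L) ** A) $ i $ j) n" for i j n
  proof -
    let ?T = "\<lambda>M i j. \<Sum>k\<le>n. const (fps_nth c k) * matrix_power M k $ i $ j"
    have "fps_nth ((A ** matrix_series c (L ** A)) $ i $ j) n = (\<Sum>l\<in>UNIV. fps_nth (A $ i $ l * ?T (L ** A) l j) n)"
      unfolding matrix_mult_nth fps_sum_nth
      by (intro sum.cong refl fps_mult_nth_cong matrix_series_trunc assms)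
    also have "\<dots> = fps_nth (\<Sum>k\<le>n. const (fps_nth c k) * (A ** matrix_power (L ** A) k) $ i $ j) n"
      unfolding matrix_mult_nth sum_distrib_left fps_sum_nth by (subst sum.swap) (simp only: mult_ac)
    also have "\<dots> = fps_nth (\<Sum>k\<le>n. const (fps_nth c k) * (matrix_power (A ** L) k ** A) $ i $ j) n"
      by (simp only: matrix_power_push)
    also have "\<dots> = (\<Sum>l\<in>UNIV. fps_nth (?T (A ** L) i l * A $ l $ j) n)"
      unfolding matrix_mult_nth sum_distrib_left sum_distrib_right fps_sum_nth by (subst sum.swap) (simp only: mult_ac)
    also have "\<dots> = fps_nth ((matrix_series c (A ** L) ** A) $ i $ j) n"
      unfolding matrix_mult_nth fps_sum_nth
      by (intro sum.cong refl fps_mult_nth_cong matrix_series_trunc[symmetric] assms)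
    finally show ?thesis .
  qed
  then show ?thesis by (simp add: vec_eq_iff fps_eq_iff)
qed

text \<open>
  A matrix whose entries are homogeneous of degree \<open>2\<close> commutes with its derivative, so that the naive
  chain rule holds for functions of it.
\<close>
lemma theta_matrix_power:
  fixes M :: "scalar ^ 'n::finite ^ 'n"
  assumes "\<And>i j. theta (M $ i $ j) = 2 * M $ i $ j"
  shows "theta (matrix_power M k $ i $ j) = of_nat (2 * k) * matrix_power M k $ i $ j"
proof (induction k arbitrary: i j)
  case 0
  then show ?case by (simp add: mat_nth)
next
  case (Suc k)
  have "theta (matrix_power M (Suc k) $ i $ j) =
      (\<Sum>l\<in>UNIV. of_nat (2 * Suc k) * (M $ i $ l * matrix_power M k $ l $ j))"
    by (simp add: matrix_power_Suc matrix_mult_nth theta_sum theta_mult Suc assms algebra_simps)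
  then show ?case by (simp only: matrix_power_Suc matrix_mult_nth sum_distrib_left)
qed

lemma theta_matrix_series:
  fixes M :: "scalar ^ 'n::finite ^ 'n"
  assumes M: "zero_constant_term M" and th: "\<And>i j. theta (M $ i $ j) = 2 * M $ i $ j"
  shows "theta (matrix_series c M $ i $ j) = 2 * matrix_series (theta c) M $ i $ j"
proof (rule fps_ext)
  fix n
  have *: "of_nat n * fps_nth (matrix_power M k $ i $ j) n = of_nat (2 * k) * fps_nth (matrix_power M k $ i $ j) n" for k
    using arg_cong[OF theta_matrix_power[OF th, of k i j], of "\<lambda>x. fps_nth x n"]
    by (simp only: theta_nth fps_of_nat[symmetric] fps_mult_left_const_nth)
  have f2: "fls_const (of_nat k * x) = of_nat k * fls_const (x::complex)" for k x
    by (simp add: fls_of_nat fls_const_mult_const)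
  have "fps_nth (theta (matrix_series c M $ i $ j)) n
      = (\<Sum>k\<le>n. fls_const (fps_nth c k) * (of_nat n * fps_nth (matrix_power M k $ i $ j) n))"
    by (simp add: matrix_series_nth[OF M] sum_distrib_left mult_ac)
  also have "\<dots> = (\<Sum>k\<le>n. 2 * (fls_const (fps_nth (theta c) k) * fps_nth (matrix_power M k $ i $ j) n))"
    by (simp only: *) (simp add: f2 mult_ac)
  also have "\<dots> = fps_nth (2 * matrix_series (theta c) M $ i $ j) n"
    by (simp add: numeral_fps_const matrix_series_nth[OF M] sum_distrib_left)
  finally show "fps_nth (theta (matrix_series c M $ i $ j)) n = fps_nth (2 * matrix_series (theta c) M $ i $ j) n" .
qed

section \<open>Determinants, square roots and exponentials under the degree operator\<close>

lemma theta_prod: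
  "finite I \<Longrightarrow> theta (\<Prod>i\<in>I. f i) = (\<Sum>i\<in>I. \<Prod>j\<in>I. if j = i then theta (f j) else f j)"
proof (induction I rule: finite_induct)
  case (insert x I)
  have "(\<Prod>j\<in>I. if j = x then theta (f j) else f j) = (\<Prod>j\<in>I. f j)"
    using insert by (intro prod.cong) auto
  moreover have "(\<Sum>i\<in>I. (if x = i then theta (f x) else f x) * (\<Prod>j\<in>I. if j = i then theta (f j) else f j))
     = f x * (\<Sum>i\<in>I. \<Prod>j\<in>I. if j = i then theta (f j) else f j)"
    unfolding sum_distrib_left using insert by (intro sum.cong) auto
  ultimately show ?case using insert by (simp add: theta_mult)
qed simp

lemma theta_det:
  fixes C :: "'a::comm_ring_1 fps ^ 'n::finite ^ 'n"
  shows "theta (det C) = (\<Sum>k\<in>UNIV. det (\<chi> i. if i = k then (\<chi> j. theta (C $ i $ j)) else C $ i))"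
proof -
  have of_int: "theta (of_int z) = (0 :: 'a fps)" for z
    unfolding fps_of_int[symmetric] by simp
  have "theta (det C) = (\<Sum>p | p permutes UNIV. of_int (sign p) * theta (\<Prod>i\<in>UNIV. C $ i $ p i))"
    unfolding det_def by (simp add: theta_sum theta_mult of_int)
  also have "\<dots> = (\<Sum>p | p permutes UNIV. \<Sum>k\<in>UNIV. of_int (sign p) *
      (\<Prod>i\<in>UNIV. (\<chi> i. if i = k then (\<chi> j. theta (C $ i $ j)) else C $ i) $ i $ p i))"
    by (simp add: theta_prod sum_distrib_left if_distrib[of "\<lambda>v. v $ _"] cong: if_cong)
  also have "\<dots> = (\<Sum>k\<in>UNIV. det (\<chi> i. if i = k then (\<chi> j. theta (C $ i $ j)) else C $ i))"
    unfolding det_def by (rule sum.swap)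
  finally show ?thesis .
qed

text \<open>
  Jacobi's formula, with \<open>W\<close> in the role of \<open>(\<theta> C) C\<^sup>-\<^sup>1\<close> so that \<open>C\<close> is not inverted: when
  row \<open>k\<close> of \<open>C\<close> is replaced by row \<open>k\<close> of \<open>W C\<close>, every summand except \<open>W\<^sub>k\<^sub>k C\<^sub>k\<close> repeats another row.
\<close>
lemma theta_det_trace:
  fixes C W :: "'a::comm_ring_1 fps ^ 'n::finite ^ 'n"
  assumes "\<And>i j. theta (C $ i $ j) = (W ** C) $ i $ j"
  shows "theta (det C) = trace W * det C"
proof -
  have "det (\<chi> i. if i = k then (\<chi> j. theta (C $ i $ j)) else C $ i) = W $ k $ k * det C" for k
  proof -
    have "(\<chi> i. if i = k then (\<chi> j. theta (C $ i $ j)) else C $ i)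
        = (\<chi> i. if i = k then (\<Sum>l\<in>UNIV. W $ i $ l *s C $ l) else C $ i)"
      by (simp add: vec_eq_iff assms matrix_mult_nth sum_component)
    also have "det \<dots> = (\<Sum>l\<in>UNIV. W $ k $ l * det (\<chi> i. if i = k then C $ l else C $ i))"
      using det_linear_row_sum[of UNIV k "\<lambda>i l. W $ k $ l *s C $ l" "\<lambda>i. C $ i"]
      by (simp add: det_row_mul cong: if_cong)
    also have "\<dots> = (\<Sum>l\<in>UNIV. if l = k then W $ k $ k * det C else 0)"
    proof (rule sum.cong[OF refl])
      fix l
      show "W $ k $ l * det (\<chi> i. if i = k then C $ l else C $ i) = (if l = k then W $ k $ k * det C else 0)"
      proof (cases "l = k")
        case True
        have "(\<chi> i. if i = k then C $ k else C $ i) = C" by (simp add: vec_eq_iff)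
        then show ?thesis by (simp only: True if_True simp_thms)
      next
        case False
        then have "det (\<chi> i. if i = k then C $ l else C $ i) = 0"
          by (intro det_identical_rows[of k l]) (auto simp: row_def)
        with False show ?thesis by simp
      qed
    qed
    finally show ?thesis by simp
  qed
  then show ?thesis by (simp add: theta_det trace_def sum_distrib_right)
qed

lemma fps_prod_nth_0: "fps_nth (\<Prod>i\<in>I. f i) 0 = (\<Prod>i\<in>I. fps_nth (f i :: 'a::comm_ring_1 fps) 0)"
  by (induction I rule: infinite_finite_induct) simp_all

lemma det_nth_0:
  fixes C :: "'a::comm_ring_1 fps ^ 'n::finite ^ 'n"
  assumes "\<And>i j. fps_nth (C $ i $ j) 0 = (if i = j then 1 else 0)"
  shows "fps_nth (det C) 0 = 1"
proof -
  have of_int: "fps_nth (of_int z) 0 = (of_int z :: 'a)" for z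
    unfolding fps_of_int[symmetric] by simp
  have "fps_nth (det C) 0 = det (mat 1 :: 'a ^ 'n ^ 'n)"
    unfolding det_def by (simp add: fps_sum_nth fps_prod_nth_0 of_int assms mat_nth)
  then show ?thesis by simp
qed

text \<open>Differentiate \<open>r\<^sup>2 = det D\<close> and \<open>r * det_inv_sqrt D = 1\<close>, where \<open>r\<close> is the chosen square root.\<close>
lemma theta_det_inv_sqrt:
  fixes D :: "scalar ^ 'n::finite ^ 'n"
  assumes D0: "fps_nth (det D) 0 = 1" and th: "theta (det D) = w * det D"
  shows "2 * theta (det_inv_sqrt D) = - w * det_inv_sqrt D" "fps_nth (det_inv_sqrt D) 0 = 1"
proof -
  define r where "r = fps_radical (\<lambda>_ _. 1) 2 (det D)"
  define g where "g = det_inv_sqrt D"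
  have r2: "r ^ 2 = det D"
    using power_radical[of "det D" "\<lambda>_ _. 1" 1] D0 by (simp add: r_def numeral_2_eq_2)
  have r0: "fps_nth r 0 = 1" by (simp add: r_def)
  have g: "g = inverse r" by (simp add: g_def det_inv_sqrt_def r_def)
  have gr: "g * r = 1" unfolding g by (rule inverse_mult_eq_1) (simp add: r0)
  show "fps_nth (det_inv_sqrt D) 0 = 1" unfolding g_def[symmetric] g by (simp add: r0)
  have "2 * theta r * r = w * r * r"
    using th unfolding r2[symmetric] power2_eq_square theta_mult by (simp add: mult_ac)
  then have thr: "2 * theta r = w * r" using r0 by auto
  have "theta g * r + g * theta r = 0"
    using arg_cong[OF gr, of theta] by (simp add: theta_mult)
  then have "2 * g * (theta g * r + g * theta r) = 0" by simp
  also have "2 * g * (theta g * r + g * theta r) = 2 * theta g * (r * g) + g * g * (2 * theta r)"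
    by (simp only: distrib_left mult_ac)
  finally have "2 * theta g * (r * g) + g * g * (2 * theta r) = 0" .
  then have "2 * theta g * (g * r) + w * g * (g * r) = 0"
    unfolding thr by (simp only: mult_ac)
  then have "2 * theta g + w * g = 0" by (simp only: gr mult_1_right)
  then show "2 * theta (det_inv_sqrt D) = - w * det_inv_sqrt D"
    unfolding g_def[symmetric] by (simp add: add_eq_0_iff2)
qed

lemma theta_formal_exp:
  assumes "fps_nth x 0 = 0"
  shows "theta (formal_exp x) = theta x * formal_exp x" "fps_nth (formal_exp x) 0 = 1"
  using assms by (simp_all add: formal_exp_def theta_def fps_compose_deriv mult_ac)

section \<open>The hyperbolic tangent\<close>

text \<open>
  The series \<open>tanh x / x\<close>, because \<open>tan (\<i> x) = \<i> tanh x\<close>.  The hyperbolic cosine and tangent appear below as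
  \<open>fps_cos \<i>\<close> and \<open>fps_X * tanhc\<close>.
\<close>
definition tanhc :: "complex fps" where
  "tanhc = fps_compose (fps_shift 1 (fps_tan 1)) (fps_const \<i> * fps_X)"

lemma fps_cos_neq_0: "fps_cos (c::'a::field_char_0) \<noteq> 0"
proof
  assume "fps_cos c = 0"
  then have "fps_nth (fps_cos c) 0 = 0" by simp
  then show False by simp
qed

lemma X_tanhc: "fps_X * tanhc = fps_const (- \<i>) * fps_tan \<i>"
proof -
  have "fps_nth (fps_tan (1::complex)) 0 = 0" by (simp add: fps_tan_def)
  then have t: "fps_tan (1::complex) = fps_X * fps_shift 1 (fps_tan 1)"
    by (intro fps_ext) (auto simp: gr0_conv_Suc)
  have sin: "fps_compose (fps_sin 1) (fps_const \<i> * fps_X) = fps_sin \<i>"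
    by (rule fps_ext) (simp add: fps_sin_def)
  have cos: "fps_compose (fps_cos 1) (fps_const \<i> * fps_X) = fps_cos \<i>"
    by (rule fps_ext) (simp add: fps_cos_def)
  have "fps_compose (fps_tan 1) (fps_const \<i> * fps_X) = fps_tan \<i>"
    unfolding fps_tan_def by (subst fps_compose_divide_distrib) (simp_all add: fps_cos_neq_0 sin cos)
  then have "fps_const \<i> * fps_X * tanhc = fps_tan \<i>"
    by (subst (asm) t) (simp add: fps_compose_mult_distrib tanhc_def)
  then have "fps_const (- \<i>) * (fps_const \<i> * fps_X * tanhc) = fps_const (- \<i>) * fps_tan \<i>" by simp
  then show ?thesis by (simp add: mult.assoc[symmetric])
qed

lemma cosh_eq: "fps_const (1/2) * (fps_exp 1 + fps_exp (-1)) = (fps_cos \<i> :: complex fps)"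
  by (simp add: fps_cos_fps_exp_ii fps_divide_unit fps_const_inverse mult.commute add.commute)

lemma theta_cosh: "theta (fps_cos \<i>) = (fps_X * (fps_X * tanhc)) * (fps_cos \<i> :: complex fps)"
proof -
  have "fps_tan \<i> * fps_cos \<i> = (fps_sin \<i> :: complex fps)"
    unfolding fps_tan_def by (simp add: fps_divide_unit mult.assoc inverse_mult_eq_1)
  then show ?thesis unfolding X_tanhc
    by (simp add: theta_def fps_cos_deriv mult.assoc)
qed

text \<open>
  The equation \<open>tanh' = 1 - tanh\<^sup>2\<close>.  The left-hand side is the derivative of \<open>x (tanh x / x)\<close> by the
  product rule; it is written with the degree operator because that is how it arises from the
  exponent, one summand from the two coordinates and one from the matrix between them.
\<close>
lemma tanh_ode: "tanhc + theta tanhc = 1 - (fps_X * tanhc) * (fps_X * tanhc)"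
proof -
  have "tanhc + theta tanhc = fps_deriv (fps_X * tanhc)" by (simp add: theta_def)
  also have "\<dots> = inverse (fps_cos \<i> ^ 2)"
    unfolding X_tanhc by (simp add: fps_tan_deriv fps_divide_unit mult.assoc[symmetric])
  also have "\<dots> = 1 - (fps_X * tanhc) * (fps_X * tanhc)"
  proof -
    have ic: "inverse (fps_cos \<i>) * fps_cos \<i> = (1 :: complex fps)" by (simp add: inverse_mult_eq_1)
    have "inverse (fps_cos \<i> ^ 2) = inverse (fps_cos \<i>) ^ 2 * ((fps_cos \<i>)^2 + (fps_sin \<i>)^2 :: complex fps)"
      by (simp add: fps_sin_cos_sum_of_squares fps_inverse_power)
    also have "\<dots> = 1 + fps_tan \<i> ^ 2"
      using ic by (simp add: fps_tan_def fps_divide_unit distrib_left power_mult_distrib[symmetric] mult.commute)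
    also have "\<dots> = 1 - (fps_const (- \<i>) * fps_const (- \<i>)) * fps_tan \<i> ^ 2"
      unfolding fps_const_mult by (simp add: fps_const_neg[symmetric] del: fps_const_neg)
    finally show ?thesis unfolding X_tanhc
      by (simp only: power2_eq_square mult_ac)
  qed
  finally show ?thesis .
qed

lemma tanhc_even: "fps_compose tanhc (fps_const (-1) * fps_X) = tanhc"
proof -
  have sin: "fps_compose (fps_sin \<i>) (fps_const (-1) * fps_X) = - fps_sin \<i>"
    by (rule fps_ext) (auto simp: fps_sin_def)
  have cos: "fps_compose (fps_cos \<i>) (fps_const (-1) * fps_X) = fps_cos \<i>"
    by (rule fps_ext) (auto simp: fps_cos_def)
  have tan: "fps_compose (fps_tan \<i>) (fps_const (-1) * fps_X) = - fps_tan \<i>"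
    unfolding fps_tan_def by (subst fps_compose_divide_distrib) (simp_all only: sin cos, simp_all add: fps_divide_unit fps_cos_neq_0)
  have "fps_compose (fps_X * tanhc) (fps_const (-1) * fps_X) = - (fps_X * tanhc)"
    unfolding X_tanhc by (subst fps_compose_mult_distrib) (simp_all only: tan, simp_all)
  then have "fps_const (-1) * fps_X * fps_compose tanhc (fps_const (-1) * fps_X) = - (fps_X * tanhc)"
    by (subst (asm) fps_compose_mult_distrib) simp_all
  then have "fps_X * fps_compose tanhc (fps_const (-1) * fps_X) = fps_X * tanhc"
    by (simp add: fps_const_neg[symmetric] del: fps_const_neg)
  then show ?thesis by (metis mult_cancel_left fps_X_neq_zero)
qed

section \<open>The coefficients of the biderivation are Casimirs\<close>

lemma multi_indices_0: "multi_indices 0 = {[]}"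
  by (auto simp: multi_indices_def)

lemma sum_multi_indices_Suc:
  "(\<Sum>xs\<in>multi_indices (Suc k). F xs) = (\<Sum>a\<in>UNIV. \<Sum>xs\<in>multi_indices k. F (a # xs))"
proof -
  have "(\<Sum>xs\<in>multi_indices (Suc k). F xs) = (\<Sum>(a,xs)\<in>UNIV \<times> multi_indices k. F (a # xs))"
    by (rule sum.reindex_bij_witness[of _ "\<lambda>(a,xs). a # xs" "\<lambda>xs. (hd xs, tl xs)"])
       (auto simp: multi_indices_def length_Suc_conv)
  then show ?thesis by (simp add: sum.cartesian_product)
qed

lemma sum_multi_indices_1: "(\<Sum>xs\<in>multi_indices 1. F xs) = (\<Sum>a\<in>UNIV. F [a])"
  by (simp add: sum_multi_indices_Suc multi_indices_0)

lemma sum_multi_indices_2: "(\<Sum>xs\<in>multi_indices 2. F xs) = (\<Sum>a\<in>UNIV. \<Sum>b\<in>UNIV. F [a, b])"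
  by (simp add: numeral_2_eq_2 sum_multi_indices_Suc multi_indices_0)

lemma sum_PiE_2:
  "(\<Sum>\<phi>\<in>(\<Pi>\<^sub>E j\<in>{..<2::nat}. S j). F \<phi>)
    = (\<Sum>x\<in>S 0. \<Sum>y\<in>S 1. F (\<lambda>j. if j = 0 then x else if j = 1 then y else undefined))"
proof -
  have "(\<Sum>\<phi>\<in>(\<Pi>\<^sub>E j\<in>{..<2::nat}. S j). F \<phi>)
    = (\<Sum>(x,y)\<in>S 0 \<times> S 1. F (\<lambda>j. if j = 0 then x else if j = 1 then y else undefined))"
    by (rule sum.reindex_bij_witness[of _ "\<lambda>(x,y). (\<lambda>j. if j = 0 then x else if j = 1 then y else undefined)"
          "\<lambda>\<phi>. (\<phi> 0, \<phi> 1)"])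
       (auto simp: PiE_iff extensional_def fun_eq_iff less_2_cases_iff intro!: arg_cong[of _ _ F])
  then show ?thesis by (simp add: sum.cartesian_product)
qed

text \<open>
  Of the two left arrows the second one differentiates \<open>f\<close> or the first coefficient, and of the two
  right arrows the first one differentiates \<open>g\<close> or the second coefficient: four terms.
\<close>
lemma arrow_product_2:
  "arrow_product \<Lambda> 2 f g Z = (\<Sum>a\<in>UNIV. \<Sum>b\<in>UNIV. \<Sum>c\<in>UNIV. \<Sum>d\<in>UNIV.
      pd a (pd b f) Z * \<Lambda> a c Z * \<Lambda> b d Z * pd c (pd d g) Z
    + pd a (pd b f) Z * \<Lambda> a c Z * pd c (\<Lambda> b d) Z * pd d g Z
    + pd a f Z * pd b (\<Lambda> a c) Z * \<Lambda> b d Z * pd c (pd d g) Z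
    + pd a f Z * pd b (\<Lambda> a c) Z * pd c (\<Lambda> b d) Z * pd d g Z)"
proof -
  have s: "{0..3::nat} = {0,1,2,3}" "{2..3::nat} = {2,3}" "{0..1::nat} = {0,1}" "[0..<2] = [0, 1::nat]"
    by (auto simp: upt_rec)
  show ?thesis
    unfolding arrow_product_def sum_multi_indices_2 sum_PiE_2
    by (intro sum.cong refl) (simp add: s pds_def arrow_factor_def algebra_simps)
qed

lemma normal_ordered_product_2:
  "normal_ordered_product \<Lambda> 2 f g Z = (\<Sum>a\<in>UNIV. \<Sum>b\<in>UNIV. \<Sum>c\<in>UNIV. \<Sum>d\<in>UNIV.
      pd a (pd b f) Z * \<Lambda> a c Z * \<Lambda> b d Z * pd c (pd d g) Z)"
  unfolding normal_ordered_product_def sum_multi_indices_2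
  by (intro sum.cong refl) (simp add: pds_def numeral_2_eq_2 lessThan_Suc algebra_simps)

lemma pd_coord_fun: "pd i (\<lambda>Z. Z $ j) = (\<lambda>Z. if i = j then 1 else 0)"
  by (rule ext) (rule pd_coord)

lemma pd_coord_mult: "pd i (\<lambda>Z. Z $ a * Z $ b) = (\<lambda>Z. (if i = a then 1 else 0) * Z $ b + (if i = b then 1 else 0) * Z $ a)"
  by (rule ext) (simp add: pd_mult holomorphic_fun_coord pd_coord)

lemma pd_pd_coord_mult:
  "pd j (pd i (\<lambda>Z. Z $ a * Z $ b)) Z = (if i = a \<and> j = b then 1 else 0) + (if i = b \<and> j = a then 1 else 0)"
proof -
  have *: "pd j (\<lambda>Z. c * Z $ b + d * Z $ a) Z = c * (if j = b then 1 else 0) + d * (if j = a then 1 else 0)" for c d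
    using pd_add[OF holomorphic_fun_mult[OF holomorphic_fun_const[of c] holomorphic_fun_coord[of b]]
        holomorphic_fun_mult[OF holomorphic_fun_const[of d] holomorphic_fun_coord[of a]], of j Z]
      pd_cmult[OF holomorphic_fun_coord, of j c b Z] pd_cmult[OF holomorphic_fun_coord, of j d a Z]
    by (simp only: pd_coord)
  show ?thesis
    unfolding pd_coord_mult * by (cases "i = a"; cases "i = b"; cases "j = a"; cases "j = b") simp_all
qed

lemma sum_delta_mult:
  fixes f :: "'n::finite \<Rightarrow> 'a::semiring_1"
  shows "(\<Sum>i\<in>UNIV. (if i = a then 1 else 0) * f i) = f a"
    and "(\<Sum>i\<in>UNIV. f i * (if i = a then 1 else 0)) = f a"
  by (simp_all add: if_distrib[of "\<lambda>x. x * _"] if_distrib[of "(*) _"] cong: if_cong)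

text \<open>
  With \<open>T c a b\<close> the value of \<open>X\<^sub>c \<Lambda>\<^sup>a\<^sup>b\<close>: it is antisymmetric under exchange of the last two indices
  (\<open>T_skew\<close>) and of the outer two (\<open>P\<close>), hence invariant under cyclic permutations, and its cyclic sum
  vanishes (\<open>J\<close>).
\<close>
lemma coefficients_central:
  fixes \<Lambda> :: "'n::finite \<Rightarrow> 'n \<Rightarrow> complex ^ 'n \<Rightarrow> complex"
  assumes order_zero: "\<And>\<alpha> \<beta>. \<Lambda> \<alpha> \<beta> \<in> H0 2"
    and skew: "\<And>\<alpha> \<beta> Z. \<Lambda> \<alpha> \<beta> Z = - \<Lambda> \<beta> \<alpha> Z"
    and jacobi: "jacobi_rule \<Lambda>"
    and arrows: "\<And>a b f g. f \<in> H0 a \<Longrightarrow> g \<in> H0 b \<Longrightarrow>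
      arrow_product \<Lambda> 2 f g = normal_ordered_product \<Lambda> 2 f g"
  shows "(\<Sum>d\<in>UNIV. \<Lambda> c d Z * pd d (\<Lambda> a b) Z) = 0"
proof -
  define T where "T = (\<lambda>c a b. \<Sum>d\<in>UNIV. \<Lambda> c d Z * pd d (\<Lambda> a b) Z)"
  have hol: "holomorphic_fun (\<Lambda> a b)" for a b using order_zero by (rule H0_holomorphic)
  have pd_skew: "pd d (\<Lambda> a b) Z = - pd d (\<Lambda> b a) Z" for a b d
  proof -
    have "\<Lambda> a b = (\<lambda>Z. (- 1) * \<Lambda> b a Z)" by (rule ext) (subst skew, simp)
    then have "pd d (\<Lambda> a b) Z = pd d (\<lambda>Z. (- 1) * \<Lambda> b a Z) Z" by (rule arg_cong)
    also have "\<dots> = (- 1) * pd d (\<Lambda> b a) Z" by (rule pd_cmult[OF hol])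
    finally show ?thesis by simp
  qed
  have T_skew: "T c a b = - T c b a" for a b c
    unfolding T_def sum_negf[symmetric] by (intro sum.cong refl) (subst pd_skew, simp)
  have br: "bracket \<Lambda> (\<lambda>Z. Z $ a) g W = (\<Sum>\<beta>\<in>UNIV. \<Lambda> a \<beta> W * pd \<beta> g W)" for a g W
  proof -
    have "bracket \<Lambda> (\<lambda>Z. Z $ a) g W
        = (\<Sum>\<alpha>\<in>UNIV. (if \<alpha> = a then 1 else 0) * (\<Sum>\<beta>\<in>UNIV. \<Lambda> \<alpha> \<beta> W * pd \<beta> g W))"
      unfolding bracket_def by (simp add: pd_coord sum_distrib_left) (intro sum.cong refl, auto)
    then show ?thesis by (simp add: sum_delta_mult)
  qed
  have br_coord: "bracket \<Lambda> (\<lambda>Z. Z $ b) (\<lambda>Z. Z $ c) = \<Lambda> b c" for b c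
    by (rule ext) (simp add: br pd_coord sum_delta_mult)
  have J: "T a b c + T b c a + T c a b = 0" for a b c
    using jacobi[unfolded jacobi_rule_def, rule_format, OF H0_coord H0_coord H0_coord, of a b c Z]
    unfolding br_coord br T_def .
  \<comment> \<open>On two coordinates only the term survives in which both coefficients are differentiated.\<close>
  have E: "(\<Sum>x\<in>UNIV. \<Sum>d\<in>UNIV. pd x (\<Lambda> a d) Z * pd d (\<Lambda> x b) Z) = 0" for a b
  proof -
    have "arrow_product \<Lambda> 2 (\<lambda>Z. Z $ a) (\<lambda>Z. Z $ b) Z = normal_ordered_product \<Lambda> 2 (\<lambda>Z. Z $ a) (\<lambda>Z. Z $ b) Z"
      using arrows[OF H0_coord H0_coord] by simp
    then have "(\<Sum>i\<in>UNIV. (if i = a then 1 else 0) * (\<Sum>x\<in>UNIV. \<Sum>d\<in>UNIV. \<Sum>j\<in>UNIV.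
         pd x (\<Lambda> i d) Z * pd d (\<Lambda> x j) Z * (if j = b then 1 else 0))) = 0"
      unfolding arrow_product_2 normal_ordered_product_2 pd_coord_fun
      by (simp add: sum_distrib_left mult.assoc)
    then show ?thesis by (simp add: sum_delta_mult)
  qed
  \<comment> \<open>On a coordinate and a product of two coordinates the term just seen to vanish appears again, and
    the remaining one symmetrizes \<open>X\<^sub>b \<Lambda>\<^sup>a\<^sup>c\<close> in \<open>b\<close> and \<open>c\<close>.\<close>
  have P: "T c a b = - T b a c" for a b c
  proof -
    let ?g = "\<lambda>Z. Z $ b * Z $ c"
    have "arrow_product \<Lambda> 2 (\<lambda>Z. Z $ a) ?g Z = normal_ordered_product \<Lambda> 2 (\<lambda>Z. Z $ a) ?g Z"
      using arrows[OF H0_coord H0_mult[OF H0_coord H0_coord]] by simp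
    then have "(\<Sum>i\<in>UNIV. (if i = a then 1 else 0) * (\<Sum>x\<in>UNIV. \<Sum>d\<in>UNIV. \<Sum>j\<in>UNIV.
         pd x (\<Lambda> i d) Z * \<Lambda> x j Z * pd d (pd j ?g) Z + pd x (\<Lambda> i d) Z * pd d (\<Lambda> x j) Z * pd j ?g Z)) = 0"
      unfolding arrow_product_2 normal_ordered_product_2 pd_coord_fun
      by (simp add: sum_distrib_left mult.assoc distrib_left)
    then have "(\<Sum>x\<in>UNIV. \<Sum>d\<in>UNIV. \<Sum>j\<in>UNIV. pd x (\<Lambda> a d) Z * \<Lambda> x j Z * pd d (pd j ?g) Z)
        + (\<Sum>x\<in>UNIV. \<Sum>d\<in>UNIV. \<Sum>j\<in>UNIV. pd x (\<Lambda> a d) Z * pd d (\<Lambda> x j) Z * pd j ?g Z) = 0"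
      by (simp only: sum_delta_mult sum.distrib)
    moreover have "(\<Sum>x\<in>UNIV. \<Sum>d\<in>UNIV. \<Sum>j\<in>UNIV. pd x (\<Lambda> a d) Z * pd d (\<Lambda> x j) Z * pd j ?g Z)
        = (\<Sum>j\<in>UNIV. (\<Sum>x\<in>UNIV. \<Sum>d\<in>UNIV. pd x (\<Lambda> a d) Z * pd d (\<Lambda> x j) Z) * pd j ?g Z)"
      unfolding sum_distrib_right
      by (subst (2) sum.swap, subst sum.swap, rule sum.cong[OF refl], rule refl)
    ultimately have "(\<Sum>x\<in>UNIV. \<Sum>d\<in>UNIV. \<Sum>j\<in>UNIV. pd x (\<Lambda> a d) Z * \<Lambda> x j Z * pd d (pd j ?g) Z) = 0"
      by (simp add: E)
    then have "(\<Sum>x\<in>UNIV. \<Sum>d\<in>UNIV. \<Sum>j\<in>UNIV. pd x (\<Lambda> a d) Z * \<Lambda> x j Z *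
        ((if j = b then 1 else 0) * (if d = c then 1 else 0) + (if j = c then 1 else 0) * (if d = b then 1 else 0))) = 0"
      unfolding pd_pd_coord_mult
      by (simp add: if_distrib[of "\<lambda>x. x * _"] if_if_eq_conj cong: if_cong)
    then have "(\<Sum>x\<in>UNIV. pd x (\<Lambda> a c) Z * \<Lambda> x b Z + pd x (\<Lambda> a b) Z * \<Lambda> x c Z) = 0"
      by (simp only: distrib_left mult.assoc[symmetric] sum.distrib sum_delta_mult)
         (simp only: sum_distrib_right[symmetric] sum_delta_mult)
    moreover have "(\<Sum>x\<in>UNIV. \<Lambda> b x Z * pd x (\<Lambda> a c) Z + \<Lambda> c x Z * pd x (\<Lambda> a b) Z)
        = - (\<Sum>x\<in>UNIV. pd x (\<Lambda> a c) Z * \<Lambda> x b Z + pd x (\<Lambda> a b) Z * \<Lambda> x c Z)"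
      unfolding sum_negf[symmetric]
    proof (rule sum.cong[OF refl])
      fix x
      show "\<Lambda> b x Z * pd x (\<Lambda> a c) Z + \<Lambda> c x Z * pd x (\<Lambda> a b) Z
          = - (pd x (\<Lambda> a c) Z * \<Lambda> x b Z + pd x (\<Lambda> a b) Z * \<Lambda> x c Z)"
        unfolding skew[of b x Z] skew[of c x Z] by (simp add: algebra_simps)
    qed
    ultimately have "(\<Sum>x\<in>UNIV. \<Lambda> b x Z * pd x (\<Lambda> a c) Z + \<Lambda> c x Z * pd x (\<Lambda> a b) Z) = 0"
      by simp
    then show ?thesis unfolding T_def by (simp add: sum.distrib add_eq_0_iff)
  qed
  have cyc: "T c a b = T b c a" for a b c using P[of c a b] T_skew[of b a c] by simp
  have "3 * T c a b = 0" using J[of c a b] cyc[of c a b] cyc[of b c a] by simp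
  then show ?thesis unfolding T_def by simp
qed

section \<open>Star multiplication by a quadratic form\<close>

definition coord :: "'n::finite \<Rightarrow> 'n formal" where
  "coord i = homog 1 (\<lambda>W. W $ i)"

lemma quad_form_coord: "quad_form M Z = (\<Sum>i\<in>UNIV. \<Sum>j\<in>UNIV. coord i Z * M $ i $ j * coord j Z)"
  by (simp add: quad_form_def coord_def)

abbreviation hamiltonian :: "complex ^ 'n::finite ^ 'n \<Rightarrow> 'n formal" where
  "hamiltonian A \<equiv> (\<lambda>Z. inv_mu * quad_form (const_matrix A) Z)"

lemma formal_sections_coord [intro, simp]: "coord i \<in> formal_sections"
  unfolding coord_def by (intro formal_sections_homog H0_coord)

lemma fpd_coord [simp]: "fpd a (coord i) = (\<lambda>Z. if a = i then 1 else 0)"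
proof -
  have "fpd a (coord i) = homog 0 (pd a (\<lambda>W. W $ i))"
    unfolding coord_def One_nat_def
    by (rule fpd_homog_Suc) (rule H0_coord[unfolded One_nat_def])
  then show ?thesis by (simp add: homog_def pd_coord const_def fun_eq_iff)
qed

lemma mu_inv_mu: "mu * inv_mu = 1"
  unfolding mu_def inv_mu_def fps_const_mult fls_inverse_X[symmetric] by simp

lemma symmetric_nth:
  assumes "transpose A = A"
  shows "A $ i $ j = A $ j $ i"
proof -
  have "transpose A $ j $ i = A $ i $ j" by (simp add: transpose_def)
  then show ?thesis by (simp only: assms)
qed

lemma fpd_hamiltonian:
  assumes sym: "transpose A = A"
  shows "fpd a (hamiltonian A) = (\<lambda>Z. 2 * inv_mu * (\<Sum>j\<in>UNIV. const (A $ a $ j) * coord j Z))"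
proof
  fix Z
  have A: "A $ i $ j = A $ j $ i" for i j
    using sym by (rule symmetric_nth)
  have S: "(\<lambda>Z. coord i Z * const (A $ i $ j) * coord j Z) \<in> formal_sections" for i j
    by (intro formal_sections_mult) auto
  have "fpd a (hamiltonian A) Z = inv_mu * (\<Sum>i\<in>UNIV. \<Sum>j\<in>UNIV. fpd a (\<lambda>Z. coord i Z * const (A $ i $ j) * coord j Z) Z)"
    unfolding quad_form_coord const_matrix_def vec_lambda_beta
    by (subst fpd_mult) (auto simp: fpd_sum S formal_sections_sum)
  also have "(\<Sum>i\<in>UNIV. \<Sum>j\<in>UNIV. fpd a (\<lambda>Z. coord i Z * const (A $ i $ j) * coord j Z) Z)
      = (\<Sum>i\<in>UNIV. \<Sum>j\<in>UNIV. (if i = a then 1 else 0) * (const (A $ i $ j) * coord j Z))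
       + (\<Sum>i\<in>UNIV. \<Sum>j\<in>UNIV. coord i Z * const (A $ i $ j) * (if j = a then 1 else 0))"
    unfolding sum.distrib[symmetric]
    by (intro sum.cong refl) (simp add: fpd_mult formal_sections_mult)
  also have "\<dots> = 2 * (\<Sum>j\<in>UNIV. const (A $ a $ j) * coord j Z)"
    unfolding sum_distrib_left[symmetric] sum_delta_mult A[of _ a] by (simp add: mult.commute)
  finally show "fpd a (hamiltonian A) Z = 2 * inv_mu * (\<Sum>j\<in>UNIV. const (A $ a $ j) * coord j Z)"
    by (simp add: mult_ac)
qed

lemma fpd_fpd_hamiltonian:
  assumes sym: "transpose A = A"
  shows "fpd b (fpd a (hamiltonian A)) = (\<lambda>Z. 2 * inv_mu * const (A $ a $ b))"
proof
  fix Z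
  have two: "(2::scalar) * inv_mu = fps_const (2 * fls_X)" by (simp add: inv_mu_def numeral_fps_const)
  have S: "(\<lambda>Z. const (A $ a $ j) * coord j Z) \<in> formal_sections" for j
    by (intro formal_sections_mult) auto
  have "fpd b (fpd a (hamiltonian A)) Z = 2 * inv_mu * (\<Sum>j\<in>UNIV. fpd b (\<lambda>Z. const (A $ a $ j) * coord j Z) Z)"
    unfolding fpd_hamiltonian[OF sym] two
    by (subst fpd_mult) (auto simp: fpd_sum S formal_sections_sum)
  also have "(\<Sum>j\<in>UNIV. fpd b (\<lambda>Z. const (A $ a $ j) * coord j Z) Z) = (\<Sum>j\<in>UNIV. const (A $ a $ j) * (if j = b then 1 else 0))"
    by (intro sum.cong refl) (simp add: fpd_mult)
  finally show "fpd b (fpd a (hamiltonian A)) Z = 2 * inv_mu * const (A $ a $ b)"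
    by (simp only: sum_delta_mult)
qed

lemma fpd_fpd_fpd_hamiltonian:
  assumes sym: "transpose A = A"
  shows "fpd c (fpd b (fpd a (hamiltonian A))) = (\<lambda>Z. 0)"
proof -
  have "2 * inv_mu * const (A $ a $ b) = fps_const (2 * fls_X * fls_const (A $ a $ b))"
    by (simp add: inv_mu_def numeral_fps_const const_def)
  then show ?thesis unfolding fpd_fpd_hamiltonian[OF sym] by simp
qed

lemma fpds_hamiltonian_eq_0:
  assumes sym: "transpose A = A"
  shows "3 \<le> length as \<Longrightarrow> fpds as (hamiltonian A) = (\<lambda>Z. 0)"
proof (induction as)
  case (Cons a as)
  show ?case
  proof (cases "3 \<le> length as")
    case True
    then show ?thesis using Cons by (simp add: fpds_def)
  next
    case False
    with Cons.prems have "length as = 2" by simp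
    then obtain b c where "as = [b, c]"
      by (auto simp: numeral_2_eq_2 length_Suc_conv)
    then show ?thesis using fpd_fpd_fpd_hamiltonian[OF sym] by (simp add: fpds_def)
  qed
qed simp

text \<open>
  All derivatives of \<open>A[Z]\<close> of order at least three vanish, so the star product stops after the
  second-order term.  For \<open>k \<ge> 1\<close> the factors \<open>\<mu>\<^sup>k\<close> cancel against the \<open>1/\<mu>\<close> in front of \<open>A[Z]\<close> up to one power of
  \<open>\<mu>\<close> in the last term.
\<close>
lemma star_hamiltonian:
  assumes sym: "transpose A = A"
  shows "star \<Lambda> (hamiltonian A) F Z = hamiltonian A Z * F Z
    + (\<Sum>a\<in>UNIV. (\<Sum>j\<in>UNIV. const (A $ a $ j) * coord j Z) * ham \<Lambda> a F Z)
    + const (1/4) * mu * (\<Sum>a\<in>UNIV. \<Sum>b\<in>UNIV. const (A $ a $ b) *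
        (\<Sum>c\<in>UNIV. \<Sum>d\<in>UNIV. homog 2 (\<Lambda> a c) Z * homog 2 (\<Lambda> b d) Z * fpd c (fpd d F) Z))"
proof -
  define t where "t = (\<lambda>k. const (1 / fact k) * (const (1 / 2) * mu) ^ k *
     (\<Sum>\<alpha>s\<in>multi_indices k. \<Sum>\<beta>s\<in>multi_indices k.
        (\<Prod>i<k. homog 2 (\<Lambda> (\<alpha>s ! i) (\<beta>s ! i)) Z) * fpds \<alpha>s (hamiltonian A) Z * fpds \<beta>s F Z))"
  have "t k = 0" if "k \<notin> {0, 1, 2}" for k
  proof -
    have "fpds \<alpha>s (hamiltonian A) Z = 0" if "\<alpha>s \<in> multi_indices k" for \<alpha>s
      using fpds_hamiltonian_eq_0[OF sym, of \<alpha>s] that \<open>k \<notin> {0, 1, 2}\<close> by (simp add: multi_indices_def)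
    then show ?thesis by (simp add: t_def)
  qed
  then have "star \<Lambda> (hamiltonian A) F Z = (\<Sum>k\<in>{0, 1, 2}. t k)"
    unfolding star_def t_def[symmetric] by (intro suminf_finite) auto
  also have "\<dots> = t 0 + t 1 + t 2" by simp
  also have "t 0 = hamiltonian A Z * F Z"
    by (simp add: t_def multi_indices_0 fpds_def)
  also have "t 1 = (\<Sum>a\<in>UNIV. (\<Sum>j\<in>UNIV. const (A $ a $ j) * coord j Z) * ham \<Lambda> a F Z)"
  proof -
    have c: "const (1/2) * 2 = 1"
      using const_mult[of "1/2" 2] const_numeral[of "num.Bit0 num.One"] by simp
    define l where "l = (\<lambda>a. \<Sum>j\<in>UNIV. const (A $ a $ j) * coord j Z)"
    have "t 1 = const (1/2) * mu * (\<Sum>a\<in>UNIV. \<Sum>b\<in>UNIV. homog 2 (\<Lambda> a b) Z * (2 * inv_mu * l a) * fpd b F Z)"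
      unfolding t_def sum_multi_indices_1 l_def by (simp add: fpds_def fpd_hamiltonian[OF sym])
    also have "\<dots> = (const (1/2) * 2) * (mu * inv_mu) * (\<Sum>a\<in>UNIV. l a * ham \<Lambda> a F Z)"
      unfolding ham_def by (simp only: sum_distrib_left mult_ac)
    also have "\<dots> = (\<Sum>a\<in>UNIV. l a * ham \<Lambda> a F Z)" by (simp only: c mu_inv_mu mult_1_left)
    finally show ?thesis unfolding l_def .
  qed
  also have "t 2 = const (1/4) * mu * (\<Sum>a\<in>UNIV. \<Sum>b\<in>UNIV. const (A $ a $ b) *
        (\<Sum>c\<in>UNIV. \<Sum>d\<in>UNIV. homog 2 (\<Lambda> a c) Z * homog 2 (\<Lambda> b d) Z * fpd c (fpd d F) Z))"
  proof -
    have c: "const (1/2) * (const (1/2) * const (1/2)) * 2 = const (1/4)"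
      using const_numeral[of "num.Bit0 num.One"] by (simp only: const_mult[symmetric] flip: const_numeral) simp
    have A: "A $ b $ a = A $ a $ b" for a b
      using sym by (rule symmetric_nth)
    have "t 2 = const (1/2) * (const (1/2) * mu) ^ 2 * (\<Sum>a\<in>UNIV. \<Sum>b\<in>UNIV. \<Sum>c\<in>UNIV. \<Sum>d\<in>UNIV.
        (homog 2 (\<Lambda> a c) Z * homog 2 (\<Lambda> b d) Z) * (2 * inv_mu * const (A $ a $ b)) * fpd c (fpd d F) Z)"
      unfolding t_def sum_multi_indices_2
      by (simp add: fpds_def fpd_fpd_hamiltonian[OF sym] A numeral_2_eq_2 lessThan_Suc mult_ac)
    also have "\<dots> = (const (1/2) * (const (1/2) * const (1/2)) * 2) * (mu * inv_mu) * mu *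
       (\<Sum>a\<in>UNIV. \<Sum>b\<in>UNIV. const (A $ a $ b) *
        (\<Sum>c\<in>UNIV. \<Sum>d\<in>UNIV. homog 2 (\<Lambda> a c) Z * homog 2 (\<Lambda> b d) Z * fpd c (fpd d F) Z))"
      by (simp only: sum_distrib_left mult_ac power2_eq_square)
    finally show ?thesis by (simp only: c mu_inv_mu mult_1_right)
  qed
  finally show ?thesis .
qed

section \<open>Trading time for degree\<close>

definition monomial_of_degree :: "nat \<Rightarrow> 'a::zero fps \<Rightarrow> bool" where
  "monomial_of_degree d x \<longleftrightarrow> (\<forall>n. n \<noteq> d \<longrightarrow> fps_nth x n = 0)"

lemma monomial_mult_nth:
  fixes x y :: "'a::comm_ring_1 fps"
  assumes "monomial_of_degree d x"
  shows "fps_nth (x * y) n = (if n < d then 0 else fps_nth x d * fps_nth y (n - d))"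
proof -
  have "fps_nth (x * y) n = (\<Sum>i=0..n. if i = d then fps_nth x d * fps_nth y (n - d) else 0)"
    unfolding fps_mult_nth using assms by (intro sum.cong) (auto simp: monomial_of_degree_def)
  then show ?thesis by (simp add: sum.delta)
qed

lemma monomial_mult:
  "monomial_of_degree d x \<Longrightarrow> monomial_of_degree e y \<Longrightarrow> monomial_of_degree (d + e) (x * y :: 'a::comm_ring_1 fps)"
  by (subst monomial_of_degree_def) (auto simp: monomial_mult_nth, auto simp: monomial_of_degree_def)

lemma monomial_sum:
  "(\<And>i. i \<in> I \<Longrightarrow> monomial_of_degree d (f i)) \<Longrightarrow> monomial_of_degree d (\<Sum>i\<in>I. f i :: 'a::comm_ring_1 fps)"
  by (simp add: monomial_of_degree_def fps_sum_nth)

lemma monomial_homog: "monomial_of_degree k (homog k f Z)"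
  by (auto simp: monomial_of_degree_def homog_def const_def fps_X_power_mult_right_nth)

lemma monomial_coord: "monomial_of_degree 1 (coord i Z)"
  unfolding coord_def by (rule monomial_homog)

lemma monomial_const: "monomial_of_degree 0 (const c)" "monomial_of_degree 0 mu" "monomial_of_degree 0 inv_mu"
  by (auto simp: monomial_of_degree_def const_def mu_def inv_mu_def)

text \<open>
  The derivatives of \<open>F\<close> of order \<open>0\<close>, \<open>1\<close>, \<open>2\<close> come with coefficients of degree \<open>2\<close>, \<open>3\<close>, \<open>4\<close>: in all
  three cases the degree goes up by two.
\<close>
lemma star_hamiltonian_graded:
  assumes sym: "transpose A = A"
  obtains x0 x1 x2 where
    "monomial_of_degree 2 x0" "\<And>b. monomial_of_degree 3 (x1 b)" "\<And>c d. monomial_of_degree 4 (x2 c d)"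
    "\<And>F. star \<Lambda> (hamiltonian A) F Z = x0 * F Z + (\<Sum>b\<in>UNIV. x1 b * fpd b F Z)
       + (\<Sum>c\<in>UNIV. \<Sum>d\<in>UNIV. x2 c d * fpd c (fpd d F) Z)"
proof (rule that)
  have h1: "monomial_of_degree 1 (const c * coord i Z)" for c i
    using monomial_mult[OF monomial_const(1)[of c] monomial_coord[of i Z]] by simp
  show "monomial_of_degree 2 (hamiltonian A Z)"
  proof -
    have "monomial_of_degree (0 + (1 + 0 + 1)) (hamiltonian A Z)"
      unfolding quad_form_coord const_matrix_def vec_lambda_beta
      by (intro monomial_mult monomial_sum monomial_coord monomial_const)
    then show ?thesis by (simp add: numeral_2_eq_2)
  qed
  show "monomial_of_degree 3 (\<Sum>a\<in>UNIV. (\<Sum>j\<in>UNIV. const (A $ a $ j) * coord j Z) * homog 2 (\<Lambda> a b) Z)" for b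
  proof -
    have "monomial_of_degree (1 + 2) (\<Sum>a\<in>UNIV. (\<Sum>j\<in>UNIV. const (A $ a $ j) * coord j Z) * homog 2 (\<Lambda> a b) Z)"
      by (intro monomial_sum monomial_mult h1 monomial_homog)
    then show ?thesis by (simp add: numeral_3_eq_3)
  qed
  show "monomial_of_degree 4 (\<Sum>a\<in>UNIV. \<Sum>b\<in>UNIV. const (1/4) * mu * const (A $ a $ b) * (homog 2 (\<Lambda> a c) Z * homog 2 (\<Lambda> b d) Z))" for c d
  proof -
    have "monomial_of_degree (0 + 0 + 0 + (2 + 2)) (\<Sum>a\<in>UNIV. \<Sum>b\<in>UNIV. const (1/4) * mu * const (A $ a $ b) * (homog 2 (\<Lambda> a c) Z * homog 2 (\<Lambda> b d) Z))"
      by (intro monomial_sum monomial_mult monomial_const monomial_homog)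
    then show ?thesis by simp
  qed
  fix F
  have e1: "(\<Sum>a\<in>UNIV. (\<Sum>j\<in>UNIV. const (A $ a $ j) * coord j Z) * ham \<Lambda> a F Z)
      = (\<Sum>b\<in>UNIV. (\<Sum>a\<in>UNIV. (\<Sum>j\<in>UNIV. const (A $ a $ j) * coord j Z) * homog 2 (\<Lambda> a b) Z) * fpd b F Z)"
  proof -
    have "(\<Sum>a\<in>UNIV. l a * (\<Sum>b\<in>UNIV. h a b * f b)) = (\<Sum>b\<in>UNIV. (\<Sum>a\<in>UNIV. l a * h a b) * f b)"
      for l :: "'a \<Rightarrow> scalar" and h :: "'a \<Rightarrow> 'a \<Rightarrow> scalar" and f
      unfolding sum_distrib_left sum_distrib_right mult.assoc by (rule sum.swap)
    then show ?thesis unfolding ham_def .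
  qed
  have e2: "const (1/4) * mu * (\<Sum>a\<in>UNIV. \<Sum>b\<in>UNIV. const (A $ a $ b) *
        (\<Sum>c\<in>UNIV. \<Sum>d\<in>UNIV. homog 2 (\<Lambda> a c) Z * homog 2 (\<Lambda> b d) Z * fpd c (fpd d F) Z))
    = (\<Sum>c\<in>UNIV. \<Sum>d\<in>UNIV. (\<Sum>a\<in>UNIV. \<Sum>b\<in>UNIV. const (1/4) * mu * const (A $ a $ b) *
        (homog 2 (\<Lambda> a c) Z * homog 2 (\<Lambda> b d) Z)) * fpd c (fpd d F) Z)"
  proof -
    have "(\<Sum>a\<in>UNIV. \<Sum>b\<in>UNIV. \<Sum>c\<in>UNIV. \<Sum>d\<in>UNIV. f a b c d)
        = (\<Sum>c\<in>UNIV. \<Sum>d\<in>UNIV. \<Sum>a\<in>UNIV. \<Sum>b\<in>UNIV. f a b c d)" for f :: "'a \<Rightarrow> 'a \<Rightarrow> 'a \<Rightarrow> 'a \<Rightarrow> scalar"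
    proof -
      have swap3: "(\<Sum>b\<in>UNIV. \<Sum>c\<in>UNIV. \<Sum>d\<in>UNIV. h b c d) = (\<Sum>c\<in>UNIV. \<Sum>d\<in>UNIV. \<Sum>b\<in>UNIV. h b c d)"
        for h :: "'a \<Rightarrow> 'a \<Rightarrow> 'a \<Rightarrow> scalar"
        by (subst sum.swap, rule sum.cong[OF refl], rule sum.swap)
      have "(\<Sum>a\<in>UNIV. \<Sum>b\<in>UNIV. \<Sum>c\<in>UNIV. \<Sum>d\<in>UNIV. f a b c d)
          = (\<Sum>a\<in>UNIV. \<Sum>c\<in>UNIV. \<Sum>d\<in>UNIV. \<Sum>b\<in>UNIV. f a b c d)"
        by (rule sum.cong[OF refl], rule swap3)
      also have "\<dots> = (\<Sum>c\<in>UNIV. \<Sum>d\<in>UNIV. \<Sum>a\<in>UNIV. \<Sum>b\<in>UNIV. f a b c d)"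
        by (rule swap3)
      finally show ?thesis .
    qed
    then show ?thesis
      unfolding sum_distrib_left sum_distrib_right by (simp only: mult.assoc)
  qed
  show "star \<Lambda> (hamiltonian A) F Z = hamiltonian A Z * F Z
     + (\<Sum>b\<in>UNIV. (\<Sum>a\<in>UNIV. (\<Sum>j\<in>UNIV. const (A $ a $ j) * coord j Z) * homog 2 (\<Lambda> a b) Z) * fpd b F Z)
     + (\<Sum>c\<in>UNIV. \<Sum>d\<in>UNIV. (\<Sum>a\<in>UNIV. \<Sum>b\<in>UNIV. const (1/4) * mu * const (A $ a $ b) *
        (homog 2 (\<Lambda> a c) Z * homog 2 (\<Lambda> b d) Z)) * fpd c (fpd d F) Z)"
    unfolding star_hamiltonian[OF sym] e1 e2 ..
qed

lemma fpd_scaled: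
  assumes F: "F \<in> formal_sections" and F': "F' \<in> formal_sections"
    and sc: "\<And>W. fps_nth (F' W) (Suc k) = fls_const c * fps_nth (F W) (Suc k)"
  shows "fps_nth (fpd a F' W) k = fls_const c * fps_nth (fpd a F W) k"
proof (rule fls_eqI)
  fix m
  have "coef (fpd a F') k m W = pd a (\<lambda>W. c * coef F (Suc k) m W) W"
    unfolding coef_fpd[OF F'] by (simp add: sc)
  also have "\<dots> = c * pd a (coef F (Suc k) m) W"
    by (rule pd_cmult) (rule formal_sections_holomorphic[OF F])
  finally show "coef (fpd a F') k m W = fls_nth (fls_const c * fps_nth (fpd a F W) k) m"
    by (simp add: coef_fpd[OF F])
qed

text \<open>
  The component of degree \<open>k + 2\<close> depends linearly on the component of degree \<open>k\<close> alone.  With \<open>c = 1\<close>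
  this gives uniqueness of the flow, with \<open>c = 0\<close> the vanishing of odd degrees, and with a power of the
  time the scaling of the solution.
\<close>
lemma star_hamiltonian_nth_scaled:
  assumes sym: "transpose A = A" and F: "F \<in> formal_sections" and F': "F' \<in> formal_sections"
    and sc: "\<And>W. fps_nth (F' W) k = fls_const c * fps_nth (F W) k"
  shows "fps_nth (star \<Lambda> (hamiltonian A) F' Z) (k + 2) = fls_const c * fps_nth (star \<Lambda> (hamiltonian A) F Z) (k + 2)"
proof -
  obtain x0 x1 x2 where x: "monomial_of_degree 2 x0" "\<And>b. monomial_of_degree 3 (x1 b)" "\<And>c d. monomial_of_degree 4 (x2 c d)"
    and st: "\<And>F. star \<Lambda> (hamiltonian A) F Z = x0 * F Z + (\<Sum>b\<in>UNIV. x1 b * fpd b F Z)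
       + (\<Sum>c\<in>UNIV. \<Sum>d\<in>UNIV. x2 c d * fpd c (fpd d F) Z)"
    by (rule star_hamiltonian_graded[OF sym, of \<Lambda> Z]) (rule that)
  have 1: "fps_nth (fpd b F' W) (k - 1) = fls_const c * fps_nth (fpd b F W) (k - 1)" if "1 \<le> k" for b W
    by (rule fpd_scaled[OF F F']) (use sc that in simp)
  have 2: "fps_nth (fpd b (fpd d F') W) (k - 2) = fls_const c * fps_nth (fpd b (fpd d F) W) (k - 2)" if "2 \<le> k" for b d W
  proof (rule fpd_scaled[OF formal_sections_fpd[OF F] formal_sections_fpd[OF F']])
    have s: "Suc (k - 2) = k - 1" using that by simp
    show "fps_nth (fpd d F' W) (Suc (k - 2)) = fls_const c * fps_nth (fpd d F W) (Suc (k - 2))" for W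
      unfolding s by (rule 1) (use that in simp)
  qed
  have t0: "fps_nth (x0 * F' Z) (k + 2) = fls_const c * fps_nth (x0 * F Z) (k + 2)"
    by (simp add: monomial_mult_nth[OF x(1)] sc mult_ac)
  have t1: "fps_nth (x1 b * fpd b F' Z) (k + 2) = fls_const c * fps_nth (x1 b * fpd b F Z) (k + 2)" for b
  proof (cases "1 \<le> k")
    case True
    then have "k + 2 - 3 = k - 1" "\<not> k + 2 < 3" by auto
    then show ?thesis by (simp only: monomial_mult_nth[OF x(2)] 1[OF True] mult_ac if_False)
  qed (simp add: monomial_mult_nth[OF x(2)])
  have t2: "fps_nth (x2 b d * fpd b (fpd d F') Z) (k + 2) = fls_const c * fps_nth (x2 b d * fpd b (fpd d F) Z) (k + 2)" for b d
  proof (cases "2 \<le> k")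
    case True
    then have "k + 2 - 4 = k - 2" "\<not> k + 2 < 4" by auto
    then show ?thesis by (simp only: monomial_mult_nth[OF x(3)] 2[OF True] mult_ac if_False)
  qed (simp add: monomial_mult_nth[OF x(3)])
  show ?thesis
    unfolding st fps_add_nth fps_sum_nth t0 t1 t2 by (simp only: distrib_left sum_distrib_left)
qed

lemma star_hamiltonian_nth_low:
  assumes sym: "transpose A = A" and "n < 2"
  shows "fps_nth (star \<Lambda> (hamiltonian A) F Z) n = 0"
proof -
  obtain x0 x1 x2 where x: "monomial_of_degree 2 x0" "\<And>b. monomial_of_degree 3 (x1 b)" "\<And>c d. monomial_of_degree 4 (x2 c d)"
    and st: "\<And>F. star \<Lambda> (hamiltonian A) F Z = x0 * F Z + (\<Sum>b\<in>UNIV. x1 b * fpd b F Z)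
       + (\<Sum>c\<in>UNIV. \<Sum>d\<in>UNIV. x2 c d * fpd c (fpd d F) Z)"
    by (rule star_hamiltonian_graded[OF sym, of \<Lambda> Z]) (rule that)
  show ?thesis using assms(2)
    unfolding st fps_add_nth fps_sum_nth
    by (simp add: monomial_mult_nth[OF x(1)] monomial_mult_nth[OF x(2)] monomial_mult_nth[OF x(3)])
qed

text \<open>
  By induction on the degree: the time derivative of the component of degree \<open>k\<close> is determined by
  the component of degree \<open>k - 2\<close>.
\<close>
lemma star_flow_unique:
  assumes sym: "transpose A = A"
    and F: "star_flow \<Lambda> (hamiltonian A) F" and F': "star_flow \<Lambda> (hamiltonian A) F'"
  shows "F = F'"
proof -
  have "fps_nth (F t Z) k = fps_nth (F' t Z) k" for k t Z
  proof (induction k arbitrary: t Z rule: less_induct)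
    case (less k)
    have "fps_nth (star \<Lambda> (hamiltonian A) (F t) Z) k = fps_nth (star \<Lambda> (hamiltonian A) (F' t) Z) k" for t
    proof (cases "k < 2")
      case True
      then show ?thesis by (simp add: star_hamiltonian_nth_low[OF sym])
    next
      case False
      then have k: "k - 2 + 2 = k" "k - 2 < k" by auto
      have "fps_nth (star \<Lambda> (hamiltonian A) (F t) Z) (k - 2 + 2)
          = fls_const 1 * fps_nth (star \<Lambda> (hamiltonian A) (F' t) Z) (k - 2 + 2)"
        by (rule star_hamiltonian_nth_scaled[OF sym])
           (use F F' less[OF k(2)] in \<open>auto simp: star_flow_def\<close>)
      then show ?thesis by (simp only: k fls_const_1 mult_1_left)
    qed
    note same = this
    show ?case
    proof (rule fls_eqI)
      fix m
      have "((\<lambda>s. coef (F s) k m Z - coef (F' s) k m Z) has_vector_derivative 0) (at s)" for s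
        using F F' same[of s] has_vector_derivative_diff[of "\<lambda>s. coef (F s) k m Z" _ "at s" "\<lambda>s. coef (F' s) k m Z"]
        unfolding star_flow_def by (metis (no_types, lifting) diff_self)
      then obtain c where "\<And>s. coef (F s) k m Z - coef (F' s) k m Z = c"
        using has_vector_derivative_zero_constant[of UNIV "\<lambda>s. coef (F s) k m Z - coef (F' s) k m Z"] by auto
      moreover have "F 0 Z = F' 0 Z" using F F' by (simp add: star_flow_def)
      ultimately show "coef (F t) k m Z = coef (F' t) k m Z"
        by (metis cancel_comm_monoid_add_class.diff_cancel eq_iff_diff_eq_0)
    qed
  qed
  then show ?thesis by (simp add: fun_eq_iff fps_eq_iff)
qed

text \<open>
  Replacing the component \<open>G\<^sub>k\<close> by \<open>t\<^sup>k\<^sup>/\<^sup>2 G\<^sub>k\<close> turns the equation for the degree operator into the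
  evolution equation, since \<open>d/dt\<close> of \<open>t\<^sup>k\<^sup>/\<^sup>2\<close> is \<open>k/2\<close> times \<open>t\<^sup>(\<^sup>k\<^sup>-\<^sup>2\<^sup>)\<^sup>/\<^sup>2\<close>.  Only even degrees occur, so integer
  division by two is harmless.
\<close>
lemma star_flow_of_grading:
  assumes sym: "transpose A = A" and G: "G \<in> formal_sections"
    and G0: "\<And>Z. fps_nth (G Z) 0 = 1"
    and ode: "\<And>Z. theta (G Z) = 2 * star \<Lambda> (hamiltonian A) G Z"
  defines "F \<equiv> (\<lambda>t::real. \<lambda>Z. Abs_fps (\<lambda>k. fls_const (of_real (t ^ (k div 2))) * fps_nth (G Z) k))"
  shows "star_flow \<Lambda> (hamiltonian A) F" "F 1 = G"
proof -
  let ?H = "hamiltonian A"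
  have ode_nth: "of_nat k * coef G k m Z = 2 * fls_nth (fps_nth (star \<Lambda> ?H G Z) k) m" for k m Z
  proof -
    have "fls_nth (fps_nth (theta (G Z)) k) m = fls_nth (fps_nth (2 * star \<Lambda> ?H G Z) k) m" by (simp add: ode)
    then show ?thesis
      by (simp only: theta_nth fls_of_nat_mult_nth mult_2 fps_add_nth fls_plus_nth)
  qed
  have coef_F: "coef (F t) k m Z = of_real (t ^ (k div 2)) * coef G k m Z" for t k m Z
    by (simp add: F_def)
  have FS: "F t \<in> formal_sections" for t
    unfolding formal_sections_iff
  proof
    fix k
    obtain N where "\<forall>m<N. \<forall>Z. coef G k m Z = 0" using G unfolding formal_sections_iff by blast
    then show "(\<forall>m. coef (F t) k m \<in> H0 k) \<and> (\<exists>N. \<forall>m<N. \<forall>Z. coef (F t) k m Z = 0)"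
      unfolding coef_F using H0_cmult[OF formal_sections_H0[OF G]] by (metis mult_zero_right)
  qed
  have odd: "odd k \<Longrightarrow> coef G k m Z = 0" for k m Z
  proof (induction k arbitrary: m Z rule: less_induct)
    case (less k)
    have "fps_nth (star \<Lambda> ?H G Z) k = 0"
    proof (cases "k < 2")
      case True then show ?thesis by (rule star_hamiltonian_nth_low[OF sym])
    next
      case False
      then have k: "k - 2 + 2 = k" "k - 2 < k" "odd (k - 2)" using less.prems by auto
      have "fps_nth (G W) (k - 2) = fls_const 0 * fps_nth (G W) (k - 2)" for W
        by (rule fls_eqI) (simp add: less.IH[OF k(2,3)])
      from star_hamiltonian_nth_scaled[OF sym G G this, of \<Lambda> Z] show ?thesis
        by (simp only: k fls_const_0 mult_zero_left)
    qed
    then show ?case using ode_nth[of k Z m] less.prems by (auto elim: oddE)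
  qed
  have F0: "F 0 = (\<lambda>Z. 1)"
  proof (rule ext, rule formal_eqI)
    fix Z k m
    show "coef (F 0) k m Z = fls_nth (fps_nth 1 k) m"
    proof (cases "k = 0")
      case True then show ?thesis unfolding coef_F by (simp add: G0)
    next
      case False
      then show ?thesis unfolding coef_F using odd[of k Z m] by (cases "k = 1") (auto simp: power_0_left)
    qed
  qed
  have der: "((\<lambda>s. coef (F s) k m Z) has_vector_derivative fls_nth (fps_nth (star \<Lambda> ?H (F t) Z) k) m) (at t)" for t Z k m
  proof (cases "k < 2")
    case True
    then have "k div 2 = 0" by simp
    then show ?thesis using True by (simp add: coef_F star_hamiltonian_nth_low[OF sym])
  next
    case False
    then obtain j where j: "k = j + 2" by (metis add.commute le_Suc_ex not_less)
    have "fps_nth (F t W) j = fls_const (of_real (t ^ (j div 2))) * fps_nth (G W) j" for W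
      by (simp add: F_def)
    from star_hamiltonian_nth_scaled[OF sym G FS this, of \<Lambda> Z]
    have st: "fls_nth (fps_nth (star \<Lambda> ?H (F t) Z) k) m = of_real (t ^ (j div 2)) * (of_nat k / 2 * coef G k m Z)"
      using ode_nth[of k Z m] by (simp add: j)
    show ?thesis
    proof (cases "odd k")
      case True
      then show ?thesis unfolding st coef_F by (simp add: odd)
    next
      case False
      then have kd: "k div 2 = Suc (j div 2)" "of_nat k / 2 = (of_nat (Suc (j div 2)) :: complex)"
        unfolding j by (auto elim!: evenE)
      have "((\<lambda>s. s ^ Suc (j div 2)) has_real_derivative of_nat (Suc (j div 2)) * t ^ (j div 2)) (at t)"
        using DERIV_pow[of "Suc (j div 2)" t UNIV] by simp
      then have "((\<lambda>s. of_real (s ^ Suc (j div 2)) :: complex) has_vector_derivative of_real (of_nat (Suc (j div 2)) * t ^ (j div 2))) (at t)"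
        by (intro has_vector_derivative_of_real) (simp add: has_real_derivative_iff_has_vector_derivative)
      from has_vector_derivative_mult_left[OF this, of "coef G k m Z"]
      show ?thesis unfolding st coef_F kd by (simp only: of_real_mult of_real_of_nat_eq mult_ac)
    qed
  qed
  show "star_flow \<Lambda> ?H F" unfolding star_flow_def using FS F0 der by blast
  show "F 1 = G" by (rule ext, rule formal_eqI) (simp add: coef_F)
qed

section \<open>Casimirs\<close>

lemma homog_mult: "homog a f Z * homog b g Z = homog (a + b) (\<lambda>Z. f Z * g Z) Z"
  by (simp add: homog_def const_mult power_add mult_ac)

lemma homog_sum: "(\<Sum>i\<in>I. homog k (f i) Z) = homog k (\<lambda>Z. \<Sum>i\<in>I. f i Z) Z"
proof -
  have "const (\<Sum>i\<in>I. f i Z) = (\<Sum>i\<in>I. const (f i Z))"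
    by (induction I rule: infinite_finite_induct) (simp_all add: const_add)
  then show ?thesis by (simp add: homog_def sum_distrib_right)
qed

lemma homog_nth_low: "n < k \<Longrightarrow> fps_nth (homog k f Z) n = 0"
  using monomial_homog[of k f Z] by (simp add: monomial_of_degree_def)

locale central_bivector = quadratic_bivector +
  assumes central: "(\<Sum>d\<in>UNIV. \<Lambda> c d Z * pd d (\<Lambda> a b) Z) = 0"
begin

lemma ham_coefficient: "ham \<Lambda> c (homog 2 (\<Lambda> a b)) Z = 0"
proof -
  have "fpd d (homog 2 (\<Lambda> a b)) = homog 1 (pd d (\<Lambda> a b))" for d
    using fpd_homog_Suc[of "\<Lambda> a b" 1 d] H0_2[of a b] by (simp add: numeral_2_eq_2)
  then have "ham \<Lambda> c (homog 2 (\<Lambda> a b)) Z = homog (2 + 1) (\<lambda>Z. \<Sum>d\<in>UNIV. \<Lambda> c d Z * pd d (\<Lambda> a b) Z) Z"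
    unfolding ham_def by (simp only: homog_mult homog_sum)
  then show ?thesis by (simp only: central) (simp add: homog_def)
qed

text \<open>The matrix functions below have entries of this kind, which lets them be treated as constants.\<close>
definition casimirs :: "'a formal set" where
  "casimirs = {F \<in> formal_sections. \<forall>a Z. ham \<Lambda> a F Z = 0}"

lemma casimirs_formal_sections: "F \<in> casimirs \<Longrightarrow> F \<in> formal_sections"
  and casimirs_ham: "F \<in> casimirs \<Longrightarrow> ham \<Lambda> a F Z = 0"
  by (simp_all add: casimirs_def)

lemma casimirs_const: "(\<lambda>Z. const c) \<in> casimirs" "(\<lambda>Z. 1) \<in> casimirs" "(\<lambda>Z. 0) \<in> casimirs"
  by (simp_all add: casimirs_def)

lemma casimirs_coefficient: "homog 2 (\<Lambda> a b) \<in> casimirs"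
  by (simp add: casimirs_def ham_coefficient formal_sections_homog H0_2)

lemma casimirs_mult: "F \<in> casimirs \<Longrightarrow> G \<in> casimirs \<Longrightarrow> (\<lambda>Z. F Z * G Z) \<in> casimirs"
  by (simp add: casimirs_def ham_mult formal_sections_mult)

lemma casimirs_sum: "(\<And>i. i \<in> I \<Longrightarrow> F i \<in> casimirs) \<Longrightarrow> (\<lambda>Z. \<Sum>i\<in>I. F i Z) \<in> casimirs"
  by (simp add: casimirs_def ham_sum formal_sections_sum)

lemma ham_nth:
  assumes F: "F \<in> formal_sections" and G: "G \<in> formal_sections"
    and eq: "\<And>k W. k \<le> n \<Longrightarrow> fps_nth (F W) k = fps_nth (G W) k"
  shows "fps_nth (ham \<Lambda> a F Z) n = fps_nth (ham \<Lambda> a G Z) n"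
proof (cases "n < 2")
  case False
  have "fps_nth (fpd b F Z) (n - 2) = fps_nth (fpd b G Z) (n - 2)" for b
    using fpd_scaled[OF G F, of "n - 2" 1] eq[of "Suc (n - 2)"] False by simp
  then show ?thesis
    unfolding ham_def fps_sum_nth monomial_mult_nth[OF monomial_homog] by (intro sum.cong refl) simp
qed (simp add: ham_def fps_sum_nth monomial_mult_nth[OF monomial_homog])

lemma ham_nth_low: "n < 2 \<Longrightarrow> fps_nth (ham \<Lambda> a F Z) n = 0"
  by (simp add: ham_def fps_sum_nth monomial_mult_nth[OF monomial_homog])

text \<open>
  Being a Casimir is a condition on each coefficient separately, so it survives the passage from
  polynomials in the entries of \<open>\<Lambda> A\<close> to power series.
\<close>
lemma casimirs_limit:
  assumes "\<And>n. \<exists>G\<in>casimirs. \<forall>k\<le>n. \<forall>W. fps_nth (F W) k = fps_nth (G W) k"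
  shows "F \<in> casimirs"
proof -
  have S: "F \<in> formal_sections"
    unfolding formal_sections_iff
  proof
    fix k
    obtain G where G: "G \<in> casimirs" "\<forall>j\<le>k. \<forall>W. fps_nth (F W) j = fps_nth (G W) j"
      using assms[of k] by blast
    have "coef F k m = coef G k m" for m using G(2) by simp
    then show "(\<forall>m. coef F k m \<in> H0 k) \<and> (\<exists>N. \<forall>m<N. \<forall>Z. coef F k m Z = 0)"
      using casimirs_formal_sections[OF G(1)] G(2) unfolding formal_sections_iff by simp
  qed
  have "ham \<Lambda> a F Z = 0" for a Z
  proof (rule fps_ext)
    fix n
    obtain G where G: "G \<in> casimirs" "\<forall>j\<le>n. \<forall>W. fps_nth (F W) j = fps_nth (G W) j"
      using assms[of n] by blast
    have "fps_nth (ham \<Lambda> a F Z) n = fps_nth (ham \<Lambda> a G Z) n"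
      by (rule ham_nth[OF S casimirs_formal_sections[OF G(1)]]) (use G(2) in blast)
    then show "fps_nth (ham \<Lambda> a F Z) n = fps_nth 0 n" by (simp add: casimirs_ham[OF G(1)])
  qed
  with S show ?thesis by (simp add: casimirs_def)
qed

lemma casimirs_matrix_mult:
  assumes "\<And>i j. (\<lambda>Z. M Z $ i $ j) \<in> casimirs" "\<And>i j. (\<lambda>Z. N Z $ i $ j) \<in> casimirs"
  shows "(\<lambda>Z. (M Z ** N Z) $ i $ j) \<in> casimirs"
  unfolding matrix_mult_nth by (intro casimirs_sum casimirs_mult assms)

lemma casimirs_matrix_power:
  assumes "\<And>i j. (\<lambda>Z. M Z $ i $ j) \<in> casimirs"
  shows "(\<lambda>Z. matrix_power (M Z) k $ i $ j) \<in> casimirs"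
proof (induction k arbitrary: i j)
  case 0
  then show ?case by (cases "i = j") (simp_all add: mat_nth casimirs_const)
next
  case (Suc k)
  then show ?case unfolding matrix_power_Suc by (intro casimirs_matrix_mult assms)
qed

lemma casimirs_matrix_series:
  assumes "\<And>Z. zero_constant_term (M Z)" "\<And>i j. (\<lambda>Z. M Z $ i $ j) \<in> casimirs"
  shows "(\<lambda>Z. matrix_series c (M Z) $ i $ j) \<in> casimirs"
proof (rule casimirs_limit)
  fix n
  show "\<exists>G\<in>casimirs. \<forall>k\<le>n. \<forall>W. fps_nth (matrix_series c (M W) $ i $ j) k = fps_nth (G W) k"
  proof (rule bexI)
    show "\<forall>k\<le>n. \<forall>W. fps_nth (matrix_series c (M W) $ i $ j) k
        = fps_nth ((\<lambda>W. \<Sum>k\<le>n. const (fps_nth c k) * matrix_power (M W) k $ i $ j) W) k"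
      using matrix_series_trunc[OF assms(1)] by blast
    show "(\<lambda>W. \<Sum>k\<le>n. const (fps_nth c k) * matrix_power (M W) k $ i $ j) \<in> casimirs"
      by (intro casimirs_sum casimirs_mult casimirs_const casimirs_matrix_power assms)
  qed
qed

text \<open>
  A chain rule for solutions of \<open>\<theta> G = u G\<close>, where \<open>G\<close> plays the role of \<open>exp \<integral> u\<close>: the condition on
  \<open>X\<^sub>a u\<close> says that \<open>p\<close> is \<open>X\<^sub>a\<close> of that integral.  The defect \<open>Y = X\<^sub>a G - p G\<close> satisfies
  \<open>\<theta> Y = (u + 1) Y\<close>, the summand \<open>1\<close> being the degree by which \<open>X\<^sub>a\<close> shifts.  In degree \<open>n\<close> this reads
  \<open>(n - 1) Y\<^sub>n =\<close> a combination of lower components, which is no information for \<open>n = 1\<close>; there \<open>Y\<close>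
  vanishes because \<open>X\<^sub>a G\<close> and \<open>p\<close> start in degree two.
\<close>
lemma ham_ode:
  assumes u: "u \<in> formal_sections" and p: "p \<in> formal_sections" and G: "G \<in> formal_sections"
    and u0: "\<And>Z. fps_nth (u Z) 0 = 0"
    and ode: "\<And>Z. theta (G Z) = u Z * G Z"
    and hu: "\<And>Z. ham \<Lambda> a u Z = theta (p Z) - p Z"
    and p0: "\<And>n Z. n < 2 \<Longrightarrow> fps_nth (p Z) n = 0"
  shows "ham \<Lambda> a G Z = p Z * G Z"
proof -
  define Y where "Y = ham \<Lambda> a G Z - p Z * G Z"
  have th_diff: "theta (x - y) = theta x - theta y" for x y :: scalar
    by (simp add: theta_def algebra_simps)
  have "theta (ham \<Lambda> a G Z) = ham \<Lambda> a (\<lambda>Z. u Z * G Z) Z + ham \<Lambda> a G Z"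
    unfolding ham_theta[OF G] ode ..
  also have "\<dots> = (theta (p Z) - p Z) * G Z + u Z * ham \<Lambda> a G Z + ham \<Lambda> a G Z"
    unfolding ham_mult[OF u G] hu ..
  finally have Yode: "theta Y = (u Z + 1) * Y"
    unfolding Y_def th_diff theta_mult ode by (simp add: algebra_simps)
  have "fps_nth Y n = 0" for n
  proof (induction n rule: less_induct)
    case (less n)
    show ?case
    proof (cases "n < 2")
      case True
      have "fps_nth (p Z * G Z) n = 0"
        unfolding fps_mult_nth using p0 True by (intro sum.neutral) auto
      then show ?thesis using ham_nth_low[OF True] by (simp add: Y_def)
    next
      case False
      have "fps_nth (u Z * Y) n = 0"
        unfolding fps_mult_nth
      proof (rule sum.neutral, rule ballI)
        fix i assume "i \<in> {0..n}"
        then show "fps_nth (u Z) i * fps_nth Y (n - i) = 0"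
          using u0 less by (cases "i = 0") auto
      qed
      moreover have "of_nat n * fps_nth Y n = fps_nth (u Z * Y) n + fps_nth Y n"
        using arg_cong[OF Yode, of "\<lambda>x. fps_nth x n"] by (simp add: distrib_right)
      ultimately have "(of_nat n - 1) * fps_nth Y n = 0" by (simp add: algebra_simps)
      moreover have "(of_nat n - 1 :: complex fls) \<noteq> 0"
      proof -
        obtain j where "n = Suc (Suc j)" using False by (metis One_nat_def less_2_cases_iff not0_implies_Suc)
        then have "(of_nat n - 1 :: complex fls) = of_nat (Suc j)" by simp
        then show ?thesis by (simp only: of_nat_neq_0 not_False_eq_True)
      qed
      ultimately show ?thesis by simp
    qed
  qed
  then have "Y = 0" by (simp add: fps_eq_iff)
  then show ?thesis by (simp add: Y_def)
qed

end

text \<open>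
  The equation \<open>\<theta> G = u G\<close> expresses \<open>k G\<^sub>k\<close> through the components of \<open>G\<close> of degree below \<open>k\<close>.  Feeding
  the truncation of \<open>G\<close>, a formal section by induction, into the product with \<open>u\<close> yields \<open>G\<^sub>k\<close>.
\<close>
lemma ode_formal_sections:
  assumes u: "u \<in> formal_sections" and u0: "\<And>Z. fps_nth (u Z) 0 = 0"
    and G0: "\<And>Z. fps_nth (G Z) 0 = 1" and ode: "\<And>Z. theta (G Z) = u Z * G Z"
  shows "G \<in> formal_sections"
proof -
  have "(\<forall>m. coef G k m \<in> H0 k) \<and> (\<exists>N. \<forall>m<N. \<forall>Z. coef G k m Z = 0)" for k
  proof (induction k rule: less_induct)
    case (less k)
    show ?case
    proof (cases "k = 0")
      case True
      have "coef G 0 m = coef (\<lambda>Z. 1) 0 m" for m by (simp add: G0)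
      then show ?thesis using formal_sections_1 unfolding formal_sections_iff True by metis
    next
      case False
      define F where "F = (\<lambda>Z. fps_cutoff k (G Z))"
      have "F \<in> formal_sections"
        unfolding formal_sections_iff
      proof
        fix j
        show "(\<forall>m. coef F j m \<in> H0 j) \<and> (\<exists>N. \<forall>m<N. \<forall>Z. coef F j m Z = 0)"
          by (cases "j < k") (use less in \<open>simp_all add: F_def\<close>)
      qed
      then have uF: "(\<lambda>Z. u Z * F Z) \<in> formal_sections" by (rule formal_sections_mult[OF u])
      have "fps_nth (u Z * G Z) k = fps_nth (u Z * F Z) k" for Z
        unfolding fps_mult_nth
      proof (rule sum.cong[OF refl])
        fix i assume "i \<in> {0..k}"
        then show "fps_nth (u Z) i * fps_nth (G Z) (k - i) = fps_nth (u Z) i * fps_nth (F Z) (k - i)"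
          using False u0 by (cases "i = 0") (auto simp: F_def)
      qed
      then have "of_nat k * fps_nth (G Z) k = fps_nth (u Z * F Z) k" for Z
        using arg_cong[OF ode, of "\<lambda>x. fps_nth x k" Z] by simp
      then have "of_nat k * coef G k m Z = coef (\<lambda>Z. u Z * F Z) k m Z" for m Z
        by (metis fls_of_nat_mult_nth)
      then have eq: "coef G k m = (\<lambda>Z. (1 / of_nat k) * coef (\<lambda>Z. u Z * F Z) k m Z)" for m
        using False by (simp add: fun_eq_iff field_simps)
      have "\<exists>N. \<forall>m<N. \<forall>Z. coef (\<lambda>Z. u Z * F Z) k m Z = 0"
        using uF unfolding formal_sections_iff by blast
      then obtain N where N: "\<And>m Z. m < N \<Longrightarrow> coef (\<lambda>Z. u Z * F Z) k m Z = 0" by blast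
      have "coef G k m Z = 0" if "m < N" for m Z
        using fun_cong[OF eq[of m], of Z] N[OF that, of Z] by simp
      then have "\<exists>N. \<forall>m<N. \<forall>Z. coef G k m Z = 0" by blast
      moreover have "coef G k m \<in> H0 k" for m
        unfolding eq by (rule H0_cmult) (rule formal_sections_H0[OF uF])
      ultimately show ?thesis by blast
    qed
  qed
  then show ?thesis unfolding formal_sections_iff by blast
qed

section \<open>Quadratic forms in the coordinates\<close>

definition mult_coord :: "scalar ^ 'n ^ 'n \<Rightarrow> 'n::finite \<Rightarrow> complex ^ 'n \<Rightarrow> scalar" where
  "mult_coord N a Z = (\<Sum>j\<in>UNIV. N $ a $ j * coord j Z)"

lemma quad_form_eq: "quad_form N Z = (\<Sum>a\<in>UNIV. coord a Z * mult_coord N a Z)"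
  by (simp add: quad_form_coord mult_coord_def sum_distrib_left mult_ac)

lemma mult_coord_mult: "mult_coord (N ** P) a Z = (\<Sum>b\<in>UNIV. N $ a $ b * mult_coord P b Z)"
  unfolding mult_coord_def matrix_mult_nth sum_distrib_left sum_distrib_right mult.assoc by (rule sum.swap)

lemma quad_form_transpose_mult:
  "quad_form (transpose N ** P) Z = (\<Sum>a\<in>UNIV. mult_coord N a Z * mult_coord P a Z)"
  unfolding quad_form_eq mult_coord_mult mult_coord_def[of N] sum_distrib_left sum_distrib_right
  by (subst sum.swap) (simp add: transpose_def mult_ac)

lemma quad_form_transpose: "quad_form (transpose N) Z = quad_form N Z"
proof -
  have "coord i Z * transpose N $ i $ j * coord j Z = coord j Z * N $ j $ i * coord i Z" for i j
    by (simp add: transpose_def mult_ac)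
  then show ?thesis unfolding quad_form_coord by (simp only:) (rule sum.swap)
qed

lemma quad_form_add: "quad_form (N + P) Z = quad_form N Z + quad_form P Z"
  by (simp add: quad_form_coord distrib_left distrib_right sum.distrib)

lemma quad_form_scale: "quad_form (scale_matrix c N) Z = c * quad_form N Z"
  by (simp add: quad_form_coord sum_distrib_left mult_ac)

lemma scale_matrix_mult: "scale_matrix c N ** P = scale_matrix c (N ** P)" "N ** scale_matrix c P = scale_matrix c (N ** P)"
  by (simp_all add: vec_eq_iff matrix_mult_nth sum_distrib_left mult_ac)

lemma trace_scale: "trace (scale_matrix c N) = c * trace N"
  by (simp add: trace_def sum_distrib_left)

section \<open>The star exponential of a quadratic form\<close>

locale central_star_exponential = central_bivector \<Lambda>
  for \<Lambda> :: "'n::finite \<Rightarrow> 'n \<Rightarrow> complex ^ 'n \<Rightarrow> complex" +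
  fixes A :: "complex ^ 'n ^ 'n"
  assumes skew: "\<Lambda> a b Z = - \<Lambda> b a Z" and sym: "transpose A = A"
begin

abbreviation L where "L \<equiv> Lambda_matrix \<Lambda>"
abbreviation A' where "A' \<equiv> const_matrix A"
abbreviation M where "M Z \<equiv> L Z ** A'"
text \<open>
  The functions of \<open>M = \<Lambda> A\<close> that enter the closed form.  \<open>phase_matrix\<close> is the matrix \<open>Q\<close> with
  \<open>\<Lambda> Q = tanh M\<close>, meaningful also for singular \<open>\<Lambda>\<close>.
\<close>
definition tanhc_M where "tanhc_M Z = matrix_series tanhc (M Z)"
definition tanh_M where "tanh_M Z = matrix_series (fps_X * tanhc) (M Z)"
definition phase_matrix where "phase_matrix Z = A' ** tanhc_M Z"
definition cosh_M where "cosh_M Z = matrix_series (fps_cos \<i>) (M Z)"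

lemma L_nth: "L Z $ a $ b = homog 2 (\<Lambda> a b) Z"
  by (simp add: Lambda_matrix_def)

lemma A'_nth: "A' $ i $ j = const (A $ i $ j)"
  by (simp add: const_matrix_def)

lemma transpose_A': "transpose A' = A'"
  by (simp add: vec_eq_iff A'_nth transpose_def symmetric_nth[OF sym])

lemma transpose_L: "transpose (L Z) = scale_matrix (const (- 1)) (L Z)"
proof -
  have "transpose (L Z) $ a $ b = scale_matrix (const (- 1)) (L Z) $ a $ b" for a b
    unfolding transpose_def vec_lambda_beta scale_matrix_nth L_nth homog_def skew[of b a Z]
    by (simp add: const_minus)
  then show ?thesis by (simp only: vec_eq_iff simp_thms)
qed

lemma zero_constant_term_M: "zero_constant_term (M Z)"
  by (simp add: zero_constant_term_def matrix_mult_nth L_nth A'_nth fps_sum_nth homog_nth_low)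

lemma zero_constant_term_AL: "zero_constant_term (A' ** L Z)"
  by (simp add: zero_constant_term_def matrix_mult_nth L_nth A'_nth fps_sum_nth homog_nth_low)

lemma theta_M: "theta (M Z $ i $ j) = 2 * M Z $ i $ j"
  by (simp add: matrix_mult_nth L_nth A'_nth theta_sum theta_mult theta_homog sum_distrib_left mult_ac)

lemma tanh_M_eq: "tanh_M Z = M Z ** tanhc_M Z" "tanh_M Z = tanhc_M Z ** M Z" "tanh_M Z = L Z ** phase_matrix Z"
proof -
  show 1: "tanh_M Z = M Z ** tanhc_M Z"
    unfolding tanh_M_def tanhc_M_def matrix_series_mult[OF zero_constant_term_M, symmetric] matrix_series_X[OF zero_constant_term_M] ..
  show "tanh_M Z = tanhc_M Z ** M Z"
    unfolding tanh_M_def tanhc_M_def mult.commute[of fps_X] matrix_series_mult[OF zero_constant_term_M, symmetric] matrix_series_X[OF zero_constant_term_M] ..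
  show "tanh_M Z = L Z ** phase_matrix Z" unfolding 1 phase_matrix_def by (simp add: matrix_mul_assoc)
qed

text \<open>
  Transposition replaces \<open>\<Lambda> A\<close> by \<open>- A \<Lambda>\<close>; the sign is absorbed because \<open>tanh x / x\<close> is even.
\<close>
lemma transpose_phase_matrix: "transpose (phase_matrix Z) = phase_matrix Z"
proof -
  have "transpose (phase_matrix Z) = transpose (tanhc_M Z) ** A'"
    by (simp add: phase_matrix_def matrix_transpose_mul transpose_A')
  also have "transpose (tanhc_M Z) = matrix_series tanhc (scale_matrix (const (- 1)) (A' ** L Z))"
    unfolding tanhc_M_def matrix_series_transpose[symmetric] matrix_transpose_mul transpose_A' transpose_L scale_matrix_mult ..
  also have "\<dots> = matrix_series tanhc (A' ** L Z)"
    unfolding matrix_series_scale tanhc_even ..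
  also have "\<dots> ** A' = phase_matrix Z"
    unfolding phase_matrix_def tanhc_M_def by (rule matrix_series_push[OF zero_constant_term_M zero_constant_term_AL, symmetric])
  finally show ?thesis .
qed

lemma transpose_tanh_M_A': "transpose (tanh_M Z) ** A' = scale_matrix (const (- 1)) (A' ** tanh_M Z)"
proof -
  have "transpose (tanh_M Z) ** A' = scale_matrix (const (- 1)) (phase_matrix Z ** L Z ** A')"
    unfolding tanh_M_eq(3) matrix_transpose_mul transpose_phase_matrix transpose_L scale_matrix_mult ..
  also have "phase_matrix Z ** L Z ** A' = A' ** (tanhc_M Z ** M Z)"
    unfolding phase_matrix_def by (simp only: matrix_mul_assoc)
  finally show ?thesis by (simp only: tanh_M_eq(2))
qed

text \<open>\<open>A tanh (\<Lambda> A)\<close> is skew-symmetric.\<close>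
lemma quad_form_A'_tanh_M: "quad_form (A' ** tanh_M Z) Z = 0"
proof -
  have "quad_form (A' ** tanh_M Z) Z = quad_form (transpose (A' ** tanh_M Z)) Z" by (simp only: quad_form_transpose)
  also have "\<dots> = - quad_form (A' ** tanh_M Z) Z"
    unfolding matrix_transpose_mul transpose_A' transpose_tanh_M_A' quad_form_scale by (simp add: const_minus)
  finally have "quad_form (A' ** tanh_M Z) Z + quad_form (A' ** tanh_M Z) Z = 0"
    unfolding eq_neg_iff_add_eq_0 .
  then have "2 * quad_form (A' ** tanh_M Z) Z = 0" by (simp only: mult_2)
  then show ?thesis by simp
qed

text \<open>
  \<open>closed_form\<close> is the right-hand side of the theorem and \<open>log_derivative\<close> its logarithmic derivative
  under the degree operator.
\<close>
definition phase where "phase Z = inv_mu * quad_form (phase_matrix Z) Z"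
definition log_derivative where "log_derivative Z = theta (phase Z) - trace (M Z ** tanh_M Z)"
definition closed_form where "closed_form Z = det_inv_sqrt (cosh_M Z) * formal_exp (phase Z)"

lemma casimirs_M: "(\<lambda>Z. M Z $ i $ j) \<in> casimirs"
  by (rule casimirs_matrix_mult) (simp_all add: L_nth A'_nth casimirs_coefficient casimirs_const)

lemma casimirs_tanh_M: "(\<lambda>Z. tanh_M Z $ i $ j) \<in> casimirs"
  unfolding tanh_M_def by (intro casimirs_matrix_series zero_constant_term_M casimirs_M)

lemma casimirs_phase_matrix: "(\<lambda>Z. phase_matrix Z $ i $ j) \<in> casimirs"
  unfolding phase_matrix_def tanhc_M_def
  by (intro casimirs_matrix_mult casimirs_matrix_series zero_constant_term_M casimirs_M) (simp add: A'_nth casimirs_const)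

lemma casimirs_trace: "(\<lambda>Z. - trace (M Z ** tanh_M Z)) \<in> casimirs"
proof -
  have "(\<lambda>Z. const (- 1) * trace (M Z ** tanh_M Z)) \<in> casimirs"
    unfolding trace_def
    by (intro casimirs_mult casimirs_const casimirs_sum casimirs_matrix_mult[of "\<lambda>Z. M Z" tanh_M] casimirs_M casimirs_tanh_M)
  then show ?thesis by (simp add: const_minus)
qed

lemma formal_sections_phase: "phase \<in> formal_sections"
proof -
  have "(\<lambda>Z. inv_mu * (\<Sum>i\<in>UNIV. \<Sum>j\<in>UNIV. coord i Z * phase_matrix Z $ i $ j * coord j Z)) \<in> formal_sections"
    by (intro formal_sections_mult formal_sections_sum formal_sections_inv_mu formal_sections_coord
        casimirs_formal_sections casimirs_phase_matrix)
  then show ?thesis unfolding phase_def quad_form_coord[symmetric] .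
qed

text \<open>
  Since the matrix \<open>Q\<close> in the exponent consists of Casimirs, only the coordinates are differentiated,
  as if \<open>\<Lambda>\<close> were constant.
\<close>
lemma ham_phase: "ham \<Lambda> a phase Z = 2 * inv_mu * mult_coord (tanh_M Z) a Z"
proof -
  note B_S = casimirs_formal_sections[OF casimirs_phase_matrix]
  have ham_coord': "ham \<Lambda> a (coord i) Z = L Z $ a $ i" for i
    unfolding coord_def ham_coord L_nth ..
  have B_sym: "phase_matrix Z $ i $ j = phase_matrix Z $ j $ i" for i j
    by (rule symmetric_nth) (rule transpose_phase_matrix)
  have S1: "(\<lambda>Z. coord i Z * phase_matrix Z $ i $ j * coord j Z) \<in> formal_sections" for i j
    by (intro formal_sections_mult formal_sections_coord B_S)
  have "ham \<Lambda> a phase Z = inv_mu * (\<Sum>i\<in>UNIV. \<Sum>j\<in>UNIV. ham \<Lambda> a (\<lambda>Z. coord i Z * phase_matrix Z $ i $ j * coord j Z) Z)"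
    unfolding phase_def quad_form_coord
    by (simp add: ham_mult ham_sum S1 formal_sections_sum)
  also have "\<dots> = inv_mu * (\<Sum>i\<in>UNIV. \<Sum>j\<in>UNIV. L Z $ a $ i * phase_matrix Z $ i $ j * coord j Z + L Z $ a $ j * phase_matrix Z $ j $ i * coord i Z)"
    by (simp add: ham_mult B_S formal_sections_mult casimirs_ham[OF casimirs_phase_matrix] ham_coord' B_sym mult_ac)
  also have "\<dots> = inv_mu * (2 * (\<Sum>i\<in>UNIV. \<Sum>j\<in>UNIV. L Z $ a $ i * phase_matrix Z $ i $ j * coord j Z))"
  proof -
    have swap: "(\<Sum>i\<in>UNIV. \<Sum>j\<in>UNIV. L Z $ a $ j * phase_matrix Z $ j $ i * coord i Z)
        = (\<Sum>i\<in>UNIV. \<Sum>j\<in>UNIV. L Z $ a $ i * phase_matrix Z $ i $ j * coord j Z)"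
      by (rule sum.swap)
    show ?thesis unfolding sum.distrib swap mult_2 ..
  qed
  also have "(\<Sum>i\<in>UNIV. \<Sum>j\<in>UNIV. L Z $ a $ i * phase_matrix Z $ i $ j * coord j Z) = mult_coord (tanh_M Z) a Z"
    unfolding tanh_M_eq(3) mult_coord_mult by (simp add: mult_coord_def sum_distrib_left mult_ac)
  finally show ?thesis by (simp add: mult_ac)
qed

lemma formal_sections_log_derivative: "log_derivative \<in> formal_sections"
proof -
  have "(\<lambda>Z. theta (phase Z) + (- trace (M Z ** tanh_M Z))) \<in> formal_sections"
    by (intro formal_sections_add formal_sections_theta formal_sections_phase casimirs_formal_sections casimirs_trace)
  then show ?thesis unfolding log_derivative_def by simp
qed

lemma zero_constant_term_tanh_M: "zero_constant_term (tanh_M Z)"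
  unfolding zero_constant_term_def tanh_M_def matrix_series_nth[OF zero_constant_term_M] by simp

lemma log_derivative_nth_0: "fps_nth (log_derivative Z) 0 = 0"
  using zero_constant_term_tanh_M[of Z] zero_constant_term_M[of Z]
  by (simp add: log_derivative_def trace_def fps_sum_nth matrix_mult_nth[of "M Z"] zero_constant_term_def)

lemma phase_nth_0: "fps_nth (phase Z) 0 = 0"
  by (simp add: phase_def quad_form_coord fps_sum_nth coord_def homog_nth_low)

lemma theta_cosh_M: "theta (cosh_M Z $ i $ j) = (scale_matrix 2 (M Z ** tanh_M Z) ** cosh_M Z) $ i $ j"
proof -
  have "matrix_series (theta (fps_cos \<i>)) (M Z) = (M Z ** tanh_M Z) ** cosh_M Z"
    unfolding theta_cosh tanh_M_def cosh_M_def matrix_series_mult[OF zero_constant_term_M, symmetric] matrix_series_X[OF zero_constant_term_M] ..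
  then show ?thesis
    unfolding cosh_M_def theta_matrix_series[OF zero_constant_term_M theta_M] scale_matrix_mult scale_matrix_nth
    by (simp add: cosh_M_def)
qed

lemma theta_det_factor:
  "theta (det_inv_sqrt (cosh_M Z)) = - trace (M Z ** tanh_M Z) * det_inv_sqrt (cosh_M Z)"
  "fps_nth (det_inv_sqrt (cosh_M Z)) 0 = 1"
proof -
  have D0: "fps_nth (det (cosh_M Z)) 0 = 1"
    by (rule det_nth_0) (simp add: cosh_M_def matrix_series_nth[OF zero_constant_term_M] mat_nth)
  have "theta (det (cosh_M Z)) = trace (scale_matrix 2 (M Z ** tanh_M Z)) * det (cosh_M Z)"
    by (rule theta_det_trace) (rule theta_cosh_M)
  note * = theta_det_inv_sqrt[OF D0 this]
  have "2 * theta (det_inv_sqrt (cosh_M Z)) = 2 * (- trace (M Z ** tanh_M Z) * det_inv_sqrt (cosh_M Z))"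
    unfolding *(1) trace_scale by simp
  then show "theta (det_inv_sqrt (cosh_M Z)) = - trace (M Z ** tanh_M Z) * det_inv_sqrt (cosh_M Z)"
    by (simp only: mult_cancel_left) simp
  show "fps_nth (det_inv_sqrt (cosh_M Z)) 0 = 1" by (rule *(2))
qed

lemma theta_closed_form: "theta (closed_form Z) = log_derivative Z * closed_form Z"
  unfolding closed_form_def theta_mult theta_det_factor theta_formal_exp(1)[OF phase_nth_0] log_derivative_def
  by (simp add: algebra_simps)

lemma closed_form_nth_0: "fps_nth (closed_form Z) 0 = 1"
  by (simp add: closed_form_def theta_det_factor theta_formal_exp(2)[OF phase_nth_0])

lemma formal_sections_closed_form: "closed_form \<in> formal_sections"
  using ode_formal_sections[OF formal_sections_log_derivative log_derivative_nth_0 closed_form_nth_0 theta_closed_form] .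

lemma ham_closed_form: "ham \<Lambda> a closed_form Z = ham \<Lambda> a phase Z * closed_form Z"
proof (rule ham_ode[OF formal_sections_log_derivative _ formal_sections_closed_form log_derivative_nth_0 theta_closed_form])
  show "ham \<Lambda> a phase \<in> formal_sections" by (intro formal_sections_ham formal_sections_phase)
  show "ham \<Lambda> a log_derivative Z = theta (ham \<Lambda> a phase Z) - ham \<Lambda> a phase Z" for Z
  proof -
    have "ham \<Lambda> a log_derivative Z = ham \<Lambda> a (\<lambda>Z. theta (phase Z) + (- trace (M Z ** tanh_M Z))) Z" by (simp add: log_derivative_def[abs_def])
    also have "\<dots> = ham \<Lambda> a (\<lambda>Z. theta (phase Z)) Z"
      using ham_add[OF formal_sections_theta[OF formal_sections_phase] casimirs_formal_sections[OF casimirs_trace]]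
      by (simp add: casimirs_ham[OF casimirs_trace])
    finally show ?thesis using ham_theta[OF formal_sections_phase] by simp
  qed
qed (rule ham_nth_low)

lemma formal_sections_mult_coord_tanh_M: "(\<lambda>Z. mult_coord (tanh_M Z) b Z) \<in> formal_sections"
  unfolding mult_coord_def
  by (intro formal_sections_sum formal_sections_mult formal_sections_coord casimirs_formal_sections casimirs_tanh_M)

lemma ham_mult_coord_tanh_M: "ham \<Lambda> a (\<lambda>Z. mult_coord (tanh_M Z) b Z) Z = (tanh_M Z ** transpose (L Z)) $ b $ a"
proof -
  have "ham \<Lambda> a (\<lambda>Z. mult_coord (tanh_M Z) b Z) Z = (\<Sum>j\<in>UNIV. tanh_M Z $ b $ j * ham \<Lambda> a (coord j) Z)"
    unfolding mult_coord_def
    by (simp add: ham_sum ham_mult formal_sections_mult casimirs_formal_sections[OF casimirs_tanh_M] casimirs_ham[OF casimirs_tanh_M])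
  moreover have "ham \<Lambda> a (coord j) Z = transpose (L Z) $ j $ a" for j
    unfolding coord_def ham_coord transpose_def L_nth vec_lambda_beta ..
  ultimately show ?thesis by (simp only: matrix_mult_nth)
qed

text \<open>
  The second-order part of the star product is a composition of Hamiltonian fields, because each of
  them kills the coefficients of the others.
\<close>
lemma second_derivatives:
  assumes F: "F \<in> formal_sections"
  shows "(\<Sum>c\<in>UNIV. \<Sum>d\<in>UNIV. homog 2 (\<Lambda> a c) Z * homog 2 (\<Lambda> b d) Z * fpd c (fpd d F) Z) = ham \<Lambda> a (ham \<Lambda> b F) Z"
proof -
  have "ham \<Lambda> a (ham \<Lambda> b F) Z = (\<Sum>d\<in>UNIV. ham \<Lambda> a (\<lambda>Z. homog 2 (\<Lambda> b d) Z * fpd d F Z) Z)"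
    unfolding ham_def[of \<Lambda> b]
    by (rule ham_sum) (intro formal_sections_mult formal_sections_homog H0_2 formal_sections_fpd F)
  also have "\<dots> = (\<Sum>d\<in>UNIV. homog 2 (\<Lambda> b d) Z * ham \<Lambda> a (fpd d F) Z)"
    by (simp add: ham_mult formal_sections_homog H0_2 formal_sections_fpd F ham_coefficient)
  also have "\<dots> = (\<Sum>c\<in>UNIV. \<Sum>d\<in>UNIV. homog 2 (\<Lambda> a c) Z * homog 2 (\<Lambda> b d) Z * fpd c (fpd d F) Z)"
    unfolding ham_def sum_distrib_left by (subst sum.swap) (simp only: mult_ac)
  finally show ?thesis ..
qed

lemma ham_ham_closed_form:
  "ham \<Lambda> a (ham \<Lambda> b closed_form) Z = (2 * inv_mu * (tanh_M Z ** transpose (L Z)) $ b $ a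
     + 4 * inv_mu * inv_mu * mult_coord (tanh_M Z) a Z * mult_coord (tanh_M Z) b Z) * closed_form Z"
proof -
  have two: "2 * inv_mu = fps_const (2 * fls_X)" by (simp add: inv_mu_def numeral_fps_const)
  have "ham \<Lambda> b closed_form = (\<lambda>Z. (fps_const (2 * fls_X) * mult_coord (tanh_M Z) b Z) * closed_form Z)"
    by (rule ext) (simp only: ham_closed_form ham_phase two)
  then have "ham \<Lambda> a (ham \<Lambda> b closed_form) Z
      = ham \<Lambda> a (\<lambda>Z. (fps_const (2 * fls_X) * mult_coord (tanh_M Z) b Z) * closed_form Z) Z"
    by (simp only:)
  also have "\<dots> = ham \<Lambda> a (\<lambda>Z. fps_const (2 * fls_X) * mult_coord (tanh_M Z) b Z) Z * closed_form Z
     + fps_const (2 * fls_X) * mult_coord (tanh_M Z) b Z * ham \<Lambda> a closed_form Z"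
    by (rule ham_mult)
       (intro formal_sections_mult formal_sections_fps_const formal_sections_mult_coord_tanh_M formal_sections_closed_form)+
  also have "ham \<Lambda> a (\<lambda>Z. fps_const (2 * fls_X) * mult_coord (tanh_M Z) b Z) Z
      = fps_const (2 * fls_X) * (tanh_M Z ** transpose (L Z)) $ b $ a"
    using ham_mult[OF formal_sections_fps_const formal_sections_mult_coord_tanh_M]
    by (simp add: ham_mult_coord_tanh_M)
  also have "ham \<Lambda> a closed_form Z = 2 * inv_mu * mult_coord (tanh_M Z) a Z * closed_form Z"
    by (simp only: ham_closed_form ham_phase)
  finally show ?thesis unfolding two[symmetric] by (simp add: algebra_simps)
qed

text \<open>
  The equation \<open>\<theta> (Q[Z]) = 2 (A - A tanh\<^sup>2 M)[Z]\<close>, with the last term written in the symmetric form in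
  which it comes out of the star product.
\<close>
lemma theta_phase: "theta (phase Z) = 2 * inv_mu * (quad_form A' Z + quad_form (transpose (tanh_M Z) ** A' ** tanh_M Z) Z)"
proof -
  define S' where "S' = matrix_series (theta tanhc) (M Z)"
  have "theta (quad_form (phase_matrix Z) Z) = 2 * (quad_form (phase_matrix Z) Z + quad_form (A' ** S') Z)"
  proof -
    have tB: "theta (phase_matrix Z $ i $ j) = 2 * (A' ** S') $ i $ j" for i j
      by (simp add: phase_matrix_def tanhc_M_def S'_def matrix_mult_nth[of A'] A'_nth theta_sum theta_mult
          theta_matrix_series[OF zero_constant_term_M theta_M] sum_distrib_left mult_ac)
    have tc: "theta (coord i Z) = coord i Z" for i
      by (simp add: coord_def theta_homog)
    show ?thesis
      unfolding quad_form_coord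
      by (simp add: theta_sum theta_mult tB tc sum_distrib_left sum.distrib[symmetric] algebra_simps)
  qed
  moreover have "quad_form A' Z = quad_form (phase_matrix Z) Z + quad_form (A' ** S') Z + quad_form (A' ** (tanh_M Z ** tanh_M Z)) Z"
  proof -
    have "(1 :: complex fps) = (tanhc + theta tanhc) + (fps_X * tanhc) * (fps_X * tanhc)"
      by (simp add: tanh_ode)
    then have "matrix_series 1 (M Z) = (tanhc_M Z + S') + tanh_M Z ** tanh_M Z"
      unfolding tanhc_M_def S'_def tanh_M_def matrix_series_mult[OF zero_constant_term_M] matrix_series_add[OF zero_constant_term_M, symmetric] by simp
    then have "A' ** mat 1 = A' ** tanhc_M Z + A' ** S' + A' ** (tanh_M Z ** tanh_M Z)"
      unfolding matrix_series_1[OF zero_constant_term_M] by (simp only: matrix_add_ldistrib)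
    then show ?thesis by (simp add: phase_matrix_def quad_form_add[symmetric])
  qed
  moreover have "quad_form (transpose (tanh_M Z) ** A' ** tanh_M Z) Z = - quad_form (A' ** (tanh_M Z ** tanh_M Z)) Z"
    unfolding transpose_tanh_M_A' scale_matrix_mult quad_form_scale matrix_mul_assoc by (simp add: const_minus)
  moreover have "theta (phase Z) = inv_mu * theta (quad_form (phase_matrix Z) Z)"
    by (simp add: phase_def theta_mult inv_mu_def)
  ultimately show ?thesis by simp
qed

lemma trace_identity: "(\<Sum>a\<in>UNIV. \<Sum>b\<in>UNIV. A' $ a $ b * (tanh_M Z ** transpose (L Z)) $ b $ a) = - trace (M Z ** tanh_M Z)"
proof -
  have "(\<Sum>a\<in>UNIV. \<Sum>b\<in>UNIV. A' $ a $ b * (tanh_M Z ** transpose (L Z)) $ b $ a) = trace (A' ** (tanh_M Z ** transpose (L Z)))"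
    by (simp add: trace_def matrix_mult_nth[of A'])
  also have "\<dots> = const (- 1) * trace (A' ** (tanh_M Z ** L Z))"
    unfolding transpose_L scale_matrix_mult trace_scale ..
  also have "trace (A' ** (tanh_M Z ** L Z)) = trace ((tanh_M Z ** L Z) ** A')" by (rule trace_mul_sym)
  also have "\<dots> = trace (tanh_M Z ** M Z)" by (simp only: matrix_mul_assoc)
  also have "\<dots> = trace (M Z ** tanh_M Z)" by (rule trace_mul_sym)
  finally show ?thesis by (simp add: const_minus)
qed

text \<open>
  After division by the closed form, the star product consists of \<open>A[Z]/\<mu>\<close>, a first-order term which
  vanishes because \<open>A tanh M\<close> is skew, the square of the first derivatives, which completes
  \<open>\<theta> (Q[Z]) / 2\<mu>\<close>, and the second derivatives of the exponent, which contribute half the logarithmic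
  derivative of the determinant factor.
\<close>
lemma star_closed_form: "theta (closed_form Z) = 2 * star \<Lambda> (hamiltonian A) closed_form Z"
proof -
  define m where "m = (\<lambda>a. mult_coord (tanh_M Z) a Z)"
  have half: "const (1/4) * mu * (2 * inv_mu) = const (1/2)" 
  proof -
    have "const (1/4) * 2 = const (1/2)" using const_mult[of "1/4" 2] const_numeral[of "num.Bit0 num.One"] by simp
    then show ?thesis using mu_inv_mu by (metis mult.assoc mult.commute mult.right_neutral)
  qed
  have one: "const (1/4) * mu * (4 * inv_mu * inv_mu) = inv_mu"
  proof -
    have "const (1/4) * 4 = 1" using const_mult[of "1/4" 4] const_numeral[of "num.Bit0 (num.Bit0 num.One)"] by simp
    then have "const (1/4) * 4 * (mu * inv_mu) * inv_mu = inv_mu" by (simp add: mu_inv_mu)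
    then show ?thesis by (simp only: mult_ac)
  qed
  have lin: "(\<Sum>j\<in>UNIV. const (A $ a $ j) * coord j Z) = mult_coord A' a Z" for a
    by (simp add: mult_coord_def A'_nth)
  have t1: "(\<Sum>a\<in>UNIV. (\<Sum>j\<in>UNIV. const (A $ a $ j) * coord j Z) * ham \<Lambda> a closed_form Z) = 0"
  proof -
    have "(\<Sum>a\<in>UNIV. (\<Sum>j\<in>UNIV. const (A $ a $ j) * coord j Z) * ham \<Lambda> a closed_form Z)
        = (\<Sum>a\<in>UNIV. mult_coord A' a Z * m a) * (2 * inv_mu * closed_form Z)"
      unfolding lin ham_closed_form ham_phase m_def sum_distrib_right by (simp only: mult_ac)
    also have "(\<Sum>a\<in>UNIV. mult_coord A' a Z * m a) = quad_form (A' ** tanh_M Z) Z"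
      unfolding m_def using quad_form_transpose_mult[of A' "tanh_M Z" Z] by (simp only: transpose_A')
    finally show ?thesis by (simp add: quad_form_A'_tanh_M)
  qed
  have Q: "(\<Sum>a\<in>UNIV. \<Sum>b\<in>UNIV. A' $ a $ b * (m a * m b)) = quad_form (transpose (tanh_M Z) ** A' ** tanh_M Z) Z"
    unfolding matrix_mul_assoc[symmetric] quad_form_transpose_mult mult_coord_mult m_def sum_distrib_left
    by (simp only: mult_ac)
  have "const (1/4) * mu * (\<Sum>a\<in>UNIV. \<Sum>b\<in>UNIV. const (A $ a $ b) * ham \<Lambda> a (ham \<Lambda> b closed_form) Z)
     = (\<Sum>a\<in>UNIV. \<Sum>b\<in>UNIV. (const (1/4) * mu * (2 * inv_mu)) * (A' $ a $ b * (tanh_M Z ** transpose (L Z)) $ b $ a) * closed_form Z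
        + (const (1/4) * mu * (4 * inv_mu * inv_mu)) * (A' $ a $ b * (m a * m b)) * closed_form Z)"
    unfolding ham_ham_closed_form A'_nth m_def sum_distrib_left
    by (intro sum.cong refl) (simp only: distrib_left distrib_right mult_ac)
  also have "\<dots> = const (1/2) * (- trace (M Z ** tanh_M Z)) * closed_form Z + inv_mu * quad_form (transpose (tanh_M Z) ** A' ** tanh_M Z) Z * closed_form Z"
    unfolding half one sum.distrib trace_identity[symmetric] Q[symmetric] sum_distrib_left sum_distrib_right ..
  finally have t2: "const (1/4) * mu * (\<Sum>a\<in>UNIV. \<Sum>b\<in>UNIV. const (A $ a $ b) * ham \<Lambda> a (ham \<Lambda> b closed_form) Z)
      = const (1/2) * (- trace (M Z ** tanh_M Z)) * closed_form Z + inv_mu * quad_form (transpose (tanh_M Z) ** A' ** tanh_M Z) Z * closed_form Z" .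
  have c2: "2 * const (1/2) = 1"
    using const_mult[of 2 "1/2"] const_numeral[of "num.Bit0 num.One"] by simp
  have "2 * star \<Lambda> (hamiltonian A) closed_form Z
      = 2 * inv_mu * quad_form A' Z * closed_form Z + (2 * const (1/2)) * (- trace (M Z ** tanh_M Z)) * closed_form Z
        + 2 * inv_mu * quad_form (transpose (tanh_M Z) ** A' ** tanh_M Z) Z * closed_form Z"
    unfolding star_hamiltonian[OF sym] second_derivatives[OF formal_sections_closed_form] t1 t2 by (simp only: distrib_left mult_zero_left add_0_left add_0_right mult_ac add_ac)
  then show ?thesis
    unfolding theta_closed_form log_derivative_def theta_phase c2 by (simp add: algebra_simps)
qed

lemma star_exp_closed_form: "\<exists>!F. star_flow \<Lambda> (hamiltonian A) F" "star_exp \<Lambda> (hamiltonian A) = closed_form"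
proof -
  from star_flow_of_grading[OF sym formal_sections_closed_form closed_form_nth_0 star_closed_form]
  obtain F where F: "star_flow \<Lambda> (hamiltonian A) F" "F 1 = closed_form" by blast
  then show ex1: "\<exists>!F. star_flow \<Lambda> (hamiltonian A) F" using star_flow_unique[OF sym] by blast
  have "(THE F. star_flow \<Lambda> (hamiltonian A) F) = F"
    by (rule the1_equality[OF ex1]) (rule F(1))
  then show "star_exp \<Lambda> (hamiltonian A) = closed_form"
    unfolding star_exp_def by (simp only: F(2))
qed

lemma closed_form_eq: "closed_form Z = det_inv_sqrt (scale_matrix (const (1 / 2)) (matrix_exp (M Z) + matrix_exp (- M Z)))
            * formal_exp (inv_mu * quad_form (Lambda_inv_tan (L Z) A') Z)"
proof -
  have neg: "- M Z = scale_matrix (const (- 1)) (M Z)"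
    by (simp add: vec_eq_iff const_minus)
  have "matrix_exp (- M Z) = matrix_series (fps_exp (- 1)) (M Z)"
    unfolding matrix_exp_def neg matrix_series_scale by simp
  then have "scale_matrix (const (1 / 2)) (matrix_exp (M Z) + matrix_exp (- M Z)) = cosh_M Z"
    unfolding cosh_M_def cosh_eq[symmetric] matrix_exp_def
    by (simp add: matrix_series_smult[OF zero_constant_term_M] matrix_series_add[OF zero_constant_term_M])
  moreover have "Lambda_inv_tan (L Z) A' = phase_matrix Z"
    unfolding Lambda_inv_tan_def phase_matrix_def tanhc_M_def matrix_series_scale tanhc_def ..
  ultimately show ?thesis by (simp add: closed_form_def phase_def)
qed

end

theorem theorem1p3:
  fixes \<Lambda> :: "'n::finite \<Rightarrow> 'n \<Rightarrow> complex ^ 'n \<Rightarrow> complex"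
    and A :: "complex ^ 'n ^ 'n"
  assumes order_zero: "\<And>\<alpha> \<beta>. \<Lambda> \<alpha> \<beta> \<in> H0 2"
    and skew: "\<And>\<alpha> \<beta> Z. \<Lambda> \<alpha> \<beta> Z = - \<Lambda> \<beta> \<alpha> Z"
    and jacobi: "jacobi_rule \<Lambda>"
    and arrows: "\<And>k a b f g. 1 \<le> k \<Longrightarrow> f \<in> H0 a \<Longrightarrow> g \<in> H0 b \<Longrightarrow>
      arrow_product \<Lambda> k f g = normal_ordered_product \<Lambda> k f g"
    and symmetric: "transpose A = A"
  shows "(\<exists>!F. star_flow \<Lambda> (\<lambda>Z. inv_mu * quad_form (const_matrix A) Z) F)
    \<and> star_exp \<Lambda> (\<lambda>Z. inv_mu * quad_form (const_matrix A) Z)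
        = (\<lambda>Z. let L = Lambda_matrix \<Lambda> Z; A' = const_matrix A in
            det_inv_sqrt (scale_matrix (const (1 / 2)) (matrix_exp (L ** A') + matrix_exp (- (L ** A'))))
            * formal_exp (inv_mu * quad_form (Lambda_inv_tan L A') Z))
    \<and> star_exp \<Lambda> (\<lambda>Z. inv_mu * quad_form (const_matrix A) Z) \<in> formal_sections"
proof -
  have central: "(\<Sum>d\<in>UNIV. \<Lambda> c d Z * pd d (\<Lambda> a b) Z) = 0" for a b c Z
    by (rule coefficients_central[OF order_zero skew jacobi arrows]) auto
  interpret central_star_exponential \<Lambda> A
    by unfold_locales (rule order_zero central skew symmetric)+
  show ?thesis
    using star_exp_closed_form formal_sections_closed_form unfolding Let_def closed_form_eq[symmetric] by simp
qed

end
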